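(* Let $X\in\mathrm{Alex}(k)$ and let $F\subseteq X$ be a closed subset. Then $F$ is quasi-convex in $X$ if and only if the following holds for any two distinct points $p,r\in F$ and any $\eta\in\Sigma_pX$: there exist $\zeta\in\Uparrow_p^r$ and $\xi\in\Sigma_pF$ with $|\eta\xi|\leqslant\frac{\pi}{2}$ such that $$\cos|\eta\zeta|\geqslant\cos|\eta\xi|\cos|\zeta\xi|,$$ where, if $\Sigma_pF=\emptyset$ (i.e. $p$ is an isolated point of $F$), this condition is understood to mean that there exists $\zeta\in\Uparrow_p^r$ with $\cos|\eta\zeta|\geqslant 0$.
   Context: $\mathrm{Alex}(k)$ is the set of complete, finite-dimensional Alexandrov spaces with curvature $\geqslant k$ ($k\in\mathbb R$). For points $p,q\in X$, $|pq|$ is the distance and $[pq]$ a minimal geodesic (shortest path) between them. $\Sigma_pX$ is the space of directions of $X$ at $p$, and $|\cdot\,\cdot|$ also denotes its distance. For $q\ne p$, $\uparrow_p^q$ is the direction at $p$ of a given $[pq]$, and $\Uparrow_p^q\subseteq\Sigma_pX$ is the closed set of directions at $p$ of all minimal geodesics from $p$ to $q$. For subsets $A,B\subseteq\Sigma_pX$, $|AB|$ is the distance between them (infimum of distances). For $F\subseteq X$ and $p\in F$, $\Sigma_pF$ is the set of $\xi\in\Sigma_pX$ for which there are points $p_i\in F\setminus\{p\}$ with $p_i\to p$ and directions $\uparrow_p^{p_i}\to\xi$. Quasi-convex: a closed subset $F\subseteq X$ is quasi-convex in $X$ if whenever $q\in X\setminus F$ and the distance function $\mathrm{dist}_q|_F$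 attains its minimum at $p\in F$, then $|\Uparrow_p^q\Uparrow_p^r|\leqslant\frac{\pi}{2}$ for all $r\in F\setminus\{p\}$ (because $q$ is arbitrary, this is equivalent to $|\uparrow_p^q\Uparrow_p^r|\leqslant\frac{\pi}{2}$ for every $[pq]$). By convention the empty set and single points are quasi-convex. *)

theory Defs
  imports "HOL-Analysis.Analysis"
begin

section \<open>Length spaces\<close>

definition curve_length :: "'a metric \<Rightarrow> (real \<Rightarrow> 'a) \<Rightarrow> ennreal" where
  "curve_length X \<gamma> =
     (SUP ts \<in> {ts. sorted ts \<and> set ts \<subseteq> {0..1}}.
        \<Sum>i < length ts - 1. ennreal (mdist X (\<gamma> (ts ! i)) (\<gamma> (ts ! Suc i))))"

definition length_space :: "'a metric \<Rightarrow> bool" where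
  "length_space X \<longleftrightarrow>
     (\<forall>x \<in> mspace X. \<forall>y \<in> mspace X.
        ennreal (mdist X x y) =
          (INF \<gamma> \<in> {\<gamma>. pathin (mtopology_of X) \<gamma> \<and> \<gamma> 0 = x \<and> \<gamma> 1 = y}. curve_length X \<gamma>))"

section \<open>Hausdorff dimension\<close>

definition mdiam :: "'a metric \<Rightarrow> 'a set \<Rightarrow> ennreal" where
  "mdiam X A = (SUP x \<in> A. SUP y \<in> A. ennreal (mdist X x y))"

definition hausdorff_measure :: "'a metric \<Rightarrow> real \<Rightarrow> 'a set \<Rightarrow> ennreal" where
  "hausdorff_measure X s A =
     (SUP \<delta> \<in> {0<..}.
        INF U \<in> {U :: nat \<Rightarrow> 'a set.
                  (\<forall>i. U i \<subseteq> mspace X \<and> mdiam X (U i) \<le> ennreal \<delta>) \<and> A \<subseteq> (\<Union>i. U i)}.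
          \<Sum>i. ennreal (enn2real (mdiam X (U i)) powr s))"

text \<open>
  Only exponents \<open>s > 0\<close> are used, because \<open>0 powr 0 = 0\<close> would make every countable set
  null in dimension \<open>0\<close>. The infimum of the empty set is \<open>\<infinity>\<close>.
\<close>

definition hausdorff_dim :: "'a metric \<Rightarrow> ereal" where
  "hausdorff_dim X = Inf {ereal s | s. 0 < s \<and> hausdorff_measure X s (mspace X) = 0}"

section \<open>Alexandrov spaces\<close>

text \<open>
  \<open>model_angle k a b c\<close> is the angle between the sides of length \<open>a\<close> and \<open>b\<close> of the triangle
  with side lengths \<open>a, b, c\<close> in the simply connected surface of constant curvature \<open>k\<close>,
  given by the law of cosines. It is meaningful if \<open>a, b > 0\<close>, the triangle inequalities hold
  and, for \<open>k > 0\<close>, the perimeter is less than \<open>2 pi / sqrt k\<close>.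
\<close>

definition model_angle :: "real \<Rightarrow> real \<Rightarrow> real \<Rightarrow> real \<Rightarrow> real" where
  "model_angle k a b c =
     (if k = 0 then arccos ((a\<^sup>2 + b\<^sup>2 - c\<^sup>2) / (2 * a * b))
      else if k > 0 then
        arccos ((cos (sqrt k * c) - cos (sqrt k * a) * cos (sqrt k * b))
                / (sin (sqrt k * a) * sin (sqrt k * b)))
      else
        arccos ((cosh (sqrt (- k) * a) * cosh (sqrt (- k) * b) - cosh (sqrt (- k) * c))
                / (sinh (sqrt (- k) * a) * sinh (sqrt (- k) * b))))"

definition comparison_angle :: "'a metric \<Rightarrow> real \<Rightarrow> 'a \<Rightarrow> 'a \<Rightarrow> 'a \<Rightarrow> real" where
  "comparison_angle X k p x y = model_angle k (mdist X p x) (mdist X p y) (mdist X x y)"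

definition comparison_angle_defined :: "'a metric \<Rightarrow> real \<Rightarrow> 'a \<Rightarrow> 'a \<Rightarrow> 'a \<Rightarrow> bool" where
  "comparison_angle_defined X k p x y \<longleftrightarrow>
     x \<noteq> p \<and> y \<noteq> p \<and>
     (k > 0 \<longrightarrow> mdist X p x + mdist X p y + mdist X x y < 2 * pi / sqrt k)"

definition quadruple_condition :: "'a metric \<Rightarrow> real \<Rightarrow> bool" where
  "quadruple_condition X k \<longleftrightarrow>
     (\<forall>p \<in> mspace X. \<forall>x \<in> mspace X. \<forall>y \<in> mspace X. \<forall>z \<in> mspace X.
        comparison_angle_defined X k p x y \<and>
        comparison_angle_defined X k p y z \<and>
        comparison_angle_defined X k p z x \<longrightarrow>
          comparison_angle X k p x y + comparison_angle X k p y z + comparison_angle X k p z x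
            \<le> 2 * pi)"

text \<open>
  The diameter clause is the usual convention for \<open>k > 0\<close>. It only matters in dimension one,
  where it excludes long circles, long segments, rays and lines; in higher dimensions it
  follows from the other conditions.
\<close>

definition Alex :: "real \<Rightarrow> 'a metric set" where
  "Alex k =
     {X. mspace X \<noteq> {} \<and> mcomplete_of X \<and> length_space X \<and> hausdorff_dim X < \<infinity> \<and>
         quadruple_condition X k \<and>
         (k > 0 \<longrightarrow> (\<forall>x \<in> mspace X. \<forall>y \<in> mspace X. mdist X x y \<le> pi / sqrt k))}"

section \<open>Minimal geodesics and angles\<close>

definition unit_speed_minimal :: "'a metric \<Rightarrow> real \<Rightarrow> (real \<Rightarrow> 'a) \<Rightarrow> bool" where
  "unit_speed_minimal X l \<gamma> \<longleftrightarrow>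
     \<gamma> ` {0..l} \<subseteq> mspace X \<and> (\<forall>s \<in> {0..l}. \<forall>t \<in> {0..l}. mdist X (\<gamma> s) (\<gamma> t) = \<bar>s - t\<bar>)"

definition minimal_geodesics :: "'a metric \<Rightarrow> 'a \<Rightarrow> 'a \<Rightarrow> (real \<Rightarrow> 'a) set" where
  "minimal_geodesics X p q =
     {\<gamma>. \<gamma> 0 = p \<and> \<gamma> (mdist X p q) = q \<and> unit_speed_minimal X (mdist X p q) \<gamma>}"

definition geodesics_from :: "'a metric \<Rightarrow> 'a \<Rightarrow> (real \<Rightarrow> 'a) set" where
  "geodesics_from X p = {\<gamma>. \<gamma> 0 = p \<and> (\<exists>l > 0. unit_speed_minimal X l \<gamma>)}"

text \<open>
  The limit exists in every space of curvature bounded below, and it is the same for the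
  comparison angles of any other model curvature. It depends only on the germs of the two
  geodesics, so the values of \<open>\<gamma>\<close> and \<open>\<sigma>\<close> away from \<open>0\<close> are irrelevant.
\<close>

definition geodesic_angle :: "'a metric \<Rightarrow> 'a \<Rightarrow> (real \<Rightarrow> 'a) \<Rightarrow> (real \<Rightarrow> 'a) \<Rightarrow> real" where
  "geodesic_angle X p \<gamma> \<sigma> =
     Lim (at_right 0 \<times>\<^sub>F at_right 0) (\<lambda>(s, t). comparison_angle X 0 p (\<gamma> s) (\<sigma> t))"

section \<open>The completion of a pseudometric\<close>

text \<open>
  Cauchy sequences modulo null distance. For a pseudometric this performs both the
  identification of points at distance \<open>0\<close> and the completion.
\<close>

definition cauchy_seqs :: "'b set \<Rightarrow> ('b \<Rightarrow> 'b \<Rightarrow> real) \<Rightarrow> (nat \<Rightarrow> 'b) set" where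
  "cauchy_seqs S d =
     {u. range u \<subseteq> S \<and> (\<forall>e > 0. \<exists>N. \<forall>m \<ge> N. \<forall>n \<ge> N. d (u m) (u n) < e)}"

definition cauchy_rel :: "'b set \<Rightarrow> ('b \<Rightarrow> 'b \<Rightarrow> real) \<Rightarrow> (nat \<Rightarrow> 'b) rel" where
  "cauchy_rel S d =
     {(u, v). u \<in> cauchy_seqs S d \<and> v \<in> cauchy_seqs S d \<and> (\<lambda>n. d (u n) (v n)) \<longlonglongrightarrow> 0}"

definition completion :: "'b set \<Rightarrow> ('b \<Rightarrow> 'b \<Rightarrow> real) \<Rightarrow> (nat \<Rightarrow> 'b) set set" where
  "completion S d = cauchy_seqs S d // cauchy_rel S d"

definition completion_dist ::
    "('b \<Rightarrow> 'b \<Rightarrow> real) \<Rightarrow> (nat \<Rightarrow> 'b) set \<Rightarrow> (nat \<Rightarrow> 'b) set \<Rightarrow> real" where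
  "completion_dist d A B = lim (\<lambda>n. d ((SOME u. u \<in> A) n) ((SOME v. v \<in> B) n))"

definition completion_point :: "'b set \<Rightarrow> ('b \<Rightarrow> 'b \<Rightarrow> real) \<Rightarrow> 'b \<Rightarrow> (nat \<Rightarrow> 'b) set" where
  "completion_point S d x = cauchy_rel S d `` {\<lambda>n. x}"

text \<open>The distance does not depend on the chosen representatives.\<close>

lemma completion_dist_limit:
  assumes nonneg: "\<And>x y. x \<in> S \<Longrightarrow> y \<in> S \<Longrightarrow> 0 \<le> d x y"
    and refl: "\<And>x. x \<in> S \<Longrightarrow> d x x = 0"
    and sym: "\<And>x y. x \<in> S \<Longrightarrow> y \<in> S \<Longrightarrow> d x y = d y x"
    and tri: "\<And>x y z. x \<in> S \<Longrightarrow> y \<in> S \<Longrightarrow> z \<in> S \<Longrightarrow> d x z \<le> d x y + d y z"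
    and u: "u \<in> cauchy_seqs S d" and v: "v \<in> cauchy_seqs S d"
  shows "(\<lambda>n. d (u n) (v n)) \<longlonglongrightarrow>
           completion_dist d (cauchy_rel S d `` {u}) (cauchy_rel S d `` {v})"
proof -
  define u' where "u' = (SOME w. w \<in> cauchy_rel S d `` {u})"
  define v' where "v' = (SOME w. w \<in> cauchy_rel S d `` {v})"
  have mem: "w n \<in> S" if "w \<in> cauchy_seqs S d" for w n
    using that by (auto simp: cauchy_seqs_def)
  have self: "w \<in> cauchy_rel S d `` {w}" if "w \<in> cauchy_seqs S d" for w
    using that refl mem by (simp add: cauchy_rel_def)
  have "u' \<in> cauchy_rel S d `` {u}"
    using someI[of "\<lambda>w. w \<in> cauchy_rel S d `` {u}", OF self[OF u]] by (simp only: u'_def)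
  moreover have "v' \<in> cauchy_rel S d `` {v}"
    using someI[of "\<lambda>w. w \<in> cauchy_rel S d `` {v}", OF self[OF v]] by (simp only: v'_def)
  ultimately have u': "u' \<in> cauchy_seqs S d" "(\<lambda>n. d (u n) (u' n)) \<longlonglongrightarrow> 0"
    and v': "v' \<in> cauchy_seqs S d" "(\<lambda>n. d (v n) (v' n)) \<longlonglongrightarrow> 0"
    by (auto simp: cauchy_rel_def)
  have quad: "\<bar>d a b - d a' b'\<bar> \<le> d a a' + d b b'"
    if "a \<in> S" "b \<in> S" "a' \<in> S" "b' \<in> S" for a b a' b'
    using that tri[of a a' b] tri[of a' b' b] tri[of a' a b'] tri[of a b b']
      sym[of a a'] sym[of b b'] by linarith
  have "Cauchy (\<lambda>n. d (u n) (v n))"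
  proof (rule metric_CauchyI)
    fix e :: real assume "e > 0"
    then have "e / 2 > 0" by simp
    with u v have "\<exists>M. \<forall>m \<ge> M. \<forall>n \<ge> M. d (u m) (u n) < e / 2"
      "\<exists>N. \<forall>m \<ge> N. \<forall>n \<ge> N. d (v m) (v n) < e / 2"
      unfolding cauchy_seqs_def mem_Collect_eq by metis+
    then obtain M N where M: "\<And>m n. m \<ge> M \<Longrightarrow> n \<ge> M \<Longrightarrow> d (u m) (u n) < e / 2"
      and N: "\<And>m n. m \<ge> N \<Longrightarrow> n \<ge> N \<Longrightarrow> d (v m) (v n) < e / 2"
      by metis
    have "dist (d (u m) (v m)) (d (u n) (v n)) < e" if "m \<ge> max M N" "n \<ge> max M N" for m n
      using quad[OF mem[OF u] mem[OF v] mem[OF u] mem[OF v], of m m n n] M[of m n] N[of m n] that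
      by (simp add: dist_real_def)
    then show "\<exists>K. \<forall>m \<ge> K. \<forall>n \<ge> K. dist (d (u m) (v m)) (d (u n) (v n)) < e"
      by blast
  qed
  then obtain L where L: "(\<lambda>n. d (u n) (v n)) \<longlonglongrightarrow> L"
    using convergent_eq_Cauchy convergent_def by blast
  have "(\<lambda>n. d (u n) (u' n) + d (v n) (v' n)) \<longlonglongrightarrow> 0"
    using tendsto_add[OF u'(2) v'(2)] by simp
  then have "(\<lambda>n. d (u n) (v n) - d (u' n) (v' n)) \<longlonglongrightarrow> 0"
    by (rule Lim_null_comparison[rotated])
      (simp add: quad mem u v u'(1) v'(1))
  from tendsto_diff[OF L this] have "(\<lambda>n. d (u' n) (v' n)) \<longlonglongrightarrow> L"
    by simp
  then have "completion_dist d (cauchy_rel S d `` {u}) (cauchy_rel S d `` {v}) = L"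
    unfolding completion_dist_def u'_def[symmetric] v'_def[symmetric] by (rule limI)
  with L show ?thesis by simp
qed

section \<open>Spaces of directions\<close>

type_synonym 'a direction = "(nat \<Rightarrow> real \<Rightarrow> 'a) set"

definition directions :: "'a metric \<Rightarrow> 'a \<Rightarrow> 'a direction set" where
  "directions X p = completion (geodesics_from X p) (geodesic_angle X p)"

definition dir_dist :: "'a metric \<Rightarrow> 'a \<Rightarrow> 'a direction \<Rightarrow> 'a direction \<Rightarrow> real" where
  "dir_dist X p = completion_dist (geodesic_angle X p)"

definition dir_of :: "'a metric \<Rightarrow> 'a \<Rightarrow> (real \<Rightarrow> 'a) \<Rightarrow> 'a direction" where
  "dir_of X p = completion_point (geodesics_from X p) (geodesic_angle X p)"

definition dirs_to :: "'a metric \<Rightarrow> 'a \<Rightarrow> 'a \<Rightarrow> 'a direction set" where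
  "dirs_to X p q = dir_of X p ` minimal_geodesics X p q"

definition dir_set_dist :: "'a metric \<Rightarrow> 'a \<Rightarrow> 'a direction set \<Rightarrow> 'a direction set \<Rightarrow> real" where
  "dir_set_dist X p A B = Inf {dir_dist X p \<alpha> \<beta> | \<alpha> \<beta>. \<alpha> \<in> A \<and> \<beta> \<in> B}"

definition directions_of_subset :: "'a metric \<Rightarrow> 'a \<Rightarrow> 'a set \<Rightarrow> 'a direction set" where
  "directions_of_subset X p F =
     {\<xi> \<in> directions X p. \<exists>x \<nu>.
        (\<forall>i :: nat. x i \<in> F - {p} \<and> \<nu> i \<in> dirs_to X p (x i)) \<and>
        limitin (mtopology_of X) x p sequentially \<and>
        (\<lambda>i. dir_dist X p (\<nu> i) \<xi>) \<longlonglongrightarrow> 0}"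

section \<open>Quasi-convex subsets\<close>

definition quasi_convex :: "'a metric \<Rightarrow> 'a set \<Rightarrow> bool" where
  "quasi_convex X F \<longleftrightarrow>
     closedin (mtopology_of X) F \<and>
     (\<forall>q \<in> mspace X - F. \<forall>p \<in> F.
        (\<forall>x \<in> F. mdist X q p \<le> mdist X q x) \<longrightarrow>
        (\<forall>r \<in> F - {p}. dir_set_dist X p (dirs_to X p q) (dirs_to X p r) \<le> pi / 2))"

lemma quasi_convex_empty: "quasi_convex X {}"
  by (simp add: quasi_convex_def)

lemma quasi_convex_singleton:
  assumes "p \<in> mspace X"
  shows "quasi_convex X {p}"
proof -
  have "Hausdorff_space (mtopology_of X)"
    by (simp add: mtopology_of_def Metric_space.Hausdorff_space_mtopology)
  with assms show ?thesis
    by (simp add: quasi_convex_def closedin_Hausdorff_singleton)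
qed

end

theory Submission
  imports Defs "HOL-Probability.Infinite_Product_Measure"
begin

text \<open>
  Finite Hausdorff dimension forces a doubling property: points are pulled towards a given point along
  almost geodesics, so many separated points in one ball reappear at every location and scale and would
  span a Cantor set of large dimension. Hence the space is proper, minimal geodesics exist and the spaces
  of directions are compact. Limits are taken along a fixed nonprincipal ultrafilter, which replaces the
  passage to subsequences.

  If the condition holds and \<open>p\<close> is nearest to \<open>q\<close>, then the first variation inequality gives
  \<open>|\<eta> \<xi>| \<ge> \<pi>/2\<close> for the direction \<open>\<eta>\<close> of \<open>[pq]\<close> and all \<open>\<xi> \<in> \<Sigma>\<^sub>p F\<close>, so \<open>cos |\<eta> \<xi>| = 0\<close> and
  \<open>cos |\<eta> \<zeta>| \<ge> 0\<close>. Conversely, let \<open>\<eta>\<close> be the direction of a geodesic \<open>\<gamma>\<close> and let \<open>y\<^sub>t \<in> F\<close> be nearest to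
  \<open>\<gamma> t\<close>. If \<open>y\<^sub>t = p\<close> for some \<open>t\<close>, quasi-convexity applies at \<open>p\<close>. Otherwise \<open>\<xi>\<close> is a limit of the directions
  from \<open>p\<close> to \<open>y\<^sub>t\<close> as \<open>t\<close> tends to 0, and quasi-convexity at \<open>y\<^sub>t\<close> shows that \<open>|p y\<^sub>t| / t\<close> tends to
  \<open>cos |\<eta> \<xi>|\<close>.
\<close>

section \<open>Trigonometry in the model surfaces\<close>

text \<open>The inequality for \<open>\<zeta>\<close> comes from estimating the distance from
  \<open>r\<close> to \<open>\<gamma> t\<close> twice. First variation at \<open>p\<close> bounds it
  below by |pr| - t cos |\<eta> \<zeta>|, up to o(t), for a suitable \<open>\<zeta>\<close>. The
  detour through the nearest point y of \<open>F\<close> bounds it above: quasi-convexity at y makes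
  the leg from y to \<open>\<gamma> t\<close> cost only o(t), and hinge comparison at
  \<open>p\<close> bounds |yr| by |pr| - |py| cos |\<xi> \<zeta>|. Division by t and the limit of
  |py| / t leave the assertion. The vertex y moves with t, so the estimates at y must hold at a
  scale that does not depend on the vertex; an asymptotic statement at one fixed point would not do.
  This is why \<open>angle_scale\<close> and \<open>hinge_scale\<close> quantify over all base
  points. The second obstacle is that compactness is not given. Until it is derived from the
  Hausdorff dimension there are only almost shortest curves, so angle monotonicity has to be proved
  with explicit errors first. The third is that angles are defined by Euclidean comparison while the
  curvature bound concerns \<open>k\<close>; the two are exchanged at small scales by
  \<open>mcos_ecos_close\<close>.\<close>

definition model_sin :: "real \<Rightarrow> real \<Rightarrow> real" where
  "model_sin k x = (if k = 0 then x else if k > 0 then sin (sqrt k * x) / sqrt k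
     else sinh (sqrt (- k) * x) / sqrt (- k))"

definition model_cos :: "real \<Rightarrow> real \<Rightarrow> real" where
  "model_cos k x = (if k = 0 then 1 else if k > 0 then cos (sqrt k * x) else cosh (sqrt (- k) * x))"

text \<open>The modified distance function, the antiderivative of \<open>model_sin\<close> vanishing
  at 0. In terms of it the law of cosines has one form for all \<open>k\<close>; in terms of
  \<open>model_cos\<close> it degenerates to 1 = 1 at \<open>k = 0\<close>.\<close>

definition model_md :: "real \<Rightarrow> real \<Rightarrow> real" where
  "model_md k x = (if k = 0 then x\<^sup>2 / 2 else (1 - model_cos k x) / k)"

lemma model_cos_md: "model_cos k x = 1 - k * model_md k x"
  by (simp add: model_md_def model_cos_def)

lemma model_sin_add: "model_sin k (x + y) = model_sin k x * model_cos k y + model_cos k x * model_sin k y"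
  by (simp add: model_sin_def model_cos_def sin_add sinh_add distrib_left add_divide_distrib)

lemma model_cos_add: "model_cos k (x + y) = model_cos k x * model_cos k y - k * (model_sin k x * model_sin k y)"
proof -
  consider "k = 0" | "k > 0" | "k < 0" by linarith
  then show ?thesis
  proof cases
    case 2
    then show ?thesis
      by (simp add: model_cos_def model_sin_def cos_add distrib_left)
  next
    case 3
    then have "- k > 0" by simp
    then show ?thesis using 3
      by (simp add: model_cos_def model_sin_def cosh_add distrib_left field_simps)
  qed (simp add: model_cos_def)
qed

text \<open>For nonzero \<open>k\<close> this is the addition formula for \<open>model_cos\<close>
  after cancelling \<open>k\<close>. At \<open>k = 0\<close> that formula carries no information, so
  the square of a sum is expanded instead.\<close>

lemma model_md_add:
  "model_md k (x + y) = model_md k x + model_cos k x * model_md k y + model_sin k x * model_sin k y"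
proof (cases "k = 0")
  case True
  then show ?thesis
    by (simp add: model_md_def model_cos_def model_sin_def power2_eq_square field_simps)
next
  case False
  then have "k * model_md k (x + y)
      = k * (model_md k x + model_cos k x * model_md k y + model_sin k x * model_sin k y)"
    using model_cos_add[of k x y] by (simp add: model_cos_md algebra_simps)
  with False show ?thesis by simp
qed

lemma model_sin_0 [simp]: "model_sin k 0 = 0" and model_cos_0 [simp]: "model_cos k 0 = 1"
  and model_md_0 [simp]: "model_md k 0 = 0"
  by (simp_all add: model_sin_def model_cos_def model_md_def)

lemma model_sin_minus [simp]: "model_sin k (- x) = - model_sin k x"
  and model_cos_minus [simp]: "model_cos k (- x) = model_cos k x"
  and model_md_minus [simp]: "model_md k (- x) = model_md k x"
  by (simp_all add: model_sin_def model_cos_def model_md_def)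

lemma model_md_abs [simp]: "model_md k \<bar>x\<bar> = model_md k x"
  by (simp add: abs_if)

text \<open>The Pythagorean identity, read off from the addition formula at \<open>x\<close> and
  \<open>- x\<close>. It lets \<open>stewart_identity\<close> eliminate squares of sines.\<close>

lemma model_sin_squared: "(model_sin k x)\<^sup>2 = 2 * model_md k x - k * (model_md k x)\<^sup>2"
  using model_md_add[of k x "- x"]
  by (simp add: model_cos_md power2_eq_square algebra_simps)

lemma DERIV_model_sin: "(model_sin k has_real_derivative model_cos k x) (at x)"
proof -
  consider "k = 0" | "k > 0" | "k < 0" by linarith
  then show ?thesis
  proof cases
    case 1
    then have "model_sin k = (\<lambda>x. x)" by (auto simp: model_sin_def)
    with 1 show ?thesis by (simp add: model_cos_def)
  next
    case 2
    then have "model_sin k = (\<lambda>x. sin (sqrt k * x) / sqrt k)" by (auto simp: model_sin_def)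
    moreover have "sqrt k * sqrt k = k" using 2 by simp
    ultimately show ?thesis using 2
      by (auto simp: model_cos_def mult.assoc intro!: derivative_eq_intros)
  next
    case 3
    then have "model_sin k = (\<lambda>x. sinh (sqrt (- k) * x) / sqrt (- k))" by (auto simp: model_sin_def)
    moreover have "sqrt (- k) * sqrt (- k) = - k" using 3 by simp
    ultimately show ?thesis using 3
      by (auto simp: model_cos_def mult.assoc intro!: derivative_eq_intros)
  qed
qed

lemma DERIV_model_md: "(model_md k has_real_derivative model_sin k x) (at x)"
proof -
  consider "k = 0" | "k > 0" | "k < 0" by linarith
  then show ?thesis
  proof cases
    case 1
    then have "model_md k = (\<lambda>x. x\<^sup>2 / 2)" by (auto simp: model_md_def)
    with 1 show ?thesis
      by (auto simp: model_sin_def intro!: derivative_eq_intros)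
  next
    case 2
    then have "model_md k = (\<lambda>x. (1 - cos (sqrt k * x)) / k)"
      by (auto simp: model_md_def model_cos_def)
    with 2 show ?thesis
      by (auto simp: model_sin_def field_simps real_sqrt_mult_self intro!: derivative_eq_intros)
  next
    case 3
    define s where "s = sqrt (- k)"
    have s: "s > 0" "k = - (s * s)" using 3 by (simp_all add: s_def)
    have "model_md k = (\<lambda>x. (1 - cosh (s * x)) / k)"
      using 3 by (auto simp: model_md_def model_cos_def s_def)
    moreover have "model_sin k x = sinh (s * x) / s" using 3 by (auto simp: model_sin_def s_def)
    ultimately show ?thesis using s
      by (auto simp: field_simps intro!: derivative_eq_intros)
  qed
qed

lemma isCont_model_sin: "isCont (model_sin k) x" and isCont_model_md: "isCont (model_md k) x"
  using DERIV_model_sin DERIV_model_md DERIV_isCont by blast+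

lemma isCont_model_cos: "isCont (model_cos k) x"
  unfolding model_cos_md[abs_def] by (intro continuous_intros isCont_model_md)

lemma continuous_on_model [continuous_intros]:
  assumes "continuous_on S f"
  shows "continuous_on S (\<lambda>x. model_sin k (f x))" "continuous_on S (\<lambda>x. model_cos k (f x))"
    "continuous_on S (\<lambda>x. model_md k (f x))"
proof -
  have "continuous_on UNIV (model_sin k)" "continuous_on UNIV (model_cos k)" "continuous_on UNIV (model_md k)"
    by (auto intro!: continuous_at_imp_continuous_on isCont_model_sin isCont_model_cos isCont_model_md)
  then show "continuous_on S (\<lambda>x. model_sin k (f x))" "continuous_on S (\<lambda>x. model_cos k (f x))"
    "continuous_on S (\<lambda>x. model_md k (f x))"
    using assms by (auto elim!: continuous_on_compose2)
qed

text \<open>\<open>model_cos\<close> is the derivative of \<open>model_sin\<close>, so closeness to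
  1 integrates to linear bounds. The next lemma integrates once more, to quadratic bounds for
  \<open>model_md\<close>.\<close>

lemma sin_le_via_cos:
  assumes cos: "\<And>x. \<bar>x\<bar> \<le> R \<Longrightarrow> \<bar>model_cos k x - 1\<bar> \<le> e" and x: "0 \<le> x" "x \<le> R"
  shows "(1 - e) * x \<le> model_sin k x" "model_sin k x \<le> (1 + e) * x"
proof -
  have c: "1 - e \<le> model_cos k y" "model_cos k y \<le> 1 + e" if "0 \<le> y" "y \<le> x" for y
    using cos[of y] that x by (simp_all add: abs_le_iff)
  have "(\<lambda>x. model_sin k x - (1 - e) * x) 0 \<le> (\<lambda>x. model_sin k x - (1 - e) * x) x"
  proof (rule DERIV_nonneg_imp_nondecreasing[OF x(1)], intro exI conjI)
    fix y assume "0 \<le> y" "y \<le> x"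
    then show "0 \<le> model_cos k y - (1 - e)" using c by simp
    show "((\<lambda>x. model_sin k x - (1 - e) * x) has_real_derivative model_cos k y - (1 - e)) (at y)"
      by (auto intro!: derivative_eq_intros DERIV_model_sin)
  qed
  then show "(1 - e) * x \<le> model_sin k x" by simp
  have "(\<lambda>x. (1 + e) * x - model_sin k x) 0 \<le> (\<lambda>x. (1 + e) * x - model_sin k x) x"
  proof (rule DERIV_nonneg_imp_nondecreasing[OF x(1)], intro exI conjI)
    fix y assume "0 \<le> y" "y \<le> x"
    then show "0 \<le> (1 + e) - model_cos k y" using c by simp
    show "((\<lambda>x. (1 + e) * x - model_sin k x) has_real_derivative (1 + e) - model_cos k y) (at y)"
      by (auto intro!: derivative_eq_intros DERIV_model_sin)
  qed
  then show "model_sin k x \<le> (1 + e) * x" by simp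
qed

lemma md_le_via_cos:
  assumes cos: "\<And>x. \<bar>x\<bar> \<le> R \<Longrightarrow> \<bar>model_cos k x - 1\<bar> \<le> e" and x: "0 \<le> u" "u \<le> x" "x \<le> R"
  shows "(1 - e) * (x\<^sup>2 - u\<^sup>2) / 2 \<le> model_md k x - model_md k u"
    "model_md k x - model_md k u \<le> (1 + e) * (x\<^sup>2 - u\<^sup>2) / 2"
proof -
  note b = sin_le_via_cos[of R k e, OF cos]
  have "(\<lambda>x. model_md k x - (1 - e) * x\<^sup>2 / 2) u \<le> (\<lambda>x. model_md k x - (1 - e) * x\<^sup>2 / 2) x"
  proof (rule DERIV_nonneg_imp_nondecreasing[OF x(2)], intro exI conjI)
    fix y assume "u \<le> y" "y \<le> x"
    then show "0 \<le> model_sin k y - (1 - e) * y" using b(1)[of y] x by simp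
    show "((\<lambda>x. model_md k x - (1 - e) * x\<^sup>2 / 2) has_real_derivative
        model_sin k y - (1 - e) * y) (at y)"
      by (auto intro!: derivative_eq_intros DERIV_model_md)
  qed
  then show "(1 - e) * (x\<^sup>2 - u\<^sup>2) / 2 \<le> model_md k x - model_md k u"
    by (simp add: field_simps)
  have "(\<lambda>x. (1 + e) * x\<^sup>2 / 2 - model_md k x) u \<le> (\<lambda>x. (1 + e) * x\<^sup>2 / 2 - model_md k x) x"
  proof (rule DERIV_nonneg_imp_nondecreasing[OF x(2)], intro exI conjI)
    fix y assume "u \<le> y" "y \<le> x"
    then show "0 \<le> (1 + e) * y - model_sin k y" using b(2)[of y] x by simp
    show "((\<lambda>x. (1 + e) * x\<^sup>2 / 2 - model_md k x) has_real_derivative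
        (1 + e) * y - model_sin k y) (at y)"
      by (auto intro!: derivative_eq_intros DERIV_model_md)
  qed
  then show "model_md k x - model_md k u \<le> (1 + e) * (x\<^sup>2 - u\<^sup>2) / 2"
    by (simp add: field_simps)
qed

text \<open>The tolerance 1/2 makes sines linear and modified distances quadratic up to fixed
  factors. The bound on \<open>3 * R\<close> keeps perimeters of small triangles below the critical
  length for positive curvature.\<close>

definition good_radius :: "real \<Rightarrow> real \<Rightarrow> bool" where
  "good_radius k R \<longleftrightarrow> R > 0 \<and> (\<forall>x. \<bar>x\<bar> \<le> R \<longrightarrow> \<bar>model_cos k x - 1\<bar> \<le> 1 / 2) \<and>
     (k > 0 \<longrightarrow> 3 * R < 2 * pi / sqrt k)"

lemma cos_near_1:
  assumes "e > 0" shows "\<exists>R>0. \<forall>x. \<bar>x\<bar> \<le> R \<longrightarrow> \<bar>model_cos k x - 1\<bar> \<le> e"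
proof -
  have "\<exists>d>0. \<forall>x. dist x 0 < d \<longrightarrow> dist (model_cos k x) (model_cos k 0) < e"
    using isCont_model_cos[of 0 k] assms unfolding continuous_at_eps_delta dist_real_def by blast
  then obtain d where d: "d > 0" "\<And>x. \<bar>x\<bar> < d \<Longrightarrow> \<bar>model_cos k x - 1\<bar> < e"
    by (auto simp: dist_real_def)
  show ?thesis
    by (rule exI[of _ "d/2"]) (use d in \<open>force intro: less_imp_le\<close>)
qed

lemma good_radius_exists: "\<exists>R. good_radius k R"
proof -
  obtain R where R: "R > 0" "\<And>x. \<bar>x\<bar> \<le> R \<Longrightarrow> \<bar>model_cos k x - 1\<bar> \<le> 1/2"
    using cos_near_1[of "1/2" k] by auto
  define R' where "R' = (if k > 0 then min R (pi / (2 * sqrt k)) else R)"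
  have "R' > 0" "R' \<le> R" using R by (auto simp: R'_def)
  moreover have "3 * R' < 2 * pi / sqrt k" if "k > 0"
  proof -
    have "R' \<le> pi / (2 * sqrt k)" using that by (simp add: R'_def)
    then have "3 * R' \<le> 3 * (pi / (2 * sqrt k))" by simp
    also have "\<dots> < 2 * pi / sqrt k" using that by (simp add: field_simps)
    finally show ?thesis .
  qed
  ultimately have "good_radius k R'" unfolding good_radius_def using R by auto
  then show ?thesis ..
qed

context
  fixes k R :: real assumes good: "good_radius k R"
begin

lemma good_radius_pos: "R > 0" using good by (simp add: good_radius_def)

lemma good_cos: "\<bar>x\<bar> \<le> R \<Longrightarrow> \<bar>model_cos k x - 1\<bar> \<le> 1 / 2"
  using good by (simp add: good_radius_def)

lemma good_sin: assumes "0 \<le> x" "x \<le> R" shows "x / 2 \<le> model_sin k x" "model_sin k x \<le> 3 / 2 * x"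
  using sin_le_via_cos[of R k "1/2" x] assms good_cos by simp_all

lemma good_sin_pos: "0 < x \<Longrightarrow> x \<le> R \<Longrightarrow> model_sin k x > 0"
  using good_sin(1)[of x] by simp

lemma good_md:
  assumes "0 \<le> u" "u \<le> x" "x \<le> R"
  shows "(x\<^sup>2 - u\<^sup>2) / 4 \<le> model_md k x - model_md k u"
    "model_md k x - model_md k u \<le> 3 / 4 * (x\<^sup>2 - u\<^sup>2)"
  using md_le_via_cos[of R k "1/2" u x] assms good_cos by (simp_all add: field_simps)

lemma good_md_mono:
  assumes "0 \<le> u" "u \<le> x" "x \<le> R" shows "model_md k u \<le> model_md k x"
proof -
  have "u\<^sup>2 \<le> x\<^sup>2" using assms by (simp add: power_mono)
  then show ?thesis using good_md(1)[OF assms] by simp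
qed

lemma good_md_inject:
  assumes "0 \<le> x" "x \<le> R" "model_md k x \<le> 0" shows "x = 0"
proof -
  have "(x\<^sup>2 - 0\<^sup>2) / 4 \<le> model_md k x - model_md k 0"
    using good_md(1)[of 0 x] assms by blast
  then have "x\<^sup>2 \<le> 4 * model_md k x" by simp
  also have "\<dots> \<le> 0" using assms by simp
  finally have "x\<^sup>2 \<le> 0" .
  then show ?thesis by simp
qed

end

subsection \<open>Comparison angles\<close>

text \<open>The law of cosines solved for the cosine of the angle between the sides \<open>a\<close>
  and \<open>b\<close>, uniformly in \<open>k\<close>. Working with the cosine instead of the angle
  keeps comparison estimates algebraic.\<close>

definition mcos :: "real \<Rightarrow> real \<Rightarrow> real \<Rightarrow> real \<Rightarrow> real" where
  "mcos k a b c = (model_md k a + model_cos k a * model_md k b - model_md k c)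
     / (model_sin k a * model_sin k b)"

lemma mcos_commute: "mcos k a b c = mcos k b a c"
  by (simp add: mcos_def model_cos_md algebra_simps)

lemma model_angle_eq_arccos_mcos: "model_angle k a b c = arccos (mcos k a b c)"
proof -
  consider "k = 0" | "k > 0" | "k < 0" by linarith
  then show ?thesis
  proof cases
    case 1
    have "mcos 0 a b c = ((a\<^sup>2 + b\<^sup>2 - c\<^sup>2) / 2) / (a * b)"
      by (simp add: mcos_def model_md_def model_cos_def model_sin_def diff_divide_distrib add_divide_distrib)
    with 1 show ?thesis by (simp add: model_angle_def mult.assoc)
  next
    case 2
    have "mcos k a b c = (cos (sqrt k * c) - cos (sqrt k * a) * cos (sqrt k * b))
        / (sin (sqrt k * a) * sin (sqrt k * b))"
      using 2 by (simp add: mcos_def model_md_def model_cos_def model_sin_def divide_simps)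
        (simp add: algebra_simps)
    with 2 show ?thesis by (simp add: model_angle_def)
  next
    case 3
    then have s: "sqrt (- k) * sqrt (- k) = - k" by simp
    have "mcos k a b c = (cosh (sqrt (- k) * a) * cosh (sqrt (- k) * b) - cosh (sqrt (- k) * c))
        / (sinh (sqrt (- k) * a) * sinh (sqrt (- k) * b))"
      using 3 s by (simp add: mcos_def model_md_def model_cos_def model_sin_def divide_simps)
        (simp add: algebra_simps)
    with 3 show ?thesis by (simp add: model_angle_def)
  qed
qed

text \<open>The two half-angle forms. They measure the deviation from the degenerate triangles with
  third side \<open>\<bar>a - b\<bar>\<close> and \<open>a + b\<close>, so bounds on the cosine
  follow from monotonicity of \<open>model_md\<close>.\<close>

lemma mcos_law:
  assumes "model_sin k a \<noteq> 0" "model_sin k b \<noteq> 0"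
  shows "model_md k c = model_md k (a - b) + model_sin k a * model_sin k b * (1 - mcos k a b c)"
    "model_md k c = model_md k (a + b) - model_sin k a * model_sin k b * (1 + mcos k a b c)"
proof -
  have "model_sin k a * model_sin k b * mcos k a b c
      = model_md k a + model_cos k a * model_md k b - model_md k c"
    using assms by (simp add: mcos_def)
  then show "model_md k c = model_md k (a - b) + model_sin k a * model_sin k b * (1 - mcos k a b c)"
    "model_md k c = model_md k (a + b) - model_sin k a * model_sin k b * (1 + mcos k a b c)"
    using model_md_add[of k a b] model_md_add[of k a "-b"] by (simp_all add: algebra_simps)
qed

lemma mcos_bounds:
  assumes good: "good_radius k R" and ab: "0 < a" "0 < b" "a + b \<le> R"
    and c: "\<bar>a - b\<bar> \<le> c" "c \<le> a + b"
  shows "-1 \<le> mcos k a b c" "mcos k a b c \<le> 1"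
proof -
  have s: "model_sin k a > 0" "model_sin k b > 0"
    using good_sin_pos[OF good] ab by simp_all
  have md: "model_md k (a - b) \<le> model_md k c" "model_md k c \<le> model_md k (a + b)"
    using good_md_mono[OF good, of "\<bar>a-b\<bar>" c] good_md_mono[OF good, of c "a+b"] ab c by simp_all
  have p: "model_sin k a * model_sin k b > 0" using s by simp
  have "0 \<le> model_sin k a * model_sin k b * (1 + mcos k a b c)"
    using md mcos_law(2)[of k a b c] s by simp
  then show "-1 \<le> mcos k a b c" using p by (simp add: zero_le_mult_iff)
  have "0 \<le> model_sin k a * model_sin k b * (1 - mcos k a b c)"
    using md mcos_law(1)[of k a b c] s by simp
  then show "mcos k a b c \<le> 1" using p by (simp add: zero_le_mult_iff)
qed

abbreviation ecos :: "real \<Rightarrow> real \<Rightarrow> real \<Rightarrow> real" where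
  "ecos a b c \<equiv> (a\<^sup>2 + b\<^sup>2 - c\<^sup>2) / (2 * a * b)"

lemma ecos_bounds:
  fixes a b c :: real
  assumes "0 < a" "0 < b" "\<bar>a - b\<bar> \<le> c" "c \<le> a + b"
  shows "-1 \<le> ecos a b c" "ecos a b c \<le> 1"
proof -
  have "c\<^sup>2 \<le> (a + b)\<^sup>2" "(a - b)\<^sup>2 \<le> c\<^sup>2"
    using assms power_mono[of c "a+b" 2] power_mono[of "\<bar>a-b\<bar>" c 2] by simp_all
  then show "-1 \<le> ecos a b c" "ecos a b c \<le> 1"
    using assms by (simp_all add: field_simps power2_eq_square)
qed

text \<open>Both \<open>1 - mcos\<close> and \<open>1 - ecos\<close> are quotients whose numerators
  and denominators agree up to factors near 1. The radius does not depend on the shape of the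
  triangle.\<close>

lemma mcos_ecos_close:
  assumes "e > 0"
  shows "\<exists>r>0. \<forall>a b c. 0 < a \<and> 0 < b \<and> a \<le> r \<and> b \<le> r \<and> \<bar>a - b\<bar> \<le> c \<and> c \<le> a + b \<longrightarrow>
    \<bar>mcos k a b c - ecos a b c\<bar> \<le> e"
proof -
  \<comment> \<open>The extreme factors by which the quotient can change: one error in the
    numerator, a squared one in the denominator. A relative error of \<open>e / 2\<close> is enough
    because \<open>1 - ecos\<close> is at most 2.\<close>
  have "((\<lambda>e'::real. (1 + e') / (1 - e')\<^sup>2) \<longlongrightarrow> (1 + 0) / (1 - 0)\<^sup>2) (at_right 0)"
    "((\<lambda>e'::real. (1 - e') / (1 + e')\<^sup>2) \<longlongrightarrow> (1 - 0) / (1 + 0)\<^sup>2) (at_right 0)"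
    by (intro tendsto_intros; simp)+
  then have "eventually (\<lambda>e'. (1 + e') / (1 - e')\<^sup>2 < 1 + e / 2) (at_right 0)"
    "eventually (\<lambda>e'. 1 - e / 2 < (1 - e') / (1 + e')\<^sup>2) (at_right (0::real))"
    using assms by (auto intro: order_tendstoD)
  moreover have "eventually (\<lambda>e'::real. 0 < e' \<and> e' < 1/2) (at_right 0)"
    by (intro eventually_conj eventually_at_right_less) (auto simp: eventually_at_right_field intro: exI[of _ "1/2"])
  ultimately have "eventually (\<lambda>e'. (1 + e') / (1 - e')\<^sup>2 < 1 + e / 2 \<and>
      1 - e / 2 < (1 - e') / (1 + e')\<^sup>2 \<and> 0 < e' \<and> e' < 1/2) (at_right (0::real))"
    by eventually_elim auto
  then obtain e' :: real where e': "(1 + e') / (1 - e')\<^sup>2 < 1 + e / 2"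
      "1 - e / 2 < (1 - e') / (1 + e')\<^sup>2" "0 < e'" "e' < 1/2"
    using eventually_happens'[OF trivial_limit_at_right_real] by blast
  obtain R where R: "R > 0" "\<And>x. \<bar>x\<bar> \<le> R \<Longrightarrow> \<bar>model_cos k x - 1\<bar> \<le> e'"
    using cos_near_1[OF \<open>0 < e'\<close>, of k] by auto
  have "\<bar>mcos k a b c - ecos a b c\<bar> \<le> e"
    if "0 < a" "0 < b" "a \<le> R/2" "b \<le> R/2" "\<bar>a - b\<bar> \<le> c" "c \<le> a + b" for a b c
  proof -
    define P where "P = model_sin k a * model_sin k b"
    define D where "D = model_md k c - model_md k (a - b)"
    define Q where "Q = c\<^sup>2 - (a - b)\<^sup>2"
    have sa: "(1 - e') * a \<le> model_sin k a" "model_sin k a \<le> (1 + e') * a"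
      using sin_le_via_cos[of R k e' a, OF R(2)] that by simp_all
    have sb: "(1 - e') * b \<le> model_sin k b" "model_sin k b \<le> (1 + e') * b"
      using sin_le_via_cos[of R k e' b, OF R(2)] that by simp_all
    have pos: "0 < (1 - e') * a" "0 < (1 - e') * b" using that e' by simp_all
    have sab: "model_sin k a > 0" "model_sin k b > 0" using pos sa sb by linarith+
    have P: "(1 - e')\<^sup>2 * (a * b) \<le> P" "P \<le> (1 + e')\<^sup>2 * (a * b)" "P > 0"
      using mult_mono[OF sa(1) sb(1)] mult_mono[OF sa(2) sb(2)] pos sab e' that
      by (simp_all add: P_def power2_eq_square mult_ac)
    have D: "(1 - e') * Q / 2 \<le> D" "D \<le> (1 + e') * Q / 2"
      using md_le_via_cos[of R k e' "\<bar>a - b\<bar>" c, OF R(2)] that by (simp_all add: D_def Q_def)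
    have Q: "0 \<le> Q" using power_mono[of "\<bar>a-b\<bar>" c 2] that by (simp add: Q_def)
    have m: "1 - mcos k a b c = D / P"
      using mcos_law(1)[of k a b c] sab by (simp add: D_def P_def)
    define F where "F = Q / (2 * (a * b))"
    have F: "1 - ecos a b c = F"
      using that by (simp add: F_def Q_def field_simps power2_eq_square)
    have F2: "0 \<le> F" "F \<le> 2"
      using F ecos_bounds[of a b c] that by linarith+
    have "D / P \<le> ((1 + e') * Q / 2) / ((1 - e')\<^sup>2 * (a * b))"
      using D P Q e' that by (intro frac_le) auto
    also have "\<dots> = (1 + e') / (1 - e')\<^sup>2 * F" by (simp add: F_def)
    also have "\<dots> \<le> (1 + e / 2) * F" using e' F2 by (intro mult_right_mono) auto
    also have "\<dots> \<le> F + e" using F2 assms by (simp add: algebra_simps)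
    finally have up: "D / P \<le> F + e" .
    have "F - e \<le> (1 - e / 2) * F" using F2 assms by (simp add: algebra_simps)
    also have "\<dots> \<le> (1 - e') / (1 + e')\<^sup>2 * F" using e' F2 by (intro mult_right_mono) auto
    also have "\<dots> = ((1 - e') * Q / 2) / ((1 + e')\<^sup>2 * (a * b))" by (simp add: F_def)
    also have "\<dots> \<le> D / P"
    proof (rule frac_le)
      show "0 \<le> D" using D(1) Q e' order_trans[of 0 "(1-e')*Q/2" D] by simp
    qed (use D P in auto)
    finally have "F - e \<le> D / P" .
    with up m F show ?thesis by linarith
  qed
  then show ?thesis using R by (intro exI[of _ "R/2"]) auto
qed

section \<open>Comparison in Alexandrov spaces\<close>

lemma abs_cos_diff_le: "\<bar>cos u - cos v\<bar> \<le> \<bar>u - v\<bar>" for u v :: real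
proof -
  have "\<bar>cos u - cos v\<bar> = 2 * (\<bar>sin ((u + v) / 2)\<bar> * \<bar>sin ((v - u) / 2)\<bar>)"
    by (simp add: cos_diff_cos abs_mult)
  also have "\<dots> \<le> 2 * (1 * \<bar>(v - u) / 2\<bar>)"
    by (intro mult_left_mono mult_mono abs_sin_x_le_abs_x) auto
  finally show ?thesis by simp
qed

text \<open>With \<open>w = pi - arccos A\<close>, the other two angles add up to at most
  \<open>pi + w\<close>. Two angles with sum at most \<open>pi\<close> have cosines with nonnegative
  sum, and since cosine is 1-Lipschitz the excess costs at most \<open>w\<close>.\<close>

lemma arccos_sum_le:
  fixes A B C :: real
  assumes "-1 \<le> A" "A \<le> 1" "-1 \<le> B" "B \<le> 1" "-1 \<le> C" "C \<le> 1"
    and sum: "arccos A + arccos B + arccos C \<le> 2 * pi"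
  shows "B + C \<ge> - arccos (- A)"
proof -
  define w where "w = arccos (- A)"
  define c where "c = arccos C"
  have A: "arccos A = pi - w" using assms by (simp add: w_def arccos_minus)
  have w: "0 \<le> w" using assms by (simp add: w_def arccos_lbound)
  have c: "0 \<le> c" "c \<le> pi" "cos c = C" using assms by (simp_all add: c_def arccos_bounded)
  show ?thesis
  proof (cases "w \<le> c")
    case True
    have "arccos B \<le> pi + w - c" using sum A by (simp add: c_def)
    then have "cos (pi + w - c) \<le> cos (arccos B)"
      using True c assms by (intro cos_monotone_0_pi_le) (auto simp: arccos_lbound)
    moreover have "cos (pi + w - c) = - cos (w - c)"
      using cos_periodic_pi[of "w - c"] by (simp add: algebra_simps)
    moreover have "cos (w - c) \<le> C + w" using abs_cos_diff_le[of "w - c" "- c"] w c by simp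
    ultimately show ?thesis using assms by (simp add: w_def)
  next
    \<comment> \<open>Now \<open>C\<close> is at least \<open>1 - w\<close>, and \<open>B\<close> is
      at least -1.\<close>
    case False
    then show ?thesis using abs_cos_diff_le[of c 0] c assms by (simp add: w_def)
  qed
qed

locale alexandrov =
  fixes X :: "'a metric" and k :: real
  assumes Alex: "X \<in> Alex k"
begin

abbreviation M :: "'a set" where "M \<equiv> mspace X"
abbreviation d :: "'a \<Rightarrow> 'a \<Rightarrow> real" where "d \<equiv> mdist X"

definition R0 :: real where "R0 = (SOME R. good_radius k R)"

lemma good_R0: "good_radius k R0"
  unfolding R0_def using good_radius_exists by (rule someI_ex)

lemma R0_pos: "R0 > 0" using good_radius_pos[OF good_R0] .

lemma d_pos: "x \<in> M \<Longrightarrow> y \<in> M \<Longrightarrow> x \<noteq> y \<Longrightarrow> d x y > 0"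
  by (metis mdist_nonneg mdist_zero order_le_less)

lemma d_self [simp]: "x \<in> M \<Longrightarrow> d x x = 0" by simp

lemma d_tri: "x \<in> M \<Longrightarrow> y \<in> M \<Longrightarrow> z \<in> M \<Longrightarrow> d x z \<le> d x y + d y z"
  by (rule mdist_triangle)

lemma d_diff: "x \<in> M \<Longrightarrow> y \<in> M \<Longrightarrow> z \<in> M \<Longrightarrow> \<bar>d x y - d x z\<bar> \<le> d y z"
  using d_tri[of x y z] d_tri[of x z y] mdist_commute[of X y z] by linarith

lemma d_sides:
  assumes "p \<in> M" "x \<in> M" "y \<in> M"
  shows "\<bar>d p x - d p y\<bar> \<le> d x y" "d x y \<le> d p x + d p y"
  using d_diff[OF assms] d_tri[of x p y] assms by (simp_all add: mdist_commute)

lemma mcos_d_bounds: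
  assumes "p \<in> M" "x \<in> M" "y \<in> M" "x \<noteq> p" "y \<noteq> p" "d p x \<le> R0 / 2" "d p y \<le> R0 / 2"
  shows "-1 \<le> mcos k (d p x) (d p y) (d x y)" "mcos k (d p x) (d p y) (d x y) \<le> 1"
  using mcos_bounds[OF good_R0, of "d p x" "d p y" "d x y"] d_sides[of p x y] assms
    d_pos[of p x] d_pos[of p y] by auto

lemma quadruple:
  assumes "p \<in> M" "x \<in> M" "y \<in> M" "z \<in> M" "x \<noteq> p" "y \<noteq> p" "z \<noteq> p"
    and "d p x \<le> R0 / 2" "d p y \<le> R0 / 2" "d p z \<le> R0 / 2"
  shows "arccos (mcos k (d p x) (d p y) (d x y)) + arccos (mcos k (d p y) (d p z) (d y z))
    + arccos (mcos k (d p z) (d p x) (d z x)) \<le> 2 * pi"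
proof -
  have def: "comparison_angle_defined X k p u v"
    if "u \<in> M" "v \<in> M" "u \<noteq> p" "v \<noteq> p" "d p u \<le> R0 / 2" "d p v \<le> R0 / 2" for u v
    unfolding comparison_angle_defined_def
  proof (intro conjI impI)
    assume "k > 0"
    then have "3 * R0 < 2 * pi / sqrt k" using good_R0 by (simp add: good_radius_def)
    moreover have "d p u + d p v + d u v \<le> 3 * R0"
      using d_sides(2)[of p u v] that assms R0_pos by simp
    ultimately show "d p u + d p v + d u v < 2 * pi / sqrt k" by linarith
  qed (use that in auto)
  have "quadruple_condition X k" using Alex by (simp add: Alex_def)
  then show ?thesis
    using assms def unfolding quadruple_condition_def comparison_angle_def model_angle_eq_arccos_mcos
    by blast
qed

text \<open>Stewart's theorem as an inequality; the last term measures how far \<open>y\<close> is from lying between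
  \<open>x\<close> and \<open>x'\<close>.\<close>

lemma stewart:
  assumes M: "x \<in> M" "x' \<in> M" "y \<in> M" "z \<in> M" and ne: "x \<noteq> y" "x' \<noteq> y"
    and R: "d y x \<le> R0 / 2" "d y x' \<le> R0 / 2" "d y z \<le> R0 / 2"
  defines "s \<equiv> d y x" and "t \<equiv> d y x'" and "h \<equiv> d y z" and "a \<equiv> d x z" and "b \<equiv> d x' z" and "l \<equiv> d x x'"
  shows "model_sin k s * (model_md k t + model_cos k t * model_md k h - model_md k b)
    + model_sin k t * (model_md k s + model_cos k s * model_md k h - model_md k a)
    \<ge> - arccos (- mcos k s t l) * (model_sin k s * model_sin k t * model_sin k h)"
proof (cases "z = y")
  case True
  then show ?thesis using M by (simp add: h_def a_def b_def s_def t_def mdist_commute)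
next
  case False
  define A where "A = mcos k s t l"
  define B where "B = mcos k s h a"
  define C where "C = mcos k t h b"
  have st: "0 < s" "0 < t" "0 < h" using ne M False by (simp_all add: s_def t_def h_def d_pos)
  have S: "model_sin k s > 0" "model_sin k t > 0" "model_sin k h > 0"
    using st R R0_pos by (auto intro!: good_sin_pos[OF good_R0] simp: s_def t_def h_def)
  have "arccos A + arccos B + arccos C \<le> 2 * pi"
    using quadruple[of y x x' z] M ne False R
    unfolding A_def B_def C_def s_def t_def h_def a_def b_def l_def
    by (simp add: mdist_commute mcos_commute)
  moreover have "-1 \<le> A" "A \<le> 1" "-1 \<le> B" "B \<le> 1" "-1 \<le> C" "C \<le> 1"
    using mcos_d_bounds M ne False R unfolding A_def B_def C_def s_def t_def h_def a_def b_def l_def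
    by auto
  ultimately have "B + C \<ge> - arccos (- A)" by (intro arccos_sum_le)
  then have "- arccos (- A) * (model_sin k s * model_sin k t * model_sin k h)
      \<le> (B + C) * (model_sin k s * model_sin k t * model_sin k h)"
    using S by (intro mult_right_mono) auto
  also have "\<dots> = model_sin k t * (B * (model_sin k s * model_sin k h))
      + model_sin k s * (C * (model_sin k t * model_sin k h))" by (simp add: algebra_simps)
  also have "B * (model_sin k s * model_sin k h) = model_md k s + model_cos k s * model_md k h - model_md k a"
    using S by (simp add: B_def mcos_def)
  also have "C * (model_sin k t * model_sin k h) = model_md k t + model_cos k t * model_md k h - model_md k b"
    using S by (simp add: C_def mcos_def)
  finally show ?thesis by (simp add: A_def)
qed

text \<open>Turns the Stewart inequality into monotonicity of angles: divided by the sines, the left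
  side is the comparison cosine at distance \<open>s\<close>, the first term on the right the one at
  distance \<open>l\<close>, and the rest is the Stewart sum.\<close>

lemma stewart_identity:
  fixes s t ma mb mh :: real
  defines "S \<equiv> model_sin k s" and "T \<equiv> model_sin k t" and "l \<equiv> s + t"
  shows "model_sin k l * (model_md k s + model_cos k s * ma - mh)
    = S * (model_md k l + model_cos k l * ma - mb)
     - (S * (model_md k t + model_cos k t * mh - mb) + T * (model_md k s + model_cos k s * mh - ma))"
proof -
  define ms where "ms = model_md k s"
  define mt where "mt = model_md k t"
  have sq: "S * S = 2 * ms - k * (ms * ms)"
    using model_sin_squared[of k s] by (simp add: S_def ms_def power2_eq_square)
  have c: "model_cos k s = 1 - k * ms" "model_cos k t = 1 - k * mt"
    by (simp_all add: model_cos_md ms_def mt_def)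
  have l: "model_sin k l = S * (1 - k * mt) + (1 - k * ms) * T"
    "model_md k l = ms + (1 - k * ms) * mt + S * T"
    by (simp_all add: l_def model_sin_add model_md_add c S_def T_def flip: ms_def mt_def)
  have l2: "model_cos k l = 1 - k * (ms + (1 - k * ms) * mt + S * T)"
    using l(2) by (simp add: model_cos_md)
  have e1: "S * (S * T) = T * (2 * ms - k * (ms * ms))" 
    unfolding mult.assoc[symmetric] sq by (rule mult.commute)
  show ?thesis
    unfolding l l2 c ms_def[symmetric] mt_def[symmetric] using e1 by algebra
qed

text \<open>Geodesics are not available before local compactness is known, so monotonicity of comparison
  angles is needed for almost-between points \<open>y\<close>. For the contraction below, \<open>\<delta>\<close> must not depend on \<open>z\<close>.\<close>

lemma almost_between_mcos:
  assumes x: "x \<in> M" "x' \<in> M" and s: "0 < s" "s < d x x'" and l: "d x x' \<le> R0 / 4"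
    and e: "e > 0" and \<rho>: "\<rho> > 0"
  shows "\<exists>\<delta>>0. \<forall>y\<in>M. \<forall>z\<in>M. d x y = s \<and> d y x' \<le> d x x' - s + \<delta> \<and> \<rho> \<le> d x z \<and> d x z \<le> R0 / 4 \<longrightarrow>
    mcos k s (d x z) (d y z) \<le> mcos k (d x x') (d x z) (d x' z) + e"
proof -
  define l where "l = d x x'"
  define K where "K = R0\<^sup>2"
  \<comment> \<open>Here \<open>u\<close> stands for \<open>d y x'\<close>. The first three terms
    measure the effect of replacing \<open>s + u\<close> by \<open>l\<close>, with \<open>K\<close>
    bounding the modified distances that occur as coefficients; the last is the Stewart defect, with
    \<open>R0\<close> bounding a sine. All vanish at \<open>u = l - s\<close>, and continuity there
    gives \<open>\<delta>\<close>.\<close>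
  define err where "err u = \<bar>model_md k (s + u) / model_sin k (s + u) - model_md k l / model_sin k l\<bar>
     + K * \<bar>model_cos k (s + u) / model_sin k (s + u) - model_cos k l / model_sin k l\<bar>
     + K * \<bar>1 / model_sin k (s + u) - 1 / model_sin k l\<bar>
     + arccos (- mcos k s u l) * (model_sin k u * R0 / model_sin k (s + u))" for u
  have sl: "0 < s" "s < l" "l \<le> R0 / 4" using s l by (simp_all add: l_def)
  note R0_pos[simp]
  have sinpos: "0 < model_sin k v" if "0 < v" "v \<le> R0" for v
    using good_sin_pos[OF good_R0] that by simp
  have m1: "- 1 \<le> - mcos k s u l \<and> - mcos k s u l \<le> 1" if "u \<in> {l - s..l}" for u
    using mcos_bounds[OF good_R0, of s u l] that sl by auto
  have cont: "continuous_on {l - s..l} err"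
  proof -
    have c0: "continuous_on A (model_sin k)" "continuous_on A (model_md k)" for A
      by (auto intro!: continuous_at_imp_continuous_on isCont_model_sin isCont_model_md)
    have "model_sin k u \<noteq> 0" if "u \<in> {l - s..l}" for u
      using sinpos[of u] that sl by auto
    then have "continuous_on {l - s..l} (\<lambda>u. mcos k s u l)"
      unfolding mcos_def using sinpos[of s] sl by (intro continuous_intros c0) auto
    moreover have "model_sin k (s + u) \<noteq> 0" if "u \<in> {l - s..l}" for u
      using sinpos[of "s + u"] that sl by auto
    moreover have "model_sin k l \<noteq> 0" using sinpos[of l] sl by auto
    ultimately show ?thesis
      unfolding err_def by (intro continuous_intros c0) (use m1 in auto)
  qed
  have "mcos k s (l - s) l = -1"
    using mcos_law(2)[of k s "l - s" l] sinpos[of s] sinpos[of "l - s"] sl by auto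
  then have err0: "err (l - s) = 0" by (simp add: err_def)
  \<comment> \<open>The estimate is finally divided by \<open>Sa\<close>, which is at least
    \<open>\<rho> / 2\<close>; this tolerance then becomes \<open>e\<close>.\<close>
  have "e * \<rho> / 2 > 0" using e \<rho> by simp
  with cont sl obtain \<delta> where \<delta>: "\<delta> > 0"
    "\<And>u. u \<in> {l - s..l} \<Longrightarrow> dist u (l - s) < \<delta> \<Longrightarrow> dist (err u) (err (l - s)) < e * \<rho> / 2"
    unfolding continuous_on_iff by (metis atLeastAtMost_iff diff_le_eq le_add_same_cancel1 less_eq_real_def order_refl)
  \<comment> \<open>The minimum with \<open>s\<close> keeps \<open>d y x'\<close> inside
    \<open>{l - s..l}\<close>, where \<open>err\<close> is controlled.\<close>
  have "mcos k s (d x z) (d y z) \<le> mcos k l (d x z) (d x' z) + e"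
    if y: "y \<in> M" "z \<in> M" "d x y = s" "d y x' \<le> l - s + min (\<delta> / 2) s" and z: "\<rho> \<le> d x z" "d x z \<le> R0 / 4"
    for y z
  proof -
    define t where "t = d y x'"
    define a where "a = d x z"
    define b where "b = d x' z"
    define h where "h = d y z"
    define l' where "l' = s + t"
    define S' where "S' = model_sin k l'"
    define L where "L = model_sin k l"
    define Sa where "Sa = model_sin k a"
    define W where "W = arccos (- mcos k s t l)"
    have t: "l - s \<le> t" "t \<le> l" "dist t (l - s) < \<delta>"
      using d_tri[of x y x'] x y \<delta>(1) by (auto simp: t_def l_def dist_real_def)
    have ab: "0 < a" "a \<le> R0 / 4" "0 \<le> b" "b \<le> R0 / 2" "0 \<le> h" "h \<le> R0 / 2"
      using d_tri[of x' x z] d_tri[of y x z] x y z \<rho> sl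
      by (auto simp: a_def b_def h_def mdist_commute l_def)
    have dyx: "d y x = s" using y by (simp add: mdist_commute)
    have "x \<noteq> y" "x' \<noteq> y" using x y sl t by (auto simp: t_def)
    then have "- W * (model_sin k s * model_sin k t * model_sin k h)
      \<le> model_sin k s * (model_md k t + model_cos k t * model_md k h - model_md k b)
       + model_sin k t * (model_md k s + model_cos k s * model_md k h - model_md k a)"
      using stewart[of x x' y z, unfolded dyx, folded t_def h_def a_def b_def l_def, folded W_def]
        x y sl t ab by simp
    then have 1: "S' * (model_md k s + model_cos k s * model_md k a - model_md k h)
       \<le> model_sin k s * (model_md k l' + model_cos k l' * model_md k a - model_md k b)
         + W * (model_sin k s * model_sin k t * model_sin k h)"
      using stewart_identity[of s t "model_md k a" "model_md k h" "model_md k b"] by (simp add: l'_def S'_def)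
    have pos: "S' > 0" "L > 0" "Sa > 0" "model_sin k s > 0" "model_sin k t > 0"
      unfolding S'_def L_def Sa_def l'_def using sl t ab by (auto intro!: sinpos)
    have Sa: "\<rho> / 2 \<le> Sa" using good_sin(1)[OF good_R0, of a] ab z by (simp add: Sa_def a_def)
    have h: "0 \<le> model_sin k h" "model_sin k h \<le> R0"
      using good_sin[OF good_R0, of h] ab by simp_all
    have mab: "0 \<le> model_md k a" "model_md k a \<le> K" "0 \<le> model_md k b" "model_md k b \<le> K"
    proof -
      have *: "0 \<le> model_md k v \<and> model_md k v \<le> K" if v: "0 \<le> v" "v \<le> R0" for v
      proof -
        have "v\<^sup>2 \<le> R0\<^sup>2" using v by (intro power_mono) auto
        moreover have "0 \<le> v\<^sup>2" by simp
        moreover have "v\<^sup>2 / 4 \<le> model_md k v" "model_md k v \<le> 3 / 4 * v\<^sup>2"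
          using good_md[OF good_R0, of 0 v] v by simp_all
        ultimately show ?thesis unfolding K_def by (intro conjI; linarith)
      qed
      show "0 \<le> model_md k a" "model_md k a \<le> K" "0 \<le> model_md k b" "model_md k b \<le> K"
        using *[of a] *[of b] ab by simp_all
    qed
    have W: "0 \<le> W" using m1[of t] t by (auto simp: W_def intro!: arccos_lbound)
    have "(model_md k s + model_cos k s * model_md k a - model_md k h) / model_sin k s
       = (S' * (model_md k s + model_cos k s * model_md k a - model_md k h)) / (S' * model_sin k s)"
      using pos by simp
    also have "\<dots> \<le> (model_sin k s * (model_md k l' + model_cos k l' * model_md k a - model_md k b)
         + W * (model_sin k s * model_sin k t * model_sin k h)) / (S' * model_sin k s)"
      using 1 pos by (intro divide_right_mono) auto
    also have "\<dots> = (model_md k l' + model_cos k l' * model_md k a - model_md k b) / S' + W * (model_sin k t * model_sin k h / S')"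
      using pos by (simp add: add_divide_distrib)
    also have "\<dots> \<le> (model_md k l + model_cos k l * model_md k a - model_md k b) / L + err t"
    proof -
      have "W * (model_sin k t * model_sin k h / S') \<le> W * (model_sin k t * R0 / S')"
        using W pos h by (intro mult_left_mono divide_right_mono) auto
      moreover have "(u1 + v1 * ma - mb) / S' - (u2 + v2 * ma - mb) / L
          = (u1 / S' - u2 / L) + ma * (v1 / S' - v2 / L) - mb * (1 / S' - 1 / L)"
        for u1 v1 u2 v2 ma mb
        using pos(1,2) by (simp add: field_simps)
      note this[of "model_md k l'" "model_cos k l'" "model_md k a" "model_md k b" "model_md k l" "model_cos k l"]
      moreover have "model_md k a * (model_cos k l' / S' - model_cos k l / L) \<le> K * \<bar>model_cos k l' / S' - model_cos k l / L\<bar>"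
      proof -
        have "model_md k a * (model_cos k l' / S' - model_cos k l / L) \<le> model_md k a * \<bar>model_cos k l' / S' - model_cos k l / L\<bar>"
          using mab by (intro mult_left_mono) auto
        also have "\<dots> \<le> K * \<bar>model_cos k l' / S' - model_cos k l / L\<bar>" using mab by (intro mult_right_mono) auto
        finally show ?thesis .
      qed
      moreover have "- model_md k b * (1 / S' - 1 / L) \<le> K * \<bar>1 / S' - 1 / L\<bar>"
      proof -
        have "model_md k b * (- (1 / S' - 1 / L)) \<le> model_md k b * \<bar>1 / S' - 1 / L\<bar>"
          using mab by (intro mult_left_mono) auto
        also have "\<dots> \<le> K * \<bar>1 / S' - 1 / L\<bar>" using mab by (intro mult_right_mono) auto
        finally show ?thesis by (simp only: mult_minus_left mult_minus_right)
      qed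
      ultimately show ?thesis
        unfolding err_def l'_def[symmetric] S'_def[symmetric] L_def[symmetric] W_def[symmetric] by linarith
    qed
    also have "err t \<le> e * \<rho> / 2" using \<delta>(2)[of t] t err0 by (auto simp: dist_real_def)
    finally have 2: "(model_md k s + model_cos k s * model_md k a - model_md k h) / model_sin k s
      \<le> (model_md k l + model_cos k l * model_md k a - model_md k b) / L + e * \<rho> / 2" by simp
    have "mcos k s a h = (model_md k s + model_cos k s * model_md k a - model_md k h) / model_sin k s / Sa"
      by (simp add: mcos_def Sa_def)
    also have "\<dots> \<le> ((model_md k l + model_cos k l * model_md k a - model_md k b) / L + e * \<rho> / 2) / Sa"
      using 2 pos by (intro divide_right_mono) auto
    also have "\<dots> = mcos k l a b + e * (\<rho> / 2) / Sa"
      by (simp add: mcos_def Sa_def L_def add_divide_distrib)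
    also have "e * (\<rho> / 2) / Sa \<le> e"
    proof -
      have "e * (\<rho> / 2) \<le> e * Sa" using Sa e by (intro mult_left_mono) auto
      then show ?thesis using pos by (simp add: divide_le_eq)
    qed
    finally show ?thesis by (simp add: a_def b_def h_def)
  qed
  then show ?thesis
    using \<delta>(1) s(1) unfolding l_def
    by (intro exI[of _ "min (\<delta> / 2) s"]) auto
qed

text \<open>An exact intermediate point satisfies the hypothesis of
  \<open>almost_between_mcos\<close> for every \<open>\<delta>\<close>, so the error can be sent to
  0.\<close>

lemma between_mcos_mono:
  assumes M: "x \<in> M" "x' \<in> M" "y \<in> M" "z \<in> M" and ne: "x \<noteq> y" "x \<noteq> z"
    and l: "d x y + d y x' = d x x'" "d x x' \<le> R0 / 4" "d x z \<le> R0 / 4"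
  shows "mcos k (d x y) (d x z) (d y z) \<le> mcos k (d x x') (d x z) (d x' z)"
proof (cases "y = x'")
  case False
  have s: "0 < d x y" "d x y < d x x'" and \<rho>: "0 < d x z"
    using d_pos[of x y] d_pos[of y x'] d_pos[of x z] M ne l False by auto
  show ?thesis
  proof (rule field_le_epsilon)
    fix e :: real assume "e > 0"
    from almost_between_mcos[OF M(1,2) s l(2) this \<rho>] M l(3) s(1) l(1)
    show "mcos k (d x y) (d x z) (d y z) \<le> mcos k (d x x') (d x z) (d x' z) + e"
      by force
  qed
qed (use l in simp)

section \<open>Almost geodesics\<close>

text \<open>Points are picked on a curve of length below \<open>d x x' + e\<close> and labelled by
  their distance from \<open>x\<close>, not by arc length. The map \<open>f\<close> need not be
  continuous; only its mutual distances are used later.\<close>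

lemma almost_geodesic:
  assumes x: "x \<in> M" "x' \<in> M" and e: "e > 0"
  obtains f where "\<And>t. t \<in> {0..d x x'} \<Longrightarrow> f t \<in> M"
    "\<And>t. t \<in> {0..d x x'} \<Longrightarrow> d x (f t) = t"
    "\<And>t. t \<in> {0..d x x'} \<Longrightarrow> d (f t) x' \<le> d x x' - t + e"
    "\<And>s t. s \<in> {0..d x x'} \<Longrightarrow> t \<in> {0..d x x'} \<Longrightarrow> d (f s) (f t) \<le> \<bar>s - t\<bar> + e"
proof -
  define l where "l = d x x'"
  have "length_space X" using Alex by (simp add: Alex_def)
  then have "(INF \<gamma> \<in> {\<gamma>. pathin (mtopology_of X) \<gamma> \<and> \<gamma> 0 = x \<and> \<gamma> 1 = x'}. curve_length X \<gamma>) = ennreal l"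
    using x by (simp add: length_space_def l_def)
  also have "\<dots> < ennreal (l + e)" using e by (simp add: l_def ennreal_lessI)
  finally obtain \<gamma> where \<gamma>: "pathin (mtopology_of X) \<gamma>" "\<gamma> 0 = x" "\<gamma> 1 = x'" "curve_length X \<gamma> < ennreal (l + e)"
    unfolding INF_less_iff by auto
  have cont: "continuous_map (top_of_set {0..1}) (mtopology_of X) \<gamma>" using \<gamma>(1) by (simp add: pathin_def)
  have \<gamma>M: "\<gamma> u \<in> M" if "u \<in> {0..1}" for u
    using cont that unfolding continuous_map_def by auto
  \<comment> \<open>A single four-point subdivision yields all the required distance bounds.\<close>
  have len: "d x (\<gamma> u) + d (\<gamma> u) (\<gamma> v) + d (\<gamma> v) x' < l + e" if "0 \<le> u" "u \<le> v" "v \<le> 1" for u v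
  proof -
    have "[0, u, v, 1] \<in> {ts. sorted ts \<and> set ts \<subseteq> {0..1::real}}" using that by auto
    from SUP_upper[OF this, of "\<lambda>ts. \<Sum>i < length ts - 1. ennreal (d (\<gamma> (ts ! i)) (\<gamma> (ts ! Suc i)))"]
    have "(\<Sum>i < 3. ennreal (d (\<gamma> ([0, u, v, 1] ! i)) (\<gamma> ([0, u, v, 1] ! Suc i)))) \<le> curve_length X \<gamma>"
      by (simp add: curve_length_def numeral_3_eq_3)
    then have "ennreal (d x (\<gamma> u) + d (\<gamma> u) (\<gamma> v) + d (\<gamma> v) x') \<le> curve_length X \<gamma>"
      by (simp add: numeral_3_eq_3 lessThan_Suc \<gamma> ennreal_plus add_ac)
    also note \<gamma>(4)
    finally show ?thesis using e by (subst (asm) ennreal_less_iff) auto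
  qed
  have cd: "continuous_on {0..1} (\<lambda>u. d x (\<gamma> u))"
    unfolding continuous_on_iff
  proof (intro ballI allI impI)
    fix u \<epsilon> :: real assume u: "u \<in> {0..1}" "0 < \<epsilon>"
    have "openin (mtopology_of X) (mball_of X (\<gamma> u) \<epsilon>)"
      by (simp add: mtopology_of_def mball_of_def Metric_space.openin_mball)
    with cont have "openin (top_of_set {0..1}) {v \<in> {0..1}. \<gamma> v \<in> mball_of X (\<gamma> u) \<epsilon>}"
      unfolding continuous_map_def topspace_euclidean_subtopology by blast
    moreover have "u \<in> {v \<in> {0..1}. \<gamma> v \<in> mball_of X (\<gamma> u) \<epsilon>}" using u \<gamma>M by auto
    ultimately obtain \<delta> where "\<delta> > 0" "\<And>v. v \<in> {0..1} \<Longrightarrow> dist v u < \<delta> \<Longrightarrow> \<gamma> v \<in> mball_of X (\<gamma> u) \<epsilon>"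
      unfolding openin_euclidean_subtopology_iff by blast
    moreover have "dist (d x (\<gamma> v)) (d x (\<gamma> u)) < \<epsilon>" if "\<gamma> v \<in> mball_of X (\<gamma> u) \<epsilon>" for v
      using d_diff[of x "\<gamma> v" "\<gamma> u"] that x by (auto simp: dist_real_def mdist_commute)
    ultimately show "\<exists>\<delta>>0. \<forall>v\<in>{0..1}. dist v u < \<delta> \<longrightarrow> dist (d x (\<gamma> v)) (d x (\<gamma> u)) < \<epsilon>" by blast
  qed
  have "\<exists>u. 0 \<le> u \<and> u \<le> 1 \<and> d x (\<gamma> u) = t" if "t \<in> {0..l}" for t
    using IVT'[of "\<lambda>u. d x (\<gamma> u)" 0 t 1] cd that x \<gamma> by (auto simp: l_def)
  then obtain g where g: "\<And>t. t \<in> {0..l} \<Longrightarrow> 0 \<le> g t \<and> g t \<le> 1 \<and> d x (\<gamma> (g t)) = t" by metis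
  have gg: "d (\<gamma> (g s)) (\<gamma> (g t)) \<le> \<bar>s - t\<bar> + e" if "s \<in> {0..l}" "t \<in> {0..l}" "g s \<le> g t" for s t
  proof -
    have "l \<le> t + d (\<gamma> (g t)) x'"
      using d_tri[of x "\<gamma> (g t)" x'] x g[OF that(2)] \<gamma>M[of "g t"] by (simp add: l_def)
    then show ?thesis using len[of "g s" "g t"] g[OF that(1)] g[OF that(2)] that(3) by auto
  qed
  show ?thesis
  proof (rule that[of "\<lambda>t. \<gamma> (g t)", folded l_def])
    fix t assume t: "t \<in> {0..l}"
    show "\<gamma> (g t) \<in> M" "d x (\<gamma> (g t)) = t" using g[OF t] \<gamma>M by auto
    show "d (\<gamma> (g t)) x' \<le> l - t + e"
      using len[of "g t" "g t"] g[OF t] \<gamma>M[of "g t"] by simp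
    show "d (\<gamma> (g s)) (\<gamma> (g t)) \<le> \<bar>s - t\<bar> + e" if "s \<in> {0..l}" for s
      using gg[of s t] gg[of t s] that t by (cases "g s \<le> g t") (auto simp: mdist_commute abs_minus_commute)
  qed
qed

end

section \<open>Finite Hausdorff dimension implies doubling\<close>

text \<open>If at every location and scale there are \<open>N\<close> points with relative separation \<open>c\<close>, these form a Cantor
  set; the uniform measure on its code space bounds the Hausdorff measure from below.\<close>

lemma hausdorff_measure_pos_if_separated:
  fixes X :: "'a metric"
  assumes compl: "mcomplete_of X" and p: "p \<in> mspace X" and r: "r > 0" and c: "0 < c" "c \<le> 1"
    and s: "s > 0" and N: "real N \<ge> (8 / c) powr s"
    and tree: "\<And>x \<rho>. x \<in> mspace X \<Longrightarrow> mdist X p x \<le> 2 * r \<Longrightarrow> 0 < \<rho> \<Longrightarrow> \<rho> \<le> r \<Longrightarrow>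
      \<exists>f. (\<forall>i<N. f i \<in> mspace X \<and> mdist X x (f i) \<le> \<rho>) \<and>
          (\<forall>i<N. \<forall>j<N. i \<noteq> j \<longrightarrow> c * \<rho> \<le> mdist X (f i) (f j))"
  shows "hausdorff_measure X s (mspace X) \<noteq> 0"
proof
  assume H0: "hausdorff_measure X s (mspace X) = 0"
  interpret Metric_space "mspace X" "mdist X" by (rule Metric_space_mspace_mdist)
  note nonneg = mdist_nonneg
  let ?d = "mdist X"
  \<comment> \<open>Shrinking by \<open>c / 8\<close> per level keeps the descendants of a node well
    inside the gaps between siblings. The hypothesis on \<open>N\<close> now says that
    \<open>N * \<theta> powr s\<close> is at least 1.\<close>
  define \<theta> where "\<theta> = c / 8"
  have \<theta>: "0 < \<theta>" "\<theta> \<le> 1 / 8" using c by (simp_all add: \<theta>_def)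
  have \<theta>pow: "0 < \<theta> ^ j" "\<theta> ^ j \<le> 1" for j using \<theta> by (simp_all add: power_le_one)
  have N\<theta>: "(1 / \<theta>) powr s \<le> real N" using N c by (simp add: \<theta>_def)
  have "1 < (1 / \<theta>) powr s" using \<theta> s by (simp add: gr_one_powr)
  with N\<theta> have N2: "N \<ge> 2" by simp
  obtain F where F: "\<And>x \<rho>. x \<in> mspace X \<and> ?d p x \<le> 2 * r \<and> 0 < \<rho> \<and> \<rho> \<le> r \<Longrightarrow>
      (\<forall>i<N. F x \<rho> i \<in> mspace X \<and> ?d x (F x \<rho> i) \<le> \<rho>) \<and>
      (\<forall>i<N. \<forall>j<N. i \<noteq> j \<longrightarrow> c * \<rho> \<le> ?d (F x \<rho> i) (F x \<rho> j))"
    using tree by metis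
  \<comment> \<open>A word \<open>w\<close> describes a branch: letter \<open>j\<close> selects one
    of the \<open>N\<close> points around the current node at scale \<open>r * \<theta> ^ j\<close>.
    The node at level \<open>j\<close> depends only on the first \<open>j\<close> letters.\<close>
  define node where "node w = rec_nat p (\<lambda>j x. F x (r * \<theta> ^ j) (w j))" for w :: "nat \<Rightarrow> nat"
  have node_0: "node w 0 = p" and node_Suc: "node w (Suc j) = F (node w j) (r * \<theta> ^ j) (w j)" for w j
    by (simp_all add: node_def)
  define W where "W = {w :: nat \<Rightarrow> nat. \<forall>i. w i < N}"
  have scale: "0 < r * \<theta> ^ j" "r * \<theta> ^ j \<le> r" for j
    using r \<theta>pow[of j] by (simp_all add: mult_left_le)
  have node: "node w j \<in> mspace X \<and> ?d p (node w j) \<le> 2 * r * (1 - \<theta> ^ j)" if "w \<in> W" for w j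
  proof (induction j)
    case 0
    then show ?case using p by (simp add: node_0)
  next
    case (Suc j)
    have "2 * r * (1 - \<theta> ^ j) \<le> 2 * r" using r \<theta>pow[of j] by (simp add: mult_left_le)
    with Suc have le: "?d p (node w j) \<le> 2 * r" by linarith
    with Suc F[of "node w j" "r * \<theta> ^ j"] scale[of j] that
    have *: "node w (Suc j) \<in> mspace X" "?d (node w j) (node w (Suc j)) \<le> r * \<theta> ^ j"
      by (auto simp: node_Suc W_def)
    have "r * \<theta> ^ j * \<theta> \<le> r * \<theta> ^ j * (1 / 2)" using scale[of j] \<theta> by (intro mult_left_mono) auto
    then have "2 * r * (1 - \<theta> ^ j) + r * \<theta> ^ j \<le> 2 * r * (1 - \<theta> ^ Suc j)"
      by (simp add: algebra_simps)
    with * Suc triangle[of p "node w j" "node w (Suc j)"] p show ?case by auto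
  qed
  have node_le: "?d p (node w j) \<le> 2 * r" if "w \<in> W" for w j
  proof -
    have "2 * r * (1 - \<theta> ^ j) \<le> 2 * r" using r \<theta>pow[of j] by (simp add: mult_left_le)
    with node[OF that, of j] show ?thesis by linarith
  qed
  have nodeM: "node w j \<in> mspace X" if "w \<in> W" for w j using node[OF that] by simp
  have step: "?d (node w j) (node w (Suc j)) \<le> r * \<theta> ^ j" if "w \<in> W" for w j
    using F[of "node w j" "r * \<theta> ^ j"] scale[of j] nodeM[OF that] node_le[OF that] that
    by (auto simp: node_Suc W_def)
  \<comment> \<open>The factor 8/7 is the sum of the geometric series with ratio 1/8.\<close>
  have tail: "?d (node w j) (node w (j + n)) \<le> 8 / 7 * r * (\<theta> ^ j - \<theta> ^ (j + n))" if "w \<in> W" for w j n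
  proof (induction n)
    case 0
    then show ?case using nodeM[OF that] by simp
  next
    case (Suc n)
    have "?d (node w j) (node w (j + Suc n)) \<le> ?d (node w j) (node w (j + n)) + r * \<theta> ^ (j + n)"
      using triangle[of "node w j" "node w (j+n)" "node w (j + Suc n)"] nodeM[OF that] step[OF that, of "j + n"] by auto
    moreover have "r * \<theta> ^ (j + n) * \<theta> \<le> r * \<theta> ^ (j + n) * (1 / 8)"
      using scale[of "j + n"] \<theta> by (intro mult_left_mono) auto
    ultimately show ?case using Suc by (simp add: algebra_simps)
  qed
  have tail': "?d (node w j) (node w m) \<le> 8 / 7 * r * \<theta> ^ j" if "w \<in> W" "j \<le> m" for w j m
  proof -
    have "8 / 7 * r * (\<theta> ^ j - \<theta> ^ m) \<le> 8 / 7 * r * \<theta> ^ j" using scale[of m] by (simp add: algebra_simps)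
    with tail[OF that(1), of j "m - j"] that show ?thesis by simp
  qed
  have "\<exists>l. l \<in> mspace X \<and> (\<forall>\<epsilon>>0. \<exists>n. \<forall>m\<ge>n. ?d (node w m) l < \<epsilon>)" if w: "w \<in> W" for w
  proof -
    have "MCauchy (node w)"
      unfolding MCauchy_def
    proof (intro conjI allI impI)
      show "range (node w) \<subseteq> mspace X" using nodeM[OF w] by auto
      fix \<epsilon> :: real assume "\<epsilon> > 0"
      then obtain n where "\<theta> ^ n < \<epsilon> / (4 * r)"
        using real_arch_pow_inv[of "\<epsilon> / (4 * r)" \<theta>] \<theta> r by auto
      then have n: "r * \<theta> ^ n < \<epsilon> / 4" using r by (simp add: field_simps)
      have "?d (node w i) (node w j) < \<epsilon>" if "n \<le> i" "n \<le> j" for i j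
        using tail'[OF w that(1)] tail'[OF w that(2)] n scale[of n] nodeM[OF w]
          triangle''[of "node w i" "node w n" "node w j"] \<open>\<epsilon> > 0\<close> by (simp add: algebra_simps)
      then show "\<exists>n. \<forall>i j. n \<le> i \<longrightarrow> n \<le> j \<longrightarrow> ?d (node w i) (node w j) < \<epsilon>" by blast
    qed
    moreover have mcomplete using compl by (simp add: mcomplete_of_def)
    ultimately have "\<exists>l. limitin mtopology (node w) l sequentially" by (simp only: mcomplete_def)
    then obtain l where "limitin mtopology (node w) l sequentially" ..
    then have "l \<in> mspace X" "\<forall>\<epsilon>>0. \<exists>n. \<forall>m\<ge>n. node w m \<in> mspace X \<and> ?d (node w m) l < \<epsilon>"
      unfolding limit_metric_sequentially by (rule conjunct1, rule conjunct2)
    then show ?thesis by metis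
  qed
  then obtain f where f: "\<And>w. w \<in> W \<Longrightarrow> f w \<in> mspace X"
    "\<And>w \<epsilon>. w \<in> W \<Longrightarrow> \<epsilon> > 0 \<Longrightarrow> \<exists>n. \<forall>m\<ge>n. ?d (node w m) (f w) < \<epsilon>"
    by metis
  have flim: "?d (node w j) (f w) \<le> 8 / 7 * r * \<theta> ^ j" if w: "w \<in> W" for w j
  proof (rule field_le_epsilon)
    fix \<epsilon> :: real assume "\<epsilon> > 0"
    from f(2)[OF w this] obtain n where "\<And>m. m \<ge> n \<Longrightarrow> ?d (node w m) (f w) < \<epsilon>" by blast
    then have "?d (node w (max n j)) (f w) < \<epsilon>" by simp
    then show "?d (node w j) (f w) \<le> 8 / 7 * r * \<theta> ^ j + \<epsilon>"
      using tail'[OF w, of j "max n j"] triangle[of "node w j" "node w (max n j)" "f w"] nodeM[OF w] f(1)[OF w]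
      by auto
  qed
  have node_cong: "node w j = node w' j" if "\<And>i. i < j \<Longrightarrow> w i = w' i" for w w' j
    using that by (induction j) (simp_all add: node_0 node_Suc)
  \<comment> \<open>Siblings are \<open>c * (r * \<theta> ^ j)\<close> apart, each limit point is
    off by at most one seventh of this, and 5/7 exceeds 1/2.\<close>
  have sep: "c / 2 * (r * \<theta> ^ j) \<le> ?d (f w) (f w')"
    if w: "w \<in> W" "w' \<in> W" and eq: "\<And>i. i < j \<Longrightarrow> w i = w' i" and ne: "w j \<noteq> w' j" for w w' j
  proof -
    have nc: "node w' j = node w j" using node_cong[OF eq] by simp
    have "c * (r * \<theta> ^ j) \<le> ?d (node w (Suc j)) (node w' (Suc j))"
      using F[of "node w j" "r * \<theta> ^ j"] scale[of j] nodeM[OF w(1)] node_le[OF w(1)] w ne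
      by (auto simp: node_Suc W_def nc)
    moreover have "?d (node w (Suc j)) (node w' (Suc j))
        \<le> ?d (node w (Suc j)) (f w) + ?d (f w) (f w') + ?d (node w' (Suc j)) (f w')"
      using triangle[of "node w (Suc j)" "f w" "node w' (Suc j)"] triangle'[of "f w" "f w'" "node w' (Suc j)"]
        nodeM w f(1) by auto
    moreover have "8 / 7 * r * \<theta> ^ Suc j = c * (r * \<theta> ^ j) / 7" by (simp add: \<theta>_def)
    moreover have "0 \<le> c * (r * \<theta> ^ j)" using c scale[of j] by simp
    ultimately have "c * (r * \<theta> ^ j) / 2 \<le> ?d (f w) (f w')"
      using flim[OF w(1), of "Suc j"] flim[OF w(2), of "Suc j"] by linarith
    then show ?thesis by simp
  qed

  let ?P = "Pi\<^sub>M UNIV (\<lambda>_::nat. uniform_count_measure {..<N})"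
  have ne: "{..<N} \<noteq> {}" using N2 by (auto simp: lessThan_empty_iff)
  interpret product_prob_space "\<lambda>_. uniform_count_measure {..<N}" "UNIV :: nat set"
    by (intro product_prob_spaceI prob_space_uniform_count_measure ne) simp
  have space: "space ?P = W" by (auto simp: space_PiM W_def PiE_iff space_uniform_count_measure)
  have cyl: "emeasure ?P {w \<in> W. \<forall>i\<in>{..j}. w i \<in> {w0 i}} = ennreal ((1 / N) ^ Suc j)"
    "{w \<in> W. \<forall>i\<in>{..j}. w i \<in> {w0 i}} \<in> sets ?P" if "w0 \<in> W" for w0 j
  proof -
    have "emeasure ?P {w \<in> space ?P. \<forall>i\<in>{..j}. w i \<in> {w0 i}}
        = (\<Prod>i\<in>{..j}. emeasure (uniform_count_measure {..<N}) {w0 i})"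
      by (rule emeasure_PiM_Collect) (use that in \<open>auto simp: W_def sets_uniform_count_measure\<close>)
    also have "\<dots> = (\<Prod>i\<in>{..j}. ennreal (1 / N))"
      by (intro prod.cong refl, subst emeasure_uniform_count_measure) (use that in \<open>auto simp: W_def\<close>)
    also have "\<dots> = ennreal (1 / N) ^ Suc j" by simp
    also have "\<dots> = ennreal ((1 / N) ^ Suc j)" by (simp add: ennreal_power del: power_Suc)
    finally show "emeasure ?P {w \<in> W. \<forall>i\<in>{..j}. w i \<in> {w0 i}} = ennreal ((1 / N) ^ Suc j)" by (simp add: space)
    have "{w \<in> space ?P. \<forall>i\<in>{..j}. w i \<in> {w0 i}} \<in> sets ?P"
      by (intro sets.sets_Collect_finite_All sets_Collect_single')
        (use that in \<open>auto simp: W_def sets_uniform_count_measure space_uniform_count_measure\<close>)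
    then show "{w \<in> W. \<forall>i\<in>{..j}. w i \<in> {w0 i}} \<in> sets ?P" by (simp add: space)
  qed

  \<comment> \<open>By \<open>sep\<close>, limit points whose words first differ at letter
    \<open>j\<close> are at least \<open>\<theta> ^ j * b\<close> apart.\<close>
  define b where "b = c * r / 2"
  have b: "b > 0" using c r by (simp add: b_def)
  \<comment> \<open>The quarter leaves room for correction terms of total 1/2: the whole code space
    would get mass at most 3/4.\<close>
  define E where "E = b powr s / 4"
  have E: "E > 0" using b by (simp add: E_def)
  let ?cov = "\<lambda>\<delta>. {U :: nat \<Rightarrow> 'a set. (\<forall>i. U i \<subseteq> mspace X \<and> mdiam X (U i) \<le> ennreal \<delta>) \<and> mspace X \<subseteq> (\<Union>i. U i)}"
  have "(INF U\<in>?cov (b / 2). \<Sum>i. ennreal (enn2real (mdiam X (U i)) powr s)) \<le> hausdorff_measure X s (mspace X)"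
    unfolding hausdorff_measure_def by (rule SUP_upper) (use b in auto)
  also have "\<dots> < ennreal E" using H0 E by simp
  finally obtain U where U: "\<And>i. U i \<subseteq> mspace X" "\<And>i. mdiam X (U i) \<le> ennreal (b / 2)" "mspace X \<subseteq> (\<Union>i. U i)"
    and Usum: "(\<Sum>i. ennreal (enn2real (mdiam X (U i)) powr s)) < ennreal E"
    unfolding INF_less_iff by auto
  define D where "D i = enn2real (mdiam X (U i))" for i
  have D: "0 \<le> D i" "D i < b" for i
    using U(2)[of i] b enn2real_leI[of "b/2" "mdiam X (U i)"] by (auto simp: D_def)
  have dD: "?d x y \<le> D i" if "x \<in> U i" "y \<in> U i" for x y i
  proof -
    have "ennreal (?d x y) \<le> mdiam X (U i)"
      unfolding mdiam_def by (rule SUP_upper2[OF that(1)], rule SUP_upper2[OF that(2)]) simp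
    moreover have "mdiam X (U i) < top" using U(2)[of i] by (rule order.strict_trans1) simp
    ultimately show ?thesis by (metis D_def D(1) ennreal_enn2real ennreal_le_iff)
  qed
  \<comment> \<open>Mass distribution: a covering set meets only one cylinder of matching size. The
    summand \<open>(1 / 2) ^ (i + 2)\<close> pays for sets of diameter 0, where
    \<open>0 powr s = 0\<close> although every cylinder has positive mass.\<close>
  have "\<exists>A \<in> sets ?P. {w \<in> W. f w \<in> U i} \<subseteq> A \<and> emeasure ?P A \<le> ennreal (D i powr s / b powr s + (1 / 2) ^ (i + 2))" for i
  proof (cases "\<exists>w0 \<in> W. f w0 \<in> U i")
    case False
    then show ?thesis by (intro bexI[of _ "{}"]) auto
  next
    case True
    then obtain w0 where w0: "w0 \<in> W" "f w0 \<in> U i" by blast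
    have "\<exists>j. D i < \<theta> ^ j * b \<and> (1 / N) ^ Suc j \<le> D i powr s / b powr s + (1 / 2) ^ (i + 2)"
    proof (cases "D i = 0")
      case True
      have "(1 / real N) ^ Suc (Suc i) \<le> (1 / 2) ^ Suc (Suc i)"
        using N2 by (intro power_mono) (auto simp: field_simps)
      with True b \<theta>pow[of "Suc i"] show ?thesis by (intro exI[of _ "Suc i"]) simp
    next
      case False
      then have Dpos: "D i > 0" using D[of i] by simp
      have "\<exists>n. \<theta> ^ Suc n * b \<le> D i"
      proof -
        obtain n where "\<theta> ^ n < D i / b" using real_arch_pow_inv[of "D i / b" \<theta>] Dpos b \<theta> by auto
        then have "\<theta> ^ n * b < D i" using b by (simp add: field_simps)
        moreover have "\<theta> ^ Suc n * b \<le> \<theta> ^ n * b" using \<theta> b by (simp add: mult_left_le_one_le)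
        ultimately show ?thesis by (intro exI[of _ n]) linarith
      qed
      \<comment> \<open>The level at which the gaps drop to the diameter:
        \<open>\<theta> ^ Suc j * b \<le> D i < \<theta> ^ j * b\<close>. The mesh
        \<open>b / 2\<close> of the cover secures the upper bound when \<open>j = 0\<close>.\<close>
      define j where "j = (LEAST n. \<theta> ^ Suc n * b \<le> D i)"
      have j1: "\<theta> ^ Suc j * b \<le> D i" unfolding j_def by (rule LeastI_ex) fact
      have j2: "D i < \<theta> ^ j * b"
      proof (cases j)
        case 0
        then show ?thesis using D[of i] by simp
      next
        case (Suc m)
        then have "\<not> \<theta> ^ Suc m * b \<le> D i" unfolding j_def by (intro not_less_Least) simp
        then show ?thesis using Suc by simp
      qed
      have "1 / real N \<le> \<theta> powr s"
      proof -
        have "1 / real N \<le> 1 / ((1 / \<theta>) powr s)" using N\<theta> N2 \<theta> by (intro divide_left_mono mult_pos_pos) auto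
        also have "\<dots> = \<theta> powr s" using \<theta> by (simp add: powr_divide)
        finally show ?thesis .
      qed
      have pp: "(\<theta> powr s) ^ n = (\<theta> ^ n) powr s" for n
      proof (induction n)
        case (Suc n)
        show ?case unfolding power_Suc Suc.IH by (rule powr_mult[symmetric])
      qed (use \<theta> in simp)
      from \<open>1 / real N \<le> \<theta> powr s\<close> have "(1 / real N) ^ Suc j \<le> (\<theta> powr s) ^ Suc j"
        by (rule power_mono) simp
      also have "\<dots> = (\<theta> ^ Suc j) powr s" by (rule pp)
      also have "\<dots> \<le> (D i / b) powr s"
      proof (rule powr_mono2)
        show "\<theta> ^ Suc j \<le> D i / b" using j1 b by (simp only: pos_le_divide_eq)
      qed (use s \<theta> in auto)
      also have "\<dots> = D i powr s / b powr s" using Dpos b by (simp add: powr_divide)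
      also have "\<dots> \<le> D i powr s / b powr s + (1 / 2) ^ (i + 2)" by simp
      finally have "(1 / real N) ^ Suc j \<le> D i powr s / b powr s + (1 / 2) ^ (i + 2)" .
      with j2 show ?thesis by blast
    qed
    then obtain j where j: "D i < \<theta> ^ j * b" "(1 / N) ^ Suc j \<le> D i powr s / b powr s + (1 / 2) ^ (i + 2)" by blast
    \<comment> \<open>Strong induction makes \<open>m\<close> the first differing letter, and there
      the gap would exceed the diameter of \<open>U i\<close>.\<close>
    have "w m = w0 m" if w: "w \<in> W" "f w \<in> U i" "m \<le> j" for w m
      using that(3)
    proof (induction m rule: less_induct)
      case (less m)
      show ?case
      proof (rule ccontr)
        assume "w m \<noteq> w0 m"
        with less have "c / 2 * (r * \<theta> ^ m) \<le> ?d (f w) (f w0)" by (intro sep w w0) auto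
        also have "\<dots> \<le> D i" using dD w w0 by simp
        also note j(1)
        also have "\<theta> ^ j * b \<le> \<theta> ^ m * b" using less \<theta> b by (intro mult_right_mono power_decreasing) auto
        also have "\<theta> ^ m * b = c / 2 * (r * \<theta> ^ m)" by (simp add: b_def)
        finally show False by simp
      qed
    qed
    then have "{w \<in> W. f w \<in> U i} \<subseteq> {w \<in> W. \<forall>i\<in>{..j}. w i \<in> {w0 i}}" by auto
    moreover have "emeasure ?P {w \<in> W. \<forall>i\<in>{..j}. w i \<in> {w0 i}} \<le> ennreal (D i powr s / b powr s + (1 / 2) ^ (i + 2))"
      unfolding cyl(1)[OF w0(1)] by (rule ennreal_leI[OF j(2)])
    ultimately show ?thesis
      by (intro bexI[rotated, OF cyl(2)[OF w0(1), of j]] conjI)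
  qed
  then have "\<forall>i. \<exists>A. A \<in> sets ?P \<and> {w \<in> W. f w \<in> U i} \<subseteq> A \<and>
      emeasure ?P A \<le> ennreal (D i powr s / b powr s + (1 / 2) ^ (i + 2))" by blast
  from choice[OF this] obtain A where A': "\<forall>i. A i \<in> sets ?P \<and> {w \<in> W. f w \<in> U i} \<subseteq> A i \<and>
      emeasure ?P (A i) \<le> ennreal (D i powr s / b powr s + (1 / 2) ^ (i + 2))" ..
  then have A: "A i \<in> sets ?P" "{w \<in> W. f w \<in> U i} \<subseteq> A i"
    "emeasure ?P (A i) \<le> ennreal (D i powr s / b powr s + (1 / 2) ^ (i + 2))" for i
    by (simp_all only:)
  have "W \<subseteq> (\<Union>i. A i)"
  proof
    fix w assume "w \<in> W"
    with f(1) U(3) obtain i where "f w \<in> U i" by blast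
    with A(2) \<open>w \<in> W\<close> show "w \<in> (\<Union>i. A i)" by blast
  qed
  then have "emeasure ?P W \<le> emeasure ?P (\<Union>i. A i)" using A(1) by (intro emeasure_mono) auto
  also have "\<dots> \<le> (\<Sum>i. emeasure ?P (A i))" using A(1) by (intro emeasure_subadditive_countably) auto
  also have "\<dots> \<le> (\<Sum>i. ennreal (1 / b powr s) * ennreal (D i powr s) + ennreal ((1 / 2) ^ (i + 2)))"
  proof (intro suminf_le)
    fix i
    have "ennreal (D i powr s / b powr s + (1 / 2) ^ (i + 2))
        = ennreal (1 / b powr s * D i powr s) + ennreal ((1 / 2) ^ (i + 2))"
      by (subst ennreal_plus) auto
    also have "ennreal (1 / b powr s * D i powr s) = ennreal (1 / b powr s) * ennreal (D i powr s)"
      by (rule ennreal_mult) auto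
    finally show "emeasure ?P (A i) \<le> ennreal (1 / b powr s) * ennreal (D i powr s) + ennreal ((1 / 2) ^ (i + 2))"
      using A(3)[of i] by (simp only:)
  qed auto
  also have "\<dots> = ennreal (1 / b powr s) * (\<Sum>i. ennreal (D i powr s)) + (\<Sum>i. ennreal ((1 / 2) ^ (i + 2)))"
    by (simp add: suminf_add[symmetric])
  also have "(\<Sum>i. ennreal ((1 / 2) ^ (i + 2))) = ennreal (1 / 2)"
  proof (rule suminf_ennreal_eq)
    show "(\<lambda>i. (1 / 2) ^ (i + 2)) sums (1 / 2 :: real)"
      using sums_mult[OF power_half_series, of "1/2"] by (simp add: mult_ac)
  qed simp
  also have "ennreal (1 / b powr s) * (\<Sum>i. ennreal (D i powr s)) \<le> ennreal (1 / b powr s) * ennreal E"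
    using Usum by (intro mult_left_mono) (auto simp: D_def)
  also have "\<dots> = ennreal (1 / 4)" using b by (simp add: ennreal_mult[symmetric] E_def)
  finally have "emeasure ?P W \<le> ennreal (1 / 4) + ennreal (1 / 2)" by (simp add: add_right_mono)
  also have "\<dots> = ennreal (1 / 4 + 1 / 2)" by (rule ennreal_plus[symmetric]) auto
  also have "\<dots> < 1" by (subst ennreal_less_one_iff) simp
  finally show False using P.emeasure_space_1 by (simp add: space)
qed

context alexandrov
begin

text \<open>Each \<open>z\<close> is replaced by a point almost between \<open>x\<close> and
  \<open>z\<close>. The comparison cosine at \<open>x\<close> rises by at most \<open>2 * e\<close>,
  once per moved point, so the law of cosines preserves a fixed fraction of the scaled
  separation.\<close>

lemma contraction:
  assumes x: "x \<in> M" and T: "finite T" "T \<subseteq> M" and \<rho>: "\<rho> > 0" "\<And>z. z \<in> T \<Longrightarrow> \<rho> \<le> d x z"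
    and R: "\<And>z. z \<in> T \<Longrightarrow> d x z \<le> R0 / 4"
    and \<kappa>: "\<kappa> > 0" "\<And>z z'. z \<in> T \<Longrightarrow> z' \<in> T \<Longrightarrow> z \<noteq> z' \<Longrightarrow> \<kappa> \<le> d z z'"
    and \<mu>: "0 < \<mu>" "\<mu> < 1"
  obtains g where "\<And>z. z \<in> T \<Longrightarrow> g z \<in> M" "\<And>z. z \<in> T \<Longrightarrow> d x (g z) = \<mu> * d x z"
    "\<And>z z'. z \<in> T \<Longrightarrow> z' \<in> T \<Longrightarrow> z \<noteq> z' \<Longrightarrow> \<mu> * \<kappa> / 8 \<le> d (g z) (g z')"
proof -
  \<comment> \<open>Makes \<open>a * b * e\<close> at most \<open>\<kappa>\<^sup>2 / 36\<close> for
    all sides below \<open>R0\<close>, so that the loss \<open>2 * e\<close> consumes only half of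
    the separation term.\<close>
  define e where "e = \<kappa>\<^sup>2 / (36 * R0\<^sup>2)"
  have e: "e > 0" using \<kappa> R0_pos by (simp add: e_def)
  \<comment> \<open>The lower bound is \<open>\<mu> * \<rho>\<close> and not \<open>\<rho>\<close>,
    because the estimate is applied a second time with \<open>w\<close> an already contracted
    point.\<close>
  have "\<forall>z. \<exists>y. z \<in> T \<longrightarrow> y \<in> M \<and> d x y = \<mu> * d x z \<and>
      (\<forall>w \<in> M. \<mu> * \<rho> \<le> d x w \<and> d x w \<le> R0 / 4 \<longrightarrow>
        mcos k (\<mu> * d x z) (d x w) (d y w) \<le> mcos k (d x z) (d x w) (d z w) + e)"
  proof (intro allI)
    fix z
    show "\<exists>y. z \<in> T \<longrightarrow> y \<in> M \<and> d x y = \<mu> * d x z \<and>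
      (\<forall>w \<in> M. \<mu> * \<rho> \<le> d x w \<and> d x w \<le> R0 / 4 \<longrightarrow>
        mcos k (\<mu> * d x z) (d x w) (d y w) \<le> mcos k (d x z) (d x w) (d z w) + e)"
    proof (cases "z \<in> T")
      case True
      define s where "s = \<mu> * d x z"
      have z: "z \<in> M" "0 < d x z" "d x z \<le> R0 / 4" using True T \<rho>(1) \<rho>(2)[OF True] R[OF True] by auto
      have s: "0 < s" "s < d x z" using z \<mu> by (simp_all add: s_def)
      have "\<mu> * \<rho> > 0" using \<mu> \<rho> by simp
      from almost_between_mcos[OF x z(1) s z(3) e this] obtain \<delta> where \<delta>: "\<delta> > 0"
        "\<forall>y\<in>M. \<forall>w\<in>M. d x y = s \<and> d y z \<le> d x z - s + \<delta> \<and> \<mu> * \<rho> \<le> d x w \<and> d x w \<le> R0 / 4 \<longrightarrow>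
          mcos k s (d x w) (d y w) \<le> mcos k (d x z) (d x w) (d z w) + e" by blast
      obtain f where f: "\<And>t. t \<in> {0..d x z} \<Longrightarrow> f t \<in> M" "\<And>t. t \<in> {0..d x z} \<Longrightarrow> d x (f t) = t"
        "\<And>t. t \<in> {0..d x z} \<Longrightarrow> d (f t) z \<le> d x z - t + \<delta>"
        using almost_geodesic[OF x z(1) \<delta>(1)] by metis
      have "s \<in> {0..d x z}" using s by simp
      with f \<delta>(2) show ?thesis unfolding s_def[symmetric] by (intro exI[of _ "f s"]) auto
    qed auto
  qed
  from choice[OF this] obtain g where g: "\<And>z. z \<in> T \<Longrightarrow> g z \<in> M" "\<And>z. z \<in> T \<Longrightarrow> d x (g z) = \<mu> * d x z"
    "\<And>z w. z \<in> T \<Longrightarrow> w \<in> M \<Longrightarrow> \<mu> * \<rho> \<le> d x w \<Longrightarrow> d x w \<le> R0 / 4 \<Longrightarrow>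
        mcos k (\<mu> * d x z) (d x w) (d (g z) w) \<le> mcos k (d x z) (d x w) (d z w) + e"
    by auto
  have sep: "\<mu> * \<kappa> / 8 \<le> d (g z) (g z')" if z: "z \<in> T" "z' \<in> T" "z \<noteq> z'" for z z'
  proof -
    define a where "a = d x z"
    define b where "b = d x z'"
    define c where "c = d z z'"
    define c' where "c' = d (g z) (g z')"
    define C where "C = mcos k a b c"
    define C' where "C' = mcos k (\<mu> * a) (\<mu> * b) c'"
    have zM: "z \<in> M" "z' \<in> M" using T z by auto
    have ab: "0 < a" "a \<le> R0 / 4" "0 < b" "b \<le> R0 / 4" "\<rho> \<le> a" "\<rho> \<le> b"
      using \<rho>(1) \<rho>(2)[OF z(1)] \<rho>(2)[OF z(2)] R[OF z(1)] R[OF z(2)] by (auto simp: a_def b_def)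
    have \<mu>ab: "0 < \<mu> * a" "\<mu> * a \<le> a" "0 < \<mu> * b" "\<mu> * b \<le> b"
      using \<mu> ab by (auto intro: mult_left_le_one_le)
    have "\<mu> * \<rho> \<le> \<mu> * a" "\<mu> * \<rho> \<le> \<rho>" using \<mu> ab \<rho> by (auto intro: mult_left_le_one_le)
    have "\<mu> * a \<le> R0 / 4" using ab \<mu>ab by linarith
    with \<open>\<mu> * \<rho> \<le> \<mu> * a\<close> \<open>\<mu> * \<rho> \<le> \<rho>\<close> have "mcos k (\<mu> * a) b (d (g z) z') \<le> C + e"
      "mcos k (\<mu> * b) (\<mu> * a) (d (g z') (g z)) \<le> mcos k b (\<mu> * a) (d z' (g z)) + e"
      using g(3)[OF z(1) zM(2)] g(3)[OF z(2) g(1)[OF z(1)]] g(2)[OF z(1)] ab \<mu>ab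
      by (simp_all add: a_def b_def c_def C_def)
    then have C'C: "C' \<le> C + 2 * e"
      by (simp add: C'_def c'_def mcos_commute[of k "\<mu> * b"] mcos_commute[of k b] mdist_commute[of X "g z'"]
        mdist_commute[of X z'])
    have tri: "\<bar>a - b\<bar> \<le> c" "c \<le> a + b" using d_sides[OF x zM] by (simp_all add: a_def b_def c_def)
    have tri': "\<bar>\<mu> * a - \<mu> * b\<bar> \<le> c'" "c' \<le> \<mu> * a + \<mu> * b"
      using d_sides[OF x g(1)[OF z(1)] g(1)[OF z(2)]] g(2)[OF z(1)] g(2)[OF z(2)]
      by (simp_all add: a_def b_def c'_def)
    have C: "C \<le> 1" "C' \<le> 1"
      using mcos_bounds(2)[OF good_R0 _ _ _ tri] mcos_bounds(2)[OF good_R0 _ _ _ tri'] ab \<mu>ab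
      by (simp_all add: C_def C'_def)
    note sb = good_sin[OF good_R0]
    have S: "0 < model_sin k a" "0 < model_sin k b" "0 < model_sin k (\<mu> * a)" "0 < model_sin k (\<mu> * b)"
      using ab \<mu>ab by (auto intro!: good_sin_pos[OF good_R0])
    have md: "model_md k u \<le> 3 / 4 * u\<^sup>2" "u\<^sup>2 / 4 \<le> model_md k u" if "\<bar>u\<bar> \<le> R0" for u
      using good_md[OF good_R0, of 0 "\<bar>u\<bar>"] that by simp_all
    have P: "model_sin k a * model_sin k b \<le> 9 / 4 * (a * b)"
      using mult_mono[OF sb(2)[of a] sb(2)[of b]] ab S by simp
    have P': "\<mu>\<^sup>2 * (a * b) / 4 \<le> model_sin k (\<mu> * a) * model_sin k (\<mu> * b)"
      using mult_mono[OF sb(1)[of "\<mu> * a"] sb(1)[of "\<mu> * b"]] ab \<mu>ab S by (simp add: power2_eq_square mult_ac)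
    have "c\<^sup>2 / 4 \<le> model_md k c" using tri ab by (intro md) auto
    also have "\<dots> = model_md k (a - b) + model_sin k a * model_sin k b * (1 - C)"
      unfolding C_def by (rule mcos_law) (use S in auto)
    also have "model_md k (a - b) \<le> 3 / 4 * (a - b)\<^sup>2" using ab by (intro md) auto
    also have "model_sin k a * model_sin k b * (1 - C) \<le> 9 / 4 * (a * b) * (1 - C)"
      using P C by (intro mult_right_mono) auto
    finally have "c\<^sup>2 / 36 \<le> (a - b)\<^sup>2 / 12 + a * b * (1 - C) / 4" by (simp add: field_simps)
    moreover have "\<kappa>\<^sup>2 \<le> c\<^sup>2" using \<kappa>(1) \<kappa>(2)[OF z] by (intro power_mono) (auto simp: c_def)
    moreover have "0 \<le> (a - b)\<^sup>2" by simp
    moreover have "a * b * e \<le> \<kappa>\<^sup>2 / 36"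
    proof -
      have "a * b \<le> R0 * R0" using ab R0_pos by (intro mult_mono) auto
      then have "a * b * e \<le> R0\<^sup>2 * e" using e by (intro mult_right_mono) (auto simp: power2_eq_square)
      then show ?thesis using R0_pos by (simp add: e_def)
    qed
    moreover have "a * b * (1 - C - 2 * e) / 4 = a * b * (1 - C) / 4 - a * b * e / 2"
      by (simp add: right_diff_distrib diff_divide_distrib)
    ultimately have main: "\<kappa>\<^sup>2 / 72 \<le> (a - b)\<^sup>2 / 4 + a * b * (1 - C - 2 * e) / 4"
      by linarith
    have "\<mu>\<^sup>2 * (\<kappa>\<^sup>2 / 72) \<le> \<mu>\<^sup>2 * ((a - b)\<^sup>2 / 4 + a * b * (1 - C - 2 * e) / 4)"
      by (intro mult_left_mono main) simp
    also have "\<dots> = (\<mu> * a - \<mu> * b)\<^sup>2 / 4 + \<mu>\<^sup>2 * (a * b) / 4 * (1 - C - 2 * e)"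
      by (simp add: power2_eq_square field_simps)
    also have "(\<mu> * a - \<mu> * b)\<^sup>2 / 4 \<le> model_md k (\<mu> * a - \<mu> * b)" using ab \<mu>ab by (intro md) auto
    also have "\<mu>\<^sup>2 * (a * b) / 4 * (1 - C - 2 * e) \<le> \<mu>\<^sup>2 * (a * b) / 4 * (1 - C')"
      using C'C ab by (intro mult_left_mono) auto
    also have "\<dots> \<le> model_sin k (\<mu> * a) * model_sin k (\<mu> * b) * (1 - C')"
      using P' C by (intro mult_right_mono) auto
    also have "model_md k (\<mu> * a - \<mu> * b) + model_sin k (\<mu> * a) * model_sin k (\<mu> * b) * (1 - C') = model_md k c'"
      unfolding C'_def by (rule mcos_law(1)[symmetric]) (use S in auto)
    also have "\<dots> \<le> 3 / 4 * c'\<^sup>2" using tri' ab \<mu>ab by (intro md) auto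
    finally have "(\<mu> * \<kappa>)\<^sup>2 / 54 \<le> c'\<^sup>2" by (simp add: power_mult_distrib mult.commute)
    \<comment> \<open>The fraction 1/8 is admissible because 54 is below 64.\<close>
    moreover have "(\<mu> * \<kappa> / 8)\<^sup>2 = (\<mu> * \<kappa>)\<^sup>2 / 64" by (simp add: power_divide)
    moreover have "0 \<le> (\<mu> * \<kappa>)\<^sup>2" by (rule zero_le_power2)
    ultimately have "(\<mu> * \<kappa> / 8)\<^sup>2 \<le> c'\<^sup>2" by linarith
    then show ?thesis unfolding c'_def[symmetric]
      by (rule power2_le_imp_le) (simp add: c'_def)
  qed
  show ?thesis using that g(1,2) sep by blast
qed

lemma finite_hausdorff_measure_zero: obtains s where "s > 0" "hausdorff_measure X s M = 0"
proof -
  have "hausdorff_dim X < \<infinity>" using Alex by (simp add: Alex_def)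
  then show ?thesis using that unfolding hausdorff_dim_def Inf_less_iff by auto
qed

text \<open>This is the doubling property: the bound depends on \<open>c\<close> but not on
  \<open>p\<close> or \<open>r\<close>. A larger separated set could be contracted towards every
  nearby point at every small scale, making the Hausdorff measure positive at an exponent where it
  vanishes.\<close>

lemma separated_card_le:
  assumes c: "0 < c" "c \<le> 1"
  obtains N :: nat where "\<And>p r T. p \<in> M \<Longrightarrow> 0 < r \<Longrightarrow> r \<le> R0 / 12 \<Longrightarrow> finite T \<Longrightarrow> T \<subseteq> M \<Longrightarrow>
     (\<And>z. z \<in> T \<Longrightarrow> d p z \<le> r) \<Longrightarrow> (\<And>z z'. z \<in> T \<Longrightarrow> z' \<in> T \<Longrightarrow> z \<noteq> z' \<Longrightarrow> c * r \<le> d z z') \<Longrightarrow> card T \<le> N"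
proof -
  obtain s where s: "s > 0" "hausdorff_measure X s M = 0" by (rule finite_hausdorff_measure_zero)
  \<comment> \<open>\<open>c / 24\<close> is the relative separation after contraction:
    \<open>contraction\<close> loses a factor 8, its ratio \<open>\<rho> / (3 * r)\<close> another
    3.\<close>
  define N where "N = nat \<lceil>(8 / (c / 24)) powr s\<rceil>"
  have N: "(8 / (c / 24)) powr s \<le> real N" unfolding N_def by linarith
  have "card T \<le> N" if p: "p \<in> M" and r: "0 < r" "r \<le> R0 / 12" and T: "finite T" "T \<subseteq> M"
    and Tr: "\<And>z. z \<in> T \<Longrightarrow> d p z \<le> r" and sep: "\<And>z z'. z \<in> T \<Longrightarrow> z' \<in> T \<Longrightarrow> z \<noteq> z' \<Longrightarrow> c * r \<le> d z z'" for p r T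
  proof (rule ccontr)
    assume "\<not> card T \<le> N"
    then have card: "N + 1 \<le> card T" by simp
    have "hausdorff_measure X s M \<noteq> 0"
    proof (rule hausdorff_measure_pos_if_separated[of X p r "c / 24" s N])
      show "mcomplete_of X" using Alex by (simp add: Alex_def)
      fix x \<rho> assume x: "x \<in> M" "d p x \<le> 2 * r" and \<rho>: "0 < \<rho>" "\<rho> \<le> r"
      \<comment> \<open>\<open>contraction\<close> needs a positive lower bound on
        \<open>d x z\<close>, so points too close to \<open>x\<close> are discarded. The separation
        allows at most one of them, and \<open>T\<close> has at least \<open>N + 1\<close>
        points.\<close>
      define T' where "T' = {z \<in> T. c * r / 2 \<le> d x z}"
      have "z = z'" if "z \<in> T - T'" "z' \<in> T - T'" for z z'
      proof (rule ccontr)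
        assume "z \<noteq> z'"
        then have "c * r \<le> d z z'" using sep that by auto
        also have "\<dots> \<le> d x z + d x z'" using d_sides(2)[of x z z'] x that T by auto
        finally show False using that by (auto simp: T'_def)
      qed
      then have "card (T - T') \<le> Suc 0" using T(1) by (subst card_le_Suc0_iff_eq) auto
      moreover have "card T' + card (T - T') = card T"
        using T(1) card_mono[of T T'] by (subst card_Diff_subset) (auto simp: T'_def)
      ultimately have card': "N \<le> card T'" using card by simp
      have T'fin: "finite T'" using T(1) by (simp add: T'_def)
      from ex_bij_betw_nat_finite[OF this] obtain h where h: "bij_betw h {0..<card T'} T'" by blast
      have hT: "h i \<in> T'" if "i < N" for i using h that card' by (auto simp: bij_betw_def)
      have hne: "h i \<noteq> h j" if "i < N" "j < N" "i \<noteq> j" for i j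
        using h that card' by (auto simp: bij_betw_def inj_on_def)
      define \<mu> where "\<mu> = \<rho> / (3 * r)"
      have \<mu>: "0 < \<mu>" "\<mu> < 1" using r \<rho> by (simp_all add: \<mu>_def)
      have d3: "d x z \<le> 3 * r" if "z \<in> T'" for z
        using d_tri[of x p z] x p that T Tr[of z] by (auto simp: T'_def mdist_commute)
      obtain g where g: "\<And>z. z \<in> T' \<Longrightarrow> g z \<in> M" "\<And>z. z \<in> T' \<Longrightarrow> d x (g z) = \<mu> * d x z"
        "\<And>z z'. z \<in> T' \<Longrightarrow> z' \<in> T' \<Longrightarrow> z \<noteq> z' \<Longrightarrow> \<mu> * (c * r) / 8 \<le> d (g z) (g z')"
      proof (rule contraction[of x T' "c * r / 2" "c * r" \<mu>])
        show "d x z \<le> R0 / 4" if "z \<in> T'" for z using d3[OF that] r by simp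
      qed (use x T T'fin c r sep \<mu> in \<open>auto simp: T'_def\<close>)
      have "d x (g z) \<le> \<rho>" if "z \<in> T'" for z
      proof -
        have "\<mu> * d x z \<le> \<mu> * (3 * r)" using \<mu> d3[OF that] by (intro mult_left_mono) auto
        also have "\<dots> = \<rho>" using r by (simp add: \<mu>_def)
        finally show ?thesis using g(2)[OF that] by simp
      qed
      moreover have "\<mu> * (c * r) / 8 = c / 24 * \<rho>" using r by (simp add: \<mu>_def)
      ultimately have "(\<forall>i<N. g (h i) \<in> M \<and> d x (g (h i)) \<le> \<rho>) \<and>
          (\<forall>i<N. \<forall>j<N. i \<noteq> j \<longrightarrow> c / 24 * \<rho> \<le> d (g (h i)) (g (h j)))"
        using g hT hne by metis
      then show "\<exists>f. (\<forall>i<N. f i \<in> M \<and> d x (f i) \<le> \<rho>) \<and>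
          (\<forall>i<N. \<forall>j<N. i \<noteq> j \<longrightarrow> c / 24 * \<rho> \<le> d (f i) (f j))"
        by (rule exI[of _ "\<lambda>i. g (h i)"])
    qed (use p r c s N in auto)
    with s show False by simp
  qed
  then show ?thesis by (rule that)
qed

end

section \<open>Ultralimits\<close>

text \<open>Zorn's lemma for families all of whose finite intersections are infinite. Asking for
  infinite instead of nonempty intersections forces every cofinite set into a maximal
  family.\<close>

lemma nonprincipal_ultrafilter_exists:
  "\<exists>U :: nat filter. U \<le> sequentially \<and> U \<noteq> bot \<and> (\<forall>P. eventually P U \<or> eventually (\<lambda>n. \<not> P n) U)"
proof -
  define fip where "fip C \<longleftrightarrow> (\<forall>A. finite A \<longrightarrow> A \<subseteq> C \<longrightarrow> infinite (\<Inter>A))" for C :: "nat set set"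
  have "\<exists>C\<in>{C. fip C}. \<forall>D\<in>{C. fip C}. C \<subseteq> D \<longrightarrow> D = C"
  proof (rule subset_Zorn_nonempty)
    show "{C. fip C} \<noteq> {}"
      by (auto simp: fip_def intro!: exI[of _ "{}"])
    fix \<C> assume ne: "\<C> \<noteq> {}" and ch: "subset.chain {C. fip C} \<C>"
    have "fip (\<Union>\<C>)"
      unfolding fip_def
    proof (intro allI impI)
      fix A assume A: "finite A" "A \<subseteq> \<Union>\<C>"
      then obtain C where "C \<in> \<C>" "A \<subseteq> C"
        using finite_subset_Union_chain[OF A ne] ch by metis
      with ch A(1) show "infinite (\<Inter>A)" by (auto simp: subset.chain_def fip_def)
    qed
    then show "\<Union>\<C> \<in> {C. fip C}" by simp
  qed
  then obtain C where C: "fip C" and max: "\<And>D. fip D \<Longrightarrow> C \<subseteq> D \<Longrightarrow> D = C" by blast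
  \<comment> \<open>Maximality in usable form: a set that meets every finite intersection infinitely
    often could be added, so it is already a member.\<close>
  have memI: "S \<in> C" if S: "\<And>A. finite A \<Longrightarrow> A \<subseteq> C \<Longrightarrow> infinite (S \<inter> \<Inter>A)" for S
  proof -
    have "fip (insert S C)"
      unfolding fip_def
    proof (intro allI impI)
      fix A assume A: "finite A" "A \<subseteq> insert S C"
      then have "infinite (S \<inter> \<Inter>(A - {S}))" by (intro S) auto
      moreover have "S \<inter> \<Inter>(A - {S}) \<subseteq> \<Inter>A" by auto
      ultimately show "infinite (\<Inter>A)" using infinite_super by blast
    qed
    then show ?thesis using max[of "insert S C"] by auto
  qed
  have inf: "infinite (\<Inter>A)" if "finite A" "A \<subseteq> C" for A using C that by (simp add: fip_def)
  have Int: "S \<inter> T \<in> C" if "S \<in> C" "T \<in> C" for S T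
  proof (rule memI)
    fix A assume "finite A" "A \<subseteq> C"
    then show "infinite (S \<inter> T \<inter> \<Inter>A)" using inf[of "insert S (insert T A)"] that by (simp add: Int_assoc)
  qed
  have up: "T \<in> C" if "S \<in> C" "S \<subseteq> T" for S T
  proof (rule memI)
    fix A assume "finite A" "A \<subseteq> C"
    then have "infinite (\<Inter>(insert S A))" by (intro inf) (use that in auto)
    moreover have "\<Inter>(insert S A) \<subseteq> T \<inter> \<Inter>A" using that by auto
    ultimately show "infinite (T \<inter> \<Inter>A)" using infinite_super by blast
  qed
  have cofin: "S \<in> C" if "finite (- S)" for S
  proof (rule memI)
    fix A assume "finite A" "A \<subseteq> C"
    then have "infinite (\<Inter>A)" by (rule inf)
    moreover have "\<Inter>A \<subseteq> (S \<inter> \<Inter>A) \<union> - S" by auto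
    ultimately show "infinite (S \<inter> \<Inter>A)" using that finite_subset by blast
  qed
  have ultra: "S \<in> C \<or> - S \<in> C" for S
  proof (rule ccontr)
    assume "\<not> ?thesis"
    then have "S \<notin> C" "- S \<notin> C" by simp_all
    then have "\<exists>A. finite A \<and> A \<subseteq> C \<and> finite (S \<inter> \<Inter>A)"
      "\<exists>A. finite A \<and> A \<subseteq> C \<and> finite (- S \<inter> \<Inter>A)"
      using memI[of S] memI[of "- S"] by auto
    then obtain A B where A: "finite A" "A \<subseteq> C" "finite (S \<inter> \<Inter>A)" and B: "finite B" "B \<subseteq> C" "finite (- S \<inter> \<Inter>B)"
      by (elim exE conjE)
    have "\<Inter>(A \<union> B) \<subseteq> (S \<inter> \<Inter>A) \<union> (- S \<inter> \<Inter>B)" by auto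
    then have "finite (\<Inter>(A \<union> B))" using A B finite_subset by blast
    with inf[of "A \<union> B"] A B show False by simp
  qed
  define U where "U = Abs_filter (\<lambda>P. {n. P n} \<in> C)"
  have "is_filter (\<lambda>P. {n. P n} \<in> C)"
  proof
    show "{n. True} \<in> C" by (rule cofin) simp
    show "{n. P n \<and> Q n} \<in> C" if "{n. P n} \<in> C" "{n. Q n} \<in> C" for P Q
      using Int[OF that] by (simp add: Collect_conj_eq)
    show "{n. Q n} \<in> C" if "\<forall>n. P n \<longrightarrow> Q n" "{n. P n} \<in> C" for P Q
      using up[OF that(2), of "{n. Q n}"] that(1) by auto
  qed
  then have ev: "eventually P U \<longleftrightarrow> {n. P n} \<in> C" for P
    unfolding U_def by (rule eventually_Abs_filter)
  have "U \<le> sequentially"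
  proof (rule filter_leI)
    fix P :: "nat \<Rightarrow> bool" assume "eventually P sequentially"
    then obtain N where N: "\<And>n. n \<ge> N \<Longrightarrow> P n" unfolding eventually_sequentially by auto
    then have "- {n. P n} \<subseteq> {..<N}" by (auto simp: not_le[symmetric])
    then have "finite (- {n. P n})" using finite_subset by auto
    then show "eventually P U" unfolding ev by (rule cofin)
  qed
  moreover have "U \<noteq> bot"
    using inf[of "{{}}"] by (auto simp: trivial_limit_def ev)
  moreover have "eventually P U \<or> eventually (\<lambda>n. \<not> P n) U" for P
    using ultra[of "{n. P n}"] by (simp add: ev Collect_neg_eq)
  ultimately show ?thesis by blast
qed

definition ultra :: "nat filter" where
  "ultra = (SOME U. U \<le> sequentially \<and> U \<noteq> bot \<and> (\<forall>P. eventually P U \<or> eventually (\<lambda>n. \<not> P n) U))"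

lemma ultra_le_sequentially: "ultra \<le> sequentially" and ultra_neq_bot [simp]: "ultra \<noteq> bot"
  and ultra_cases: "eventually P ultra \<or> eventually (\<lambda>n. \<not> P n) ultra"
  using someI_ex[OF nonprincipal_ultrafilter_exists] unfolding ultra_def by simp_all

lemma eventually_ultraI: "eventually P sequentially \<Longrightarrow> eventually P ultra"
  using ultra_le_sequentially by (rule filter_leD)

lemma tendsto_ultraI: "(f \<longlongrightarrow> l) sequentially \<Longrightarrow> (f \<longlongrightarrow> l) ultra"
  using ultra_le_sequentially by (rule tendsto_mono)

lemma eventually_ultra_ex: "eventually P ultra \<Longrightarrow> \<exists>n. P n"
  using eventually_happens[of P ultra] by simp

text \<open>Pigeonhole: if each of finitely many alternatives failed eventually, all would fail
  together at some index.\<close>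

lemma ultra_finite_cases:
  assumes "finite A" and "\<And>n. \<exists>a\<in>A. P a n"
  shows "\<exists>a\<in>A. eventually (P a) ultra"
proof (rule ccontr)
  assume "\<not> ?thesis"
  then have "\<forall>a\<in>A. eventually (\<lambda>n. \<not> P a n) ultra" using ultra_cases by blast
  then have "eventually (\<lambda>n. \<forall>a\<in>A. \<not> P a n) ultra" using assms(1) by (simp add: eventually_ball_finite)
  then show False using assms(2) eventually_ultra_ex by blast
qed

text \<open>Compactness yields a cluster point. For an ultrafilter it is a limit, since a
  neighbourhood not entered eventually would be avoided eventually.\<close>

lemma ultra_bounded_tendsto:
  fixes f :: "nat \<Rightarrow> real"
  assumes "\<And>n. a \<le> f n" "\<And>n. f n \<le> b"
  obtains l where "(f \<longlongrightarrow> l) ultra"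
proof -
  have "compact {a..b}" by simp
  moreover have "filtermap f ultra \<noteq> bot" by (simp add: filtermap_bot_iff)
  moreover have "eventually (\<lambda>x. x \<in> {a..b}) (filtermap f ultra)"
    using assms by (simp add: eventually_filtermap)
  ultimately have "\<exists>l\<in>{a..b}. inf (nhds l) (filtermap f ultra) \<noteq> bot"
    unfolding compact_filter by simp
  then obtain l where l: "inf (nhds l) (filtermap f ultra) \<noteq> bot" ..
  have "(f \<longlongrightarrow> l) ultra"
  proof (rule topological_tendstoI)
    fix S assume S: "open S" "l \<in> S"
    show "eventually (\<lambda>n. f n \<in> S) ultra"
    proof (rule ccontr)
      assume "\<not> ?thesis"
      then have "eventually (\<lambda>n. f n \<notin> S) ultra" using ultra_cases by blast
      moreover have "eventually (\<lambda>x. x \<in> S) (nhds l)" using S by (rule eventually_nhds_in_open)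
      ultimately have "eventually (\<lambda>x. False) (inf (nhds l) (filtermap f ultra))"
        unfolding eventually_inf eventually_filtermap by (intro exI[of _ "\<lambda>x. x \<in> S"] exI[of _ "\<lambda>x. x \<notin> S"]) auto
      with l show False by (simp add: trivial_limit_def)
    qed
  qed
  then show ?thesis by (rule that)
qed

text \<open>Total boundedness, with nets taken from a possibly larger set \<open>C\<close> so that
  nets for a ball may leave the ball.\<close>

definition precompact :: "('b \<Rightarrow> 'b \<Rightarrow> real) \<Rightarrow> 'b set \<Rightarrow> 'b set \<Rightarrow> bool" where
  "precompact dd C S \<longleftrightarrow> (\<forall>e>0. \<exists>A. finite A \<and> A \<subseteq> C \<and> (\<forall>x\<in>S. \<exists>a\<in>A. dd a x < e))"

lemma precompactD:
  "precompact dd C S \<Longrightarrow> e > 0 \<Longrightarrow> \<exists>A. finite A \<and> A \<subseteq> C \<and> (\<forall>x\<in>S. \<exists>a\<in>A. dd a x < e)"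
  by (simp add: precompact_def)

text \<open>A separated subset of maximal cardinality is a net, since any point far from all of it
  could be added.\<close>

lemma precompact_if_card_le:
  assumes refl: "\<And>x. x \<in> S \<Longrightarrow> dd x x = 0" and sym: "\<And>x y. x \<in> S \<Longrightarrow> y \<in> S \<Longrightarrow> dd x y = dd y x"
    and card: "\<And>e. e > 0 \<Longrightarrow> \<exists>N::nat. \<forall>T. finite T \<longrightarrow> T \<subseteq> S \<longrightarrow> (\<forall>x\<in>T. \<forall>y\<in>T. x \<noteq> y \<longrightarrow> e \<le> dd x y) \<longrightarrow> card T \<le> N"
  shows "precompact dd S S"
  unfolding precompact_def
proof (intro allI impI)
  fix e :: real assume e: "e > 0"
  define P where "P T \<longleftrightarrow> finite T \<and> T \<subseteq> S \<and> (\<forall>x\<in>T. \<forall>y\<in>T. x \<noteq> y \<longrightarrow> e \<le> dd x y)" for T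
  from card[OF e] obtain N where N': "\<forall>T. finite T \<longrightarrow> T \<subseteq> S \<longrightarrow> (\<forall>x\<in>T. \<forall>y\<in>T. x \<noteq> y \<longrightarrow> e \<le> dd x y) \<longrightarrow> card T \<le> N"
    by (elim exE)
  have N: "card T \<le> N" if "P T" for T using N' that unfolding P_def by simp
  have "P {}" by (simp add: P_def)
  with N have "\<exists>T. P T \<and> (\<forall>T'. P T' \<longrightarrow> card T' \<le> card T)"
    by (intro ex_has_greatest_nat[of P "{}" card "Suc N"]) (auto simp: less_Suc_eq_le)
  then obtain T where T: "P T" "\<And>T'. P T' \<Longrightarrow> card T' \<le> card T" by blast
  have "\<exists>a\<in>T. dd a x < e" if x: "x \<in> S" for x
  proof (rule ccontr)
    assume "\<not> ?thesis"
    then have far: "\<And>a. a \<in> T \<Longrightarrow> e \<le> dd a x" by auto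
    then have "x \<notin> T" using refl[OF x] e by force
    have "P (insert x T)"
      unfolding P_def
    proof (intro conjI ballI impI)
      fix u v assume uv: "u \<in> insert x T" "v \<in> insert x T" "u \<noteq> v"
      have "T \<subseteq> S" using T(1) by (simp add: P_def)
      then have far': "e \<le> dd x a" if "a \<in> T" for a
        using far[OF that] sym[OF x subsetD[OF _ that]] by simp
      consider "u \<in> T" "v \<in> T" | "u = x" "v \<in> T" | "u \<in> T" "v = x" using uv by blast
      then show "e \<le> dd u v" using uv(3) far far' T(1) by cases (simp_all add: P_def)
    qed (use x T(1) in \<open>auto simp: P_def\<close>)
    then have "card (insert x T) \<le> card T" by (rule T(2))
    moreover have "finite T" using T(1) by (simp add: P_def)
    ultimately show False using \<open>x \<notin> T\<close> by simp
  qed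
  with T(1) show "\<exists>A. finite A \<and> A \<subseteq> S \<and> (\<forall>x\<in>S. \<exists>a\<in>A. dd a x < e)"
    by (intro exI[of _ T]) (auto simp: P_def)
qed

lemma precompact_ultra:
  assumes "precompact dd C S" "\<And>n. f n \<in> S" "e > 0"
  obtains a where "a \<in> C" "eventually (\<lambda>n. dd a (f n) < e) ultra"
proof -
  from precompactD[OF assms(1,3)] obtain A where A: "finite A" "A \<subseteq> C" "\<forall>x\<in>S. \<exists>a\<in>A. dd a x < e"
    by (elim exE conjE)
  have "\<exists>a\<in>A. eventually (\<lambda>n. dd a (f n) < e) ultra"
    by (rule ultra_finite_cases[OF A(1)]) (rule bspec[OF A(3) assms(2)])
  then show ?thesis using A(2) that by auto
qed

context alexandrov
begin

section \<open>Total boundedness of balls\<close>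

lemma precompact_small_ball:
  assumes p: "p \<in> M"
  shows "precompact d {y \<in> M. d p y \<le> R0 / 12} {y \<in> M. d p y \<le> R0 / 12}"
proof (rule precompact_if_card_le)
  fix e :: real assume e: "e > 0"
  define r where "r = R0 / 12"
  have r: "r > 0" using R0_pos by (simp add: r_def)
  define c where "c = min 1 (e / r)"
  have c: "0 < c" "c \<le> 1" "c * r \<le> e" using e r by (auto simp: c_def min_def field_simps)
  from separated_card_le[OF c(1,2)] obtain N where N: "\<And>p r T. p \<in> M \<Longrightarrow> 0 < r \<Longrightarrow> r \<le> R0 / 12 \<Longrightarrow> finite T \<Longrightarrow> T \<subseteq> M \<Longrightarrow>
     (\<And>z. z \<in> T \<Longrightarrow> d p z \<le> r) \<Longrightarrow> (\<And>z z'. z \<in> T \<Longrightarrow> z' \<in> T \<Longrightarrow> z \<noteq> z' \<Longrightarrow> c * r \<le> d z z') \<Longrightarrow> card T \<le> N"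
    by metis
  have "card T \<le> N" if T: "finite T" "T \<subseteq> {y \<in> M. d p y \<le> R0 / 12}" and sep: "\<forall>x\<in>T. \<forall>y\<in>T. x \<noteq> y \<longrightarrow> e \<le> d x y" for T
  proof (rule N[OF p r _ T(1)])
    fix z z' assume "z \<in> T" "z' \<in> T" "z \<noteq> z'"
    with sep have "e \<le> d z z'" by simp
    with c(3) show "c * r \<le> d z z'" by linarith
  qed (use T in \<open>auto simp: r_def\<close>)
  then show "\<exists>N. \<forall>T. finite T \<longrightarrow> T \<subseteq> {y \<in> M. d p y \<le> R0 / 12} \<longrightarrow>
      (\<forall>x\<in>T. \<forall>y\<in>T. x \<noteq> y \<longrightarrow> e \<le> d x y) \<longrightarrow> card T \<le> N"
    by (intro exI[of _ N] allI impI)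
qed (auto simp: mdist_commute)

text \<open>Doubling is available only up to radius \<open>R0 / 12\<close>, so large balls are
  reached in steps. A point of the larger ball is within \<open>R0 / 24\<close> plus two errors
  \<open>R0 / 100\<close> of a net of the smaller ball, hence in a small ball around a net
  point.\<close>

lemma precompact_ball_step:
  assumes p: "p \<in> M" and b: "b \<ge> 0" and pre: "precompact d M {y \<in> M. d p y \<le> b}"
  shows "precompact d M {y \<in> M. d p y \<le> b + R0 / 24}"
  unfolding precompact_def
proof (intro allI impI)
  fix e :: real assume e: "e > 0"
  have "R0 / 100 > 0" using R0_pos by simp
  from precompactD[OF pre this] obtain A where
    A0: "finite A" "A \<subseteq> M" "\<forall>y \<in> {y \<in> M. d p y \<le> b}. \<exists>a\<in>A. d a y < R0 / 100"
    by (elim exE conjE)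
  have A: "finite A" "A \<subseteq> M" "\<And>y. y \<in> M \<Longrightarrow> d p y \<le> b \<Longrightarrow> \<exists>a\<in>A. d a y < R0 / 100"
    using A0 by simp_all
  have "\<exists>B. a \<in> A \<longrightarrow> finite B \<and> B \<subseteq> M \<and> (\<forall>y. y \<in> M \<longrightarrow> d a y \<le> R0 / 12 \<longrightarrow> (\<exists>b\<in>B. d b y < e))" for a
  proof (cases "a \<in> A")
    case True
    with A(2) have "a \<in> M" by auto
    from precompactD[OF precompact_small_ball[OF this] e] obtain B where "finite B" "B \<subseteq> {y \<in> M. d a y \<le> R0 / 12}"
      "\<forall>y \<in> {y \<in> M. d a y \<le> R0 / 12}. \<exists>b\<in>B. d b y < e" by (elim exE conjE)
    then show ?thesis by (intro exI[of _ B]) auto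
  qed simp
  then have "\<exists>B. \<forall>a. a \<in> A \<longrightarrow> finite (B a) \<and> B a \<subseteq> M \<and> (\<forall>y. y \<in> M \<longrightarrow> d a y \<le> R0 / 12 \<longrightarrow> (\<exists>b\<in>B a. d b y < e))"
    by (intro choice allI)
  then obtain B where B': "\<forall>a. a \<in> A \<longrightarrow> finite (B a) \<and> B a \<subseteq> M \<and>
      (\<forall>y. y \<in> M \<longrightarrow> d a y \<le> R0 / 12 \<longrightarrow> (\<exists>b\<in>B a. d b y < e))" by (elim exE)
  have B: "finite (B a)" "B a \<subseteq> M" "y \<in> M \<Longrightarrow> d a y \<le> R0 / 12 \<Longrightarrow> \<exists>b\<in>B a. d b y < e"
    if "a \<in> A" for a y using B' that by simp_all
  have "\<exists>z\<in>(\<Union>a\<in>A. B a). d z y < e" if y: "y \<in> M" "d p y \<le> b + R0 / 24" for y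
  proof -
    obtain f where f: "\<And>t. t \<in> {0..d p y} \<Longrightarrow> f t \<in> M" "\<And>t. t \<in> {0..d p y} \<Longrightarrow> d p (f t) = t"
        "\<And>t. t \<in> {0..d p y} \<Longrightarrow> d (f t) y \<le> d p y - t + R0 / 100"
      using almost_geodesic[OF p y(1) \<open>R0 / 100 > 0\<close>] by metis
    define t where "t = min b (d p y)"
    have t: "t \<in> {0..d p y}" "t \<le> b" "d p y - t \<le> R0 / 24" using b y R0_pos by (auto simp: t_def min_def)
    obtain a where a: "a \<in> A" "d a (f t) < R0 / 100" using A(3)[of "f t"] f(1,2)[OF t(1)] t(2) by auto
    have "d a y \<le> d a (f t) + d (f t) y" using a A(2) f(1)[OF t(1)] y by (intro d_tri) auto
    also have "\<dots> \<le> R0 / 12" using a(2) f(3)[OF t(1)] t(3) R0_pos by simp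
    finally show ?thesis using B(3)[OF a(1) y(1)] a(1) by auto
  qed
  then show "\<exists>A. finite A \<and> A \<subseteq> M \<and> (\<forall>x\<in>{y \<in> M. d p y \<le> b + R0 / 24}. \<exists>a\<in>A. d a x < e)"
    using A(1) B(1,2) by (intro exI[of _ "\<Union>a\<in>A. B a"] conjI ballI) auto
qed

lemma precompact_ball:
  assumes p: "p \<in> M" shows "precompact d M {y \<in> M. d p y \<le> b}"
proof -
  have *: "precompact d M {y \<in> M. d p y \<le> real n * (R0 / 24)}" for n
  proof (induction n)
    case 0
    have "{y \<in> M. d p y \<le> real 0 * (R0 / 24)} \<subseteq> {p}" using p by (auto simp: order_antisym_conv)
    then show ?case unfolding precompact_def using p by (auto intro!: exI[of _ "{p}"])
  next
    case (Suc n)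
    have "real (Suc n) * (R0 / 24) = real n * (R0 / 24) + R0 / 24" by (simp add: algebra_simps add_divide_distrib)
    then show ?case using precompact_ball_step[OF p _ Suc] R0_pos by (simp only:) simp
  qed
  obtain n :: nat where "b / (R0 / 24) \<le> real n" using real_arch_simple by blast
  then have "b \<le> real n * (R0 / 24)" using R0_pos by (simp add: field_simps)
  then have "{y \<in> M. d p y \<le> b} \<subseteq> {y \<in> M. d p y \<le> real n * (R0 / 24)}" by auto
  with *[of n] show ?thesis unfolding precompact_def by (meson subsetD)
qed

section \<open>Ultralimits of points and curves\<close>

lemma d_tendsto:
  assumes "x \<in> M" "y \<in> M" "\<And>n. f n \<in> M" "\<And>n. g n \<in> M"
    and "((\<lambda>n. d x (f n)) \<longlongrightarrow> 0) F" "((\<lambda>n. d y (g n)) \<longlongrightarrow> 0) F"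
  shows "((\<lambda>n. d (f n) (g n)) \<longlongrightarrow> d x y) F"
proof -
  have "((\<lambda>n. d (f n) (g n) - d x y) \<longlongrightarrow> 0) F"
  proof (rule Lim_null_comparison)
    show "eventually (\<lambda>n. norm (d (f n) (g n) - d x y) \<le> d x (f n) + d y (g n)) F"
    proof (intro always_eventually allI)
      fix n
      show "norm (d (f n) (g n) - d x y) \<le> d x (f n) + d y (g n)"
        using d_diff[of "f n" "g n" y] d_diff[of y "f n" x] assms(1-4)
          mdist_commute[of X y] mdist_commute[of X "g n" y] mdist_commute[of X "f n" x]
        by (smt (verit) real_norm_def)
    qed
    show "((\<lambda>n. d x (f n) + d y (g n)) \<longlongrightarrow> 0) F" using tendsto_add[OF assms(5,6)] by simp
  qed
  then show ?thesis by (rule LIM_zero_cancel)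
qed

text \<open>Net points \<open>a j\<close> within \<open>(1 / 2) ^ j\<close> of most
  \<open>f n\<close> form a Cauchy sequence, because any two of them are close to a common
  \<open>f n\<close>. Completeness supplies the limit.\<close>

lemma ultralimit_exists:
  assumes p: "p \<in> M" and f: "\<And>n. f n \<in> M" "\<And>n. d p (f n) \<le> b"
  obtains x where "x \<in> M" "((\<lambda>n. d x (f n)) \<longlongrightarrow> 0) ultra"
proof -
  have "\<exists>a. a \<in> M \<and> eventually (\<lambda>n. d a (f n) < (1 / 2) ^ j) ultra" for j :: nat
  proof -
    obtain a where "a \<in> M" "eventually (\<lambda>n. d a (f n) < (1 / 2) ^ j) ultra"
      by (rule precompact_ultra[OF precompact_ball[OF p, of b], of f "(1 / 2) ^ j"]) (use f in auto)
    then show ?thesis by auto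
  qed
  then have "\<exists>a. \<forall>j. a j \<in> M \<and> eventually (\<lambda>n. d (a j) (f n) < (1 / 2) ^ j) ultra" by (intro choice allI)
  then obtain a where a: "\<And>j. a j \<in> M" "\<And>j. eventually (\<lambda>n. d (a j) (f n) < (1 / 2) ^ j) ultra" by auto
  interpret Metric_space M d by (rule Metric_space_mspace_mdist)
  have aa: "d (a i) (a j) < (1 / 2) ^ i + (1 / 2) ^ j" for i j
  proof -
    obtain n where "d (a i) (f n) < (1 / 2) ^ i" "d (a j) (f n) < (1 / 2) ^ j"
      using eventually_ultra_ex[OF eventually_conj[OF a(2)[of i] a(2)[of j]]] by auto
    then show ?thesis using d_tri[OF a(1)[of i] f(1)[of n] a(1)[of j]] mdist_commute[of X "f n" "a j"] by linarith
  qed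
  have small: "\<exists>j. (1 / 2) ^ j < e" if "e > 0" for e :: real
    using real_arch_pow_inv[OF that, of "1/2"] by auto
  have "MCauchy a"
    unfolding MCauchy_def
  proof (intro conjI allI impI)
    fix e :: real assume "e > 0"
    then obtain N where N: "(1 / 2) ^ N < e / 2" using small[of "e / 2"] by auto
    have "d (a i) (a j) < e" if "N \<le> i" "N \<le> j" for i j
    proof -
      have "(1 / 2 :: real) ^ i \<le> (1 / 2) ^ N" "(1 / 2 :: real) ^ j \<le> (1 / 2) ^ N"
        using that by (auto intro: power_decreasing)
      then show ?thesis using aa[of i j] N by linarith
    qed
    then show "\<exists>N. \<forall>i j. N \<le> i \<longrightarrow> N \<le> j \<longrightarrow> d (a i) (a j) < e" by blast
  qed (use a in auto)
  moreover have mcomplete using Alex by (simp add: Alex_def mcomplete_of_def)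
  ultimately have "\<exists>x. limitin mtopology a x sequentially" by (simp only: mcomplete_def)
  then obtain x where "limitin mtopology a x sequentially" ..
  then have x: "x \<in> M" "\<forall>e>0. \<exists>N. \<forall>j\<ge>N. a j \<in> M \<and> d (a j) x < e"
    unfolding limit_metric_sequentially by (rule conjunct1, rule conjunct2)
  have "((\<lambda>n. d x (f n)) \<longlongrightarrow> 0) ultra"
  proof (rule tendstoI)
    fix e :: real assume e: "e > 0"
    obtain N where N: "\<forall>j\<ge>N. a j \<in> M \<and> d (a j) x < e / 2" using x(2)[rule_format, of "e / 2"] e by auto
    obtain j0 where j0: "(1 / 2) ^ j0 < e / 2" using small[of "e / 2"] e by auto
    define j where "j = max N j0"
    have "(1 / 2 :: real) ^ j \<le> (1 / 2) ^ j0" by (auto simp: j_def intro: power_decreasing)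
    then have j: "(1 / 2) ^ j < e / 2" using j0 by linarith
    have ja: "d (a j) x < e / 2" using N by (auto simp: j_def)
    show "eventually (\<lambda>n. dist (d x (f n)) 0 < e) ultra"
      using a(2)[of j]
    proof eventually_elim
      case (elim n)
      then show ?case
        using d_tri[OF x(1) a(1)[of j] f(1)[of n]] j ja mdist_commute[of X "a j" x] by simp
    qed
  qed
  with x(1) show ?thesis by (rule that)
qed

text \<open>The limit is taken separately for every \<open>t\<close>. Convergence of the mutual
  distances alone makes it a geodesic, so continuity of the \<open>f n\<close> is irrelevant and
  almost geodesics can be inserted.\<close>

lemma ultralimit_curve:
  assumes p: "p \<in> M" and f: "\<And>n t. t \<in> {0..l} \<Longrightarrow> f n t \<in> M" "\<And>n t. t \<in> {0..l} \<Longrightarrow> d p (f n t) \<le> b"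
    and iso: "\<And>s t. s \<in> {0..l} \<Longrightarrow> t \<in> {0..l} \<Longrightarrow> ((\<lambda>n. d (f n s) (f n t)) \<longlongrightarrow> \<bar>s - t\<bar>) ultra"
  obtains \<gamma> where "unit_speed_minimal X l \<gamma>" "\<And>t. t \<in> {0..l} \<Longrightarrow> ((\<lambda>n. d (\<gamma> t) (f n t)) \<longlongrightarrow> 0) ultra"
proof -
  have "\<forall>t. \<exists>x. t \<in> {0..l} \<longrightarrow> x \<in> M \<and> ((\<lambda>n. d x (f n t)) \<longlongrightarrow> 0) ultra"
  proof
    fix t
    show "\<exists>x. t \<in> {0..l} \<longrightarrow> x \<in> M \<and> ((\<lambda>n. d x (f n t)) \<longlongrightarrow> 0) ultra"
    proof (cases "t \<in> {0..l}")
      case True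
      obtain x where "x \<in> M" "((\<lambda>n. d x (f n t)) \<longlongrightarrow> 0) ultra"
        by (rule ultralimit_exists[where p = p and f = "\<lambda>n. f n t" and b = b]) (use p f True in simp_all)
      then show ?thesis by (intro exI[of _ x]) simp
    qed auto
  qed
  from choice[OF this] obtain \<gamma> where
    \<gamma>: "\<And>t. t \<in> {0..l} \<Longrightarrow> \<gamma> t \<in> M" "\<And>t. t \<in> {0..l} \<Longrightarrow> ((\<lambda>n. d (\<gamma> t) (f n t)) \<longlongrightarrow> 0) ultra" by auto
  have "d (\<gamma> s) (\<gamma> t) = \<bar>s - t\<bar>" if "s \<in> {0..l}" "t \<in> {0..l}" for s t
    by (rule tendsto_unique[OF ultra_neq_bot d_tendsto iso]) (use \<gamma> f that in auto)
  then have "unit_speed_minimal X l \<gamma>" using \<gamma>(1) by (auto simp: unit_speed_minimal_def)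
  with \<gamma>(2) show ?thesis by (intro that)
qed

lemma minimal_geodesic_exists:
  assumes p: "p \<in> M" "q \<in> M" shows "minimal_geodesics X p q \<noteq> {}"
proof -
  define l where "l = d p q"
  have "\<exists>f. \<forall>t\<in>{0..l}. f t \<in> M \<and> d p (f t) = t \<and> d (f t) q \<le> l - t + inverse (real (Suc n)) \<and>
    (\<forall>s\<in>{0..l}. d (f s) (f t) \<le> \<bar>s - t\<bar> + inverse (real (Suc n)))" for n
    using almost_geodesic[OF p, of "inverse (real (Suc n))", folded l_def] by (metis inverse_positive_iff_positive of_nat_0_less_iff zero_less_Suc)
  then obtain f where f: "\<And>n t. t \<in> {0..l} \<Longrightarrow> f n t \<in> M" "\<And>n t. t \<in> {0..l} \<Longrightarrow> d p (f n t) = t"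
    "\<And>n t. t \<in> {0..l} \<Longrightarrow> d (f n t) q \<le> l - t + inverse (real (Suc n))"
    "\<And>n s t. s \<in> {0..l} \<Longrightarrow> t \<in> {0..l} \<Longrightarrow> d (f n s) (f n t) \<le> \<bar>s - t\<bar> + inverse (real (Suc n))"
    by metis
  have l: "0 \<le> l" by (simp add: l_def)
  have inv: "(\<lambda>n. inverse (real (Suc n))) \<longlonglongrightarrow> 0" by (rule LIMSEQ_inverse_real_of_nat)
  obtain \<gamma> where \<gamma>: "unit_speed_minimal X l \<gamma>" "\<And>t. t \<in> {0..l} \<Longrightarrow> ((\<lambda>n. d (\<gamma> t) (f n t)) \<longlongrightarrow> 0) ultra"
  proof (rule ultralimit_curve[of p l f l])
    fix s t assume st: "s \<in> {0..l}" "t \<in> {0..l}"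
    show "((\<lambda>n. d (f n s) (f n t)) \<longlongrightarrow> \<bar>s - t\<bar>) ultra"
    proof (rule tendsto_sandwich)
      show "eventually (\<lambda>n. \<bar>s - t\<bar> \<le> d (f n s) (f n t)) ultra"
        using d_diff[of p "f _ s" "f _ t"] p f st by auto
      show "eventually (\<lambda>n. d (f n s) (f n t) \<le> \<bar>s - t\<bar> + inverse (real (Suc n))) ultra"
        using f st by auto
      show "((\<lambda>n. \<bar>s - t\<bar> + inverse (real (Suc n))) \<longlongrightarrow> \<bar>s - t\<bar>) ultra"
        using tendsto_add[OF tendsto_const tendsto_ultraI[OF inv], of "\<bar>s - t\<bar>"] by simp
    qed auto
  qed (use p f in auto)
  have \<gamma>M: "\<gamma> t \<in> M" if "t \<in> {0..l}" for t using \<gamma>(1) that by (auto simp: unit_speed_minimal_def)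
  have dp: "d p (\<gamma> t) = t" if "t \<in> {0..l}" for t
  proof (rule tendsto_unique[OF ultra_neq_bot])
    show "((\<lambda>n. d p (f n t)) \<longlongrightarrow> d p (\<gamma> t)) ultra"
      by (rule d_tendsto) (use p f \<gamma>M \<gamma> that in auto)
    show "((\<lambda>n. d p (f n t)) \<longlongrightarrow> t) ultra" using f that by simp
  qed
  have "d (\<gamma> l) q \<le> 0"
  proof (rule tendsto_le[OF ultra_neq_bot])
    show "((\<lambda>n. d (f n l) q) \<longlongrightarrow> d (\<gamma> l) q) ultra"
      by (rule d_tendsto) (use p f \<gamma>M \<gamma> l in auto)
    show "((\<lambda>n. inverse (real (Suc n))) \<longlongrightarrow> 0) ultra" by (rule tendsto_ultraI[OF inv])
    show "eventually (\<lambda>n. d (f n l) q \<le> inverse (real (Suc n))) ultra" using f(3)[of l] l by auto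
  qed
  then have "\<gamma> l = q" using \<gamma>M[of l] p l by (metis atLeastAtMost_iff mdist_nonneg mdist_zero order_antisym order_refl)
  moreover have "\<gamma> 0 = p" using dp[of 0] \<gamma>M[of 0] p l by (metis atLeastAtMost_iff mdist_zero order_refl)
  ultimately have "\<gamma> \<in> minimal_geodesics X p q" using \<gamma>(1) by (simp add: minimal_geodesics_def l_def)
  then show ?thesis by blast
qed

end

section \<open>Angles\<close>

text \<open>The Euclidean law of cosines for sides \<open>cos u\<close> and \<open>cos v\<close>
  enclosing the angle \<open>u + v\<close>: the third side is \<open>sin (u + v)\<close>.\<close>

lemma cos_half_sum_identity:
  fixes u v :: real
  shows "(cos v)\<^sup>2 + (cos u)\<^sup>2 - 2 * cos u * cos v * cos (u + v) = (sin (u + v))\<^sup>2"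
proof -
  have s: "(sin u)\<^sup>2 = 1 - (cos u)\<^sup>2" "(sin v)\<^sup>2 = 1 - (cos v)\<^sup>2" by (simp_all add: sin_squared_eq)
  have "(sin (u + v))\<^sup>2 = (sin u)\<^sup>2 * (cos v)\<^sup>2 + 2 * (sin u * sin v * cos u * cos v) + (cos u)\<^sup>2 * (sin v)\<^sup>2"
    by (simp add: sin_add power2_eq_square algebra_simps)
  also have "\<dots> = (cos v)\<^sup>2 + (cos u)\<^sup>2 - 2 * cos u * cos v * (cos u * cos v - sin u * sin v)"
    unfolding s by (simp add: power2_eq_square algebra_simps)
  finally show ?thesis by (simp add: cos_add)
qed

lemma sqrt_two_minus_two_cos:
  assumes "0 \<le> x" "x \<le> 2 * pi" shows "sqrt (2 - 2 * cos x) = 2 * sin (x / 2)"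
proof (rule real_sqrt_unique)
  have "cos x = 1 - 2 * (sin (x / 2))\<^sup>2" using cos_double_sin[of "x / 2"] by simp
  then show "(2 * sin (x / 2))\<^sup>2 = 2 - 2 * cos x" by (simp add: power_mult_distrib)
  show "0 \<le> 2 * sin (x / 2)" using assms sin_ge_zero[of "x / 2"] by simp
qed

context alexandrov
begin

abbreviation ang :: "'a \<Rightarrow> (real \<Rightarrow> 'a) \<Rightarrow> (real \<Rightarrow> 'a) \<Rightarrow> real" where
  "ang \<equiv> geodesic_angle X"

lemma unit_speed_minimalD:
  assumes "unit_speed_minimal X l \<gamma>" "0 \<le> s" "s \<le> l"
  shows "\<gamma> s \<in> M" "0 \<le> t \<Longrightarrow> t \<le> l \<Longrightarrow> d (\<gamma> s) (\<gamma> t) = \<bar>s - t\<bar>"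
  using assms by (auto simp: unit_speed_minimal_def)

lemma unit_speed_minimal_le:
  "unit_speed_minimal X l \<gamma> \<Longrightarrow> l' \<le> l \<Longrightarrow> unit_speed_minimal X l' \<gamma>"
  unfolding unit_speed_minimal_def by force

lemma d_start:
  assumes "unit_speed_minimal X l \<gamma>" "\<gamma> 0 = p" "0 \<le> s" "s \<le> l"
  shows "d p (\<gamma> s) = s"
  using unit_speed_minimalD(2)[OF assms(1), of 0 s] assms by simp

text \<open>Comparison angles at \<open>p\<close> grow as the point on the geodesic slides towards
  \<open>p\<close>, so cosines decrease.\<close>

lemma geodesic_mcos_mono:
  assumes \<gamma>: "unit_speed_minimal X l \<gamma>" "\<gamma> 0 = p" and s: "0 < s" "s \<le> s'" "s' \<le> l" "s' \<le> R0 / 4"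
    and z: "z \<in> M" "z \<noteq> p" "d p z \<le> R0 / 4"
  shows "mcos k s (d p z) (d (\<gamma> s) z) \<le> mcos k s' (d p z) (d (\<gamma> s') z)"
proof -
  have p: "p \<in> M" using unit_speed_minimalD(1)[OF \<gamma>(1), of 0] \<gamma>(2) s by simp
  have D: "d p (\<gamma> s) = s" "d p (\<gamma> s') = s'" "d (\<gamma> s) (\<gamma> s') = s' - s" "\<gamma> s \<in> M" "\<gamma> s' \<in> M"
    using d_start[OF \<gamma>, of s] d_start[OF \<gamma>, of s'] unit_speed_minimalD[OF \<gamma>(1), of s] unit_speed_minimalD[OF \<gamma>(1), of s'] s
    by simp_all
  have "p \<noteq> \<gamma> s" using D(1) s p by force
  then show ?thesis
    using between_mcos_mono[of p "\<gamma> s'" "\<gamma> s" z] p D s z by simp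
qed

lemma geodesic_mcos_mono2:
  assumes \<gamma>: "unit_speed_minimal X l \<gamma>" "\<gamma> 0 = p" and \<sigma>: "unit_speed_minimal X l' \<sigma>" "\<sigma> 0 = p"
    and s: "0 < s" "s \<le> s'" "s' \<le> l" "s' \<le> R0 / 4" and t: "0 < t" "t \<le> t'" "t' \<le> l'" "t' \<le> R0 / 4"
  shows "mcos k s t (d (\<gamma> s) (\<sigma> t)) \<le> mcos k s' t' (d (\<gamma> s') (\<sigma> t'))"
proof -
  have p: "p \<in> M" using unit_speed_minimalD(1)[OF \<gamma>(1), of 0] \<gamma>(2) s by simp
  have D: "d p (\<gamma> s') = s'" "d p (\<sigma> t) = t" "\<gamma> s' \<in> M" "\<sigma> t \<in> M"
    using d_start[OF \<gamma>, of s'] d_start[OF \<sigma>, of t] unit_speed_minimalD[OF \<gamma>(1), of s'] unit_speed_minimalD[OF \<sigma>(1), of t] s t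
    by simp_all
  have ne: "\<gamma> s' \<noteq> p" "\<sigma> t \<noteq> p" using D(1,2) s t p by force+
  have "mcos k s t (d (\<gamma> s) (\<sigma> t)) \<le> mcos k s' t (d (\<gamma> s') (\<sigma> t))"
    using geodesic_mcos_mono[OF \<gamma> s, of "\<sigma> t"] D ne t by simp
  also have "\<dots> = mcos k t s' (d (\<sigma> t) (\<gamma> s'))" by (simp add: mcos_commute mdist_commute)
  also have "\<dots> \<le> mcos k t' s' (d (\<sigma> t') (\<gamma> s'))"
    using geodesic_mcos_mono[OF \<sigma> t, of "\<gamma> s'"] D ne s by simp
  also have "\<dots> = mcos k s' t' (d (\<gamma> s') (\<sigma> t'))" by (simp add: mcos_commute mdist_commute)
  finally show ?thesis .
qed

lemma eventually_at_right_0_le: "0 < (b::real) \<Longrightarrow> eventually (\<lambda>s. 0 < s \<and> s \<le> b) (at_right 0)"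
  unfolding eventually_at_right_field by (intro exI[of _ b]) auto

lemma eventually_prod_at_right_le:
  "0 < (b::real) \<Longrightarrow> eventually (\<lambda>(s, t). 0 < s \<and> s \<le> b \<and> 0 < t \<and> t \<le> b) (at_right 0 \<times>\<^sub>F at_right 0)"
  unfolding eventually_prod_filter
  using eventually_at_right_0_le[of b] by (intro exI[of _ "\<lambda>s. 0 < s \<and> s \<le> b"]) auto

text \<open>By monotonicity the cosines for curvature \<open>k\<close> converge to their infimum
  over both parameters. \<open>mcos_ecos_close\<close> transfers this limit to the Euclidean
  comparison angles of the definition.\<close>

lemma angle_aux:
  assumes \<gamma>: "\<gamma> \<in> geodesics_from X p" and \<sigma>: "\<sigma> \<in> geodesics_from X p"
  obtains L where "-1 \<le> L" "L \<le> 1" "ang p \<gamma> \<sigma> = arccos L"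
    "((\<lambda>(s, t). ecos s t (d (\<gamma> s) (\<sigma> t))) \<longlongrightarrow> L) (at_right 0 \<times>\<^sub>F at_right 0)"
    "((\<lambda>(s, t). mcos k s t (d (\<gamma> s) (\<sigma> t))) \<longlongrightarrow> L) (at_right 0 \<times>\<^sub>F at_right 0)"
proof -
  let ?F = "at_right (0::real) \<times>\<^sub>F at_right (0::real)"
  have F: "?F \<noteq> bot" by (simp add: prod_filter_eq_bot)
  obtain l where l: "l > 0" "unit_speed_minimal X l \<gamma>" and \<gamma>0: "\<gamma> 0 = p" using \<gamma> by (auto simp: geodesics_from_def)
  obtain l' where l': "l' > 0" "unit_speed_minimal X l' \<sigma>" and \<sigma>0: "\<sigma> 0 = p" using \<sigma> by (auto simp: geodesics_from_def)
  define m where "m = min (min l l') (R0 / 4)"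
  have m: "m > 0" "m \<le> l" "m \<le> l'" "m \<le> R0 / 4" using l l' R0_pos by (auto simp: m_def)
  have p: "p \<in> M" using unit_speed_minimalD(1)[OF l(2), of 0] \<gamma>0 l by simp
  define c where "c s t = mcos k s t (d (\<gamma> s) (\<sigma> t))" for s t
  have D: "\<gamma> s \<in> M" "\<sigma> s \<in> M" "d p (\<gamma> s) = s" "d p (\<sigma> s) = s" if "0 \<le> s" "s \<le> m" for s
    using that m unit_speed_minimalD(1)[OF l(2), of s] unit_speed_minimalD(1)[OF l'(2), of s]
      d_start[OF l(2) \<gamma>0, of s] d_start[OF l'(2) \<sigma>0, of s] by simp_all
  have ne: "\<gamma> s \<noteq> p" "\<sigma> s \<noteq> p" if "0 < s" "s \<le> m" for s
    using D(3,4)[of s] that p by force+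
  have c1: "-1 \<le> c s t" "c s t \<le> 1" if "0 < s" "s \<le> m" "0 < t" "t \<le> m" for s t
    using mcos_d_bounds[of p "\<gamma> s" "\<sigma> t"] D[of s] D[of t] ne[of s] ne[of t] that p m R0_pos by (simp_all add: c_def)
  have cmono: "c s t \<le> c s' t'" if "0 < s" "s \<le> s'" "s' \<le> m" "0 < t" "t \<le> t'" "t' \<le> m" for s t s' t'
    unfolding c_def by (rule geodesic_mcos_mono2[OF l(2) \<gamma>0 l'(2) \<sigma>0]) (use that m in auto)
  define A where "A = (\<lambda>(s, t). c s t) ` ({0<..m} \<times> {0<..m})"
  define L where "L = Inf A"
  have "c m m \<in> A" using m by (auto simp: A_def intro!: image_eqI[of _ _ "(m, m)"])
  have bdd: "bdd_below A" using c1 by (intro bdd_belowI[of _ "-1"]) (auto simp: A_def)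
  have Lle: "L \<le> c s t" if "0 < s" "s \<le> m" "0 < t" "t \<le> m" for s t
    unfolding L_def by (rule cInf_lower[OF _ bdd]) (use that in \<open>auto simp: A_def intro!: image_eqI[of _ _ "(s, t)"]\<close>)
  have L: "-1 \<le> L" "L \<le> 1"
  proof -
    show "-1 \<le> L" unfolding L_def
      by (rule cInf_greatest) (use \<open>c m m \<in> A\<close> c1 in \<open>auto simp: A_def\<close>)
    show "L \<le> 1" using Lle[of m m] c1[of m m] m by simp
  qed
  have climit: "((\<lambda>(s, t). c s t) \<longlongrightarrow> L) ?F"
  proof (rule tendstoI)
    fix e :: real assume e: "e > 0"
    have "\<exists>x\<in>A. x < L + e" using cInf_lessD[of A "L + e"] e \<open>c m m \<in> A\<close> by (auto simp: L_def)
    then obtain s0 t0 where st: "0 < s0" "s0 \<le> m" "0 < t0" "t0 \<le> m" "c s0 t0 < L + e" by (auto simp: A_def)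
    define b where "b = min s0 t0"
    have b: "b > 0" using st by (simp add: b_def)
    show "eventually (\<lambda>x. dist (case x of (s, t) \<Rightarrow> c s t) L < e) ?F"
      using eventually_prod_at_right_le[OF b]
    proof eventually_elim
      case (elim x)
      obtain s t where x: "x = (s, t)" by force
      with elim st have st': "0 < s" "s \<le> s0" "0 < t" "t \<le> t0" by (auto simp: b_def)
      then have "c s t \<le> c s0 t0" "L \<le> c s t" using cmono[of s s0 t t0] Lle[of s t] st by auto
      with st(5) show ?case by (simp add: x dist_real_def)
    qed
  qed
  define E where "E s t = ecos s t (d (\<gamma> s) (\<sigma> t))" for s t
  have tri: "\<bar>s - t\<bar> \<le> d (\<gamma> s) (\<sigma> t)" "d (\<gamma> s) (\<sigma> t) \<le> s + t" if "0 \<le> s" "s \<le> m" "0 \<le> t" "t \<le> m" for s t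
    using d_sides[of p "\<gamma> s" "\<sigma> t"] D[of s] D[of t] that p by auto
  have Elimit: "((\<lambda>(s, t). E s t) \<longlongrightarrow> L) ?F"
  proof (rule Lim_transform)
    show "((\<lambda>(s, t). c s t) \<longlongrightarrow> L) ?F" by (rule climit)
    show "((\<lambda>x. (case x of (s, t) \<Rightarrow> E s t) - (case x of (s, t) \<Rightarrow> c s t)) \<longlongrightarrow> 0) ?F"
    proof (rule tendstoI)
      fix e :: real assume e: "e > 0"
      then obtain r where r: "r > 0" "\<And>a b c. 0 < a \<Longrightarrow> 0 < b \<Longrightarrow> a \<le> r \<Longrightarrow> b \<le> r \<Longrightarrow> \<bar>a - b\<bar> \<le> c \<Longrightarrow> c \<le> a + b \<Longrightarrow>
        \<bar>mcos k a b c - ecos a b c\<bar> \<le> e / 2" using mcos_ecos_close[of "e / 2" k] by auto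
      have "min r m > 0" using r m by simp
      from eventually_prod_at_right_le[OF this]
      show "eventually (\<lambda>x. dist ((case x of (s, t) \<Rightarrow> E s t) - (case x of (s, t) \<Rightarrow> c s t)) 0 < e) ?F"
      proof eventually_elim
        case (elim x)
        obtain s t where x: "x = (s, t)" by force
        with elim have st: "0 < s" "s \<le> r" "s \<le> m" "0 < t" "t \<le> r" "t \<le> m" by auto
        have "\<bar>c s t - E s t\<bar> \<le> e / 2" unfolding c_def E_def using st tri[of s t] by (intro r) auto
        with e show ?case by (simp add: x dist_real_def abs_minus_commute)
      qed
    qed
  qed
  have "((\<lambda>x. arccos (case x of (s, t) \<Rightarrow> E s t)) \<longlongrightarrow> arccos L) ?F"
  proof (rule continuous_on_tendsto_compose[OF continuous_on_arccos' Elimit])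
    show "L \<in> {-1..1}" using L by simp
    show "eventually (\<lambda>x. (case x of (s, t) \<Rightarrow> E s t) \<in> {-1..1}) ?F"
      using eventually_prod_at_right_le[OF m(1)]
    proof eventually_elim
      case (elim x)
      obtain s t where x: "x = (s, t)" by force
      with elim tri[of s t] ecos_bounds[of s t "d (\<gamma> s) (\<sigma> t)"] show ?case by (auto simp: E_def)
    qed
  qed
  then have "((\<lambda>(s, t). comparison_angle X 0 p (\<gamma> s) (\<sigma> t)) \<longlongrightarrow> arccos L) ?F"
  proof (rule tendsto_cong[THEN iffD1, rotated])
    show "eventually (\<lambda>x. arccos (case x of (s, t) \<Rightarrow> E s t) = (case x of (s, t) \<Rightarrow> comparison_angle X 0 p (\<gamma> s) (\<sigma> t))) ?F"
      using eventually_prod_at_right_le[OF m(1)]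
    proof eventually_elim
      case (elim x)
      obtain s t where x: "x = (s, t)" by force
      with elim D[of s] D[of t] show ?case by (simp add: E_def comparison_angle_def model_angle_def)
    qed
  qed
  then have "ang p \<gamma> \<sigma> = arccos L" unfolding geodesic_angle_def by (rule tendsto_Lim[OF F])
  with L climit Elimit that show ?thesis unfolding c_def E_def by simp
qed

lemma ang_bounds:
  assumes "\<gamma> \<in> geodesics_from X p" "\<sigma> \<in> geodesics_from X p"
  shows "0 \<le> ang p \<gamma> \<sigma>" "ang p \<gamma> \<sigma> \<le> pi"
  by (rule angle_aux[OF assms]; simp add: arccos_lbound arccos_ubound)+

lemma ecos_tendsto_cos_ang:
  assumes "\<gamma> \<in> geodesics_from X p" "\<sigma> \<in> geodesics_from X p"
    and u: "filterlim u (at_right 0) F" and v: "filterlim v (at_right 0) F"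
  shows "((\<lambda>n. ecos (u n) (v n) (d (\<gamma> (u n)) (\<sigma> (v n)))) \<longlongrightarrow> cos (ang p \<gamma> \<sigma>)) F"
proof (rule angle_aux[OF assms(1,2)])
  fix L assume L: "-1 \<le> L" "L \<le> 1" "ang p \<gamma> \<sigma> = arccos L"
    "((\<lambda>(s, t). ecos s t (d (\<gamma> s) (\<sigma> t))) \<longlongrightarrow> L) (at_right 0 \<times>\<^sub>F at_right 0)"
  from filterlim_compose[OF L(4) filterlim_Pair[OF u v]] L(1-3) show ?thesis by simp
qed

text \<open>Hinge comparison: the angle is the limit of comparison angles that increase towards
  \<open>p\<close>, hence at least as large as each of them.\<close>

lemma cos_ang_le_mcos:
  assumes \<gamma>: "unit_speed_minimal X l \<gamma>" "\<gamma> 0 = p" and \<sigma>: "unit_speed_minimal X l' \<sigma>" "\<sigma> 0 = p"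
    and s: "0 < s" "s \<le> l" "s \<le> R0 / 4" and t: "0 < t" "t \<le> l'" "t \<le> R0 / 4"
  shows "cos (ang p \<gamma> \<sigma>) \<le> mcos k s t (d (\<gamma> s) (\<sigma> t))"
proof (rule angle_aux)
  show "\<gamma> \<in> geodesics_from X p" using \<gamma> s unfolding geodesics_from_def by (auto intro!: exI[of _ l])
  show "\<sigma> \<in> geodesics_from X p" using \<sigma> t unfolding geodesics_from_def by (auto intro!: exI[of _ l'])
  fix L assume L: "-1 \<le> L" "L \<le> 1" "ang p \<gamma> \<sigma> = arccos L"
    "((\<lambda>(s, t). mcos k s t (d (\<gamma> s) (\<sigma> t))) \<longlongrightarrow> L) (at_right 0 \<times>\<^sub>F at_right 0)"
  have "L \<le> mcos k s t (d (\<gamma> s) (\<sigma> t))"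
  proof (rule tendsto_upperbound[OF L(4)])
    have "min s t > 0" using s t by simp
    from eventually_prod_at_right_le[OF this]
    show "eventually (\<lambda>x. (case x of (s, t) \<Rightarrow> mcos k s t (d (\<gamma> s) (\<sigma> t))) \<le> mcos k s t (d (\<gamma> s) (\<sigma> t))) (at_right 0 \<times>\<^sub>F at_right 0)"
    proof eventually_elim
      case (elim x)
      obtain s' t' where x: "x = (s', t')" by force
      with elim geodesic_mcos_mono2[OF \<gamma> \<sigma>, of s' s t' t] s t show ?case by auto
    qed
  qed (simp add: prod_filter_eq_bot)
  with L show "cos (ang p \<gamma> \<sigma>) \<le> mcos k s t (d (\<gamma> s) (\<sigma> t))" by simp
qed

section \<open>Angles as a pseudometric on geodesics\<close>

lemma filterlim_ident_at_right: "filterlim (\<lambda>s::real. s) (at_right 0) (at_right 0)"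
  by (simp add: filterlim_def)

lemma cos_inj_0_pi: "0 \<le> x \<Longrightarrow> x \<le> pi \<Longrightarrow> 0 \<le> y \<Longrightarrow> y \<le> pi \<Longrightarrow> cos x = cos y \<Longrightarrow> x = y"
  by (metis arccos_cos)

lemma ang_commute:
  assumes "\<gamma> \<in> geodesics_from X p" "\<sigma> \<in> geodesics_from X p"
  shows "ang p \<gamma> \<sigma> = ang p \<sigma> \<gamma>"
proof (rule cos_inj_0_pi)
  note 1 = ecos_tendsto_cos_ang[OF assms filterlim_ident_at_right filterlim_ident_at_right]
  note 2 = ecos_tendsto_cos_ang[OF assms(2,1) filterlim_ident_at_right filterlim_ident_at_right]
  show "cos (ang p \<gamma> \<sigma>) = cos (ang p \<sigma> \<gamma>)"
    by (rule tendsto_unique[OF trivial_limit_at_right_real 1]) (use 2 in \<open>simp add: mdist_commute\<close>)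
qed (use ang_bounds assms in auto)

lemma ang_eq_0_if_eventually_eq:
  assumes "\<gamma> \<in> geodesics_from X p" "\<sigma> \<in> geodesics_from X p" and b: "b > 0" "\<And>s. 0 < s \<Longrightarrow> s \<le> b \<Longrightarrow> \<gamma> s = \<sigma> s"
  shows "ang p \<gamma> \<sigma> = 0"
proof (rule cos_inj_0_pi)
  obtain l where l: "l > 0" "unit_speed_minimal X l \<gamma>" using assms(1) by (auto simp: geodesics_from_def)
  note 1 = ecos_tendsto_cos_ang[OF assms(1,2) filterlim_ident_at_right filterlim_ident_at_right]
  have "((\<lambda>s. ecos s s (d (\<gamma> s) (\<sigma> s))) \<longlongrightarrow> 1) (at_right 0)"
  proof (rule tendsto_eventually)
    have "min b l > 0" using b l by simp
    from eventually_at_right_0_le[OF this]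
    show "eventually (\<lambda>s. ecos s s (d (\<gamma> s) (\<sigma> s)) = 1) (at_right 0)"
    proof eventually_elim
      case (elim s)
      then have "\<sigma> s = \<gamma> s" "\<gamma> s \<in> M" using b unit_speed_minimalD(1)[OF l(2), of s] by auto
      with elim show ?case by (simp add: power2_eq_square)
    qed
  qed
  from tendsto_unique[OF trivial_limit_at_right_real 1 this] show "cos (ang p \<gamma> \<sigma>) = cos 0" by simp
qed (use ang_bounds assms in auto)

lemma ang_self: "\<gamma> \<in> geodesics_from X p \<Longrightarrow> ang p \<gamma> \<gamma> = 0"
  by (rule ang_eq_0_if_eventually_eq[of _ _ _ 1]) auto

text \<open>To first order, two geodesics from \<open>p\<close> span a planar sector: the limit is
  the third side of the Euclidean triangle with sides 1 and \<open>c\<close> enclosing their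
  angle.\<close>

lemma dist_quotient_tendsto:
  assumes "\<gamma> \<in> geodesics_from X p" "\<sigma> \<in> geodesics_from X p" and c: "c > 0"
  shows "((\<lambda>s. d (\<gamma> s) (\<sigma> (c * s)) / s) \<longlongrightarrow> sqrt (1 + c\<^sup>2 - 2 * c * cos (ang p \<gamma> \<sigma>))) (at_right 0)"
proof -
  have c': "filterlim (\<lambda>s. c * s) (at_right 0) (at_right 0)"
    unfolding filterlim_at
  proof (intro conjI)
    show "((\<lambda>s. c * s) \<longlongrightarrow> 0) (at_right 0)"
      using tendsto_mult[OF tendsto_const tendsto_ident_at, of c 0 "{0<..}"] by simp
    show "eventually (\<lambda>s. c * s \<in> {0<..} \<and> c * s \<noteq> 0) (at_right 0)"
      using eventually_at_right_0_le[OF zero_less_one] by eventually_elim (use c in auto)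
  qed
  note 1 = ecos_tendsto_cos_ang[OF assms(1,2) filterlim_ident_at_right c']
  have "((\<lambda>s. sqrt (1 + c\<^sup>2 - 2 * c * ecos s (c * s) (d (\<gamma> s) (\<sigma> (c * s))))) \<longlongrightarrow>
      sqrt (1 + c\<^sup>2 - 2 * c * cos (ang p \<gamma> \<sigma>))) (at_right 0)"
    by (intro tendsto_intros 1)
  then show ?thesis
  proof (rule tendsto_cong[THEN iffD1, rotated])
    show "eventually (\<lambda>s. sqrt (1 + c\<^sup>2 - 2 * c * ecos s (c * s) (d (\<gamma> s) (\<sigma> (c * s)))) = d (\<gamma> s) (\<sigma> (c * s)) / s) (at_right 0)"
      using eventually_at_right_0_le[OF zero_less_one]
    proof eventually_elim
      case (elim s)
      define D where "D = d (\<gamma> s) (\<sigma> (c * s))"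
      have "1 + c\<^sup>2 - 2 * c * ecos s (c * s) D = (D / s)\<^sup>2"
        using elim c by (simp add: field_simps power2_eq_square)
      then show ?case using elim by (simp add: D_def)
    qed
  qed
qed

text \<open>Comparing with the point of the middle ray that lies on the base of an isosceles Euclidean triangle with
  apex angle \<open>\<alpha> + \<beta>\<close> gives the triangle inequality for angles.\<close>

lemma ang_triangle:
  assumes \<gamma>: "\<gamma> \<in> geodesics_from X p" and \<sigma>: "\<sigma> \<in> geodesics_from X p" and \<tau>: "\<tau> \<in> geodesics_from X p"
  shows "ang p \<gamma> \<tau> \<le> ang p \<gamma> \<sigma> + ang p \<sigma> \<tau>"
proof -
  define \<alpha> where "\<alpha> = ang p \<gamma> \<sigma>"
  define \<beta> where "\<beta> = ang p \<sigma> \<tau>"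
  define \<delta> where "\<delta> = ang p \<gamma> \<tau>"
  have b: "0 \<le> \<alpha>" "\<alpha> \<le> pi" "0 \<le> \<beta>" "\<beta> \<le> pi" "0 \<le> \<delta>" "\<delta> \<le> pi"
    using ang_bounds assms by (auto simp: \<alpha>_def \<beta>_def \<delta>_def)
  show ?thesis
  proof (cases "\<alpha> + \<beta> \<ge> pi")
    case True
    then show ?thesis using b by (simp add: \<alpha>_def \<beta>_def \<delta>_def)
  next
    case False
    define u where "u = (\<alpha> + \<beta>) / 2"
    define v where "v = (\<alpha> - \<beta>) / 2"
    have uv: "\<alpha> = u + v" "\<beta> = u + (- v)" by (simp_all add: u_def v_def field_simps)
    have u: "0 \<le> u" "u < pi / 2" and v: "- (pi / 2) < v" "v < pi / 2"
      using b False by (auto simp: u_def v_def)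
    have cu: "cos u > 0" "cos v > 0" using u v by (auto intro!: cos_gt_zero_pi)
    \<comment> \<open>In the isosceles triangle with unit legs and apex angle \<open>2 * u\<close>,
      the altitude is \<open>cos u\<close> and the middle ray deviates from it by \<open>v\<close>.
      It therefore meets the base at distance \<open>cos u / cos v\<close> from the apex.\<close>
    define c where "c = cos u / cos v"
    have c: "c > 0" using cu by (simp add: c_def)
    \<comment> \<open>Used with \<open>w = v\<close> and \<open>w = - v\<close> for the two pieces
      into which the middle ray cuts the base.\<close>
    have side: "sqrt (1 + c\<^sup>2 - 2 * c * cos (u + w)) = sin (u + w) / cos v"
      if w: "cos w = cos v" "0 \<le> u + w" "u + w \<le> pi" for w
    proof (rule real_sqrt_unique)
      have "1 + c\<^sup>2 - 2 * c * cos (u + w) = ((cos v)\<^sup>2 + (cos u)\<^sup>2 - 2 * cos u * cos v * cos (u + w)) / (cos v)\<^sup>2"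
        using cu by (simp add: c_def field_simps power2_eq_square)
      also have "\<dots> = (sin (u + w))\<^sup>2 / (cos v)\<^sup>2" using cos_half_sum_identity[of w u] w by simp
      finally show "(sin (u + w) / cos v)\<^sup>2 = 1 + c\<^sup>2 - 2 * c * cos (u + w)" by (simp add: power_divide)
      show "0 \<le> sin (u + w) / cos v" using cu w sin_ge_zero[of "u + w"] by simp
    qed
    have L1: "((\<lambda>s. d (\<gamma> s) (\<sigma> (c * s)) / s) \<longlongrightarrow> sin \<alpha> / cos v) (at_right 0)"
      using dist_quotient_tendsto[OF \<gamma> \<sigma> c] side[of v] b uv by (simp add: \<alpha>_def)
    have "cos (- v) = cos v" by simp
    have L2: "((\<lambda>s. d (\<tau> s) (\<sigma> (c * s)) / s) \<longlongrightarrow> sin \<beta> / cos v) (at_right 0)"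
      using dist_quotient_tendsto[OF \<tau> \<sigma> c] side[of "- v"] b uv(2) ang_commute[OF \<sigma> \<tau>]
      by (simp add: \<beta>_def)
    have L3: "((\<lambda>s. d (\<gamma> s) (\<tau> s) / s) \<longlongrightarrow> 2 * sin (\<delta> / 2)) (at_right 0)"
      using dist_quotient_tendsto[OF \<gamma> \<tau>, of 1] sqrt_two_minus_two_cos[of \<delta>] b by (simp add: \<delta>_def)
    obtain l1 where l1: "l1 > 0" "unit_speed_minimal X l1 \<gamma>" using \<gamma> by (auto simp: geodesics_from_def)
    obtain l2 where l2: "l2 > 0" "unit_speed_minimal X l2 \<sigma>" using \<sigma> by (auto simp: geodesics_from_def)
    obtain l3 where l3: "l3 > 0" "unit_speed_minimal X l3 \<tau>" using \<tau> by (auto simp: geodesics_from_def)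
    have "2 * sin (\<delta> / 2) \<le> sin \<alpha> / cos v + sin \<beta> / cos v"
    proof (rule tendsto_le[OF trivial_limit_at_right_real tendsto_add[OF L1 L2] L3])
      have "min (min l1 l3) (l2 / c) > 0" using l1 l2 l3 c by simp
      from eventually_at_right_0_le[OF this]
      show "eventually (\<lambda>s. d (\<gamma> s) (\<tau> s) / s \<le> d (\<gamma> s) (\<sigma> (c * s)) / s + d (\<tau> s) (\<sigma> (c * s)) / s) (at_right 0)"
      proof eventually_elim
        case (elim s)
        then have "c * s \<le> l2" "0 < c * s" using c by (auto simp: field_simps)
        then have "\<gamma> s \<in> M" "\<tau> s \<in> M" "\<sigma> (c * s) \<in> M"
          using elim unit_speed_minimalD(1) l1(2) l2(2) l3(2) by auto
        then have "d (\<gamma> s) (\<tau> s) \<le> d (\<gamma> s) (\<sigma> (c * s)) + d (\<tau> s) (\<sigma> (c * s))"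
          using d_tri[of "\<gamma> s" "\<sigma> (c * s)" "\<tau> s"] by (simp add: mdist_commute)
        then show ?case using elim by (simp add: add_divide_distrib[symmetric] divide_right_mono)
      qed
    qed
    also have "\<dots> = 2 * sin u"
      using cu by (simp add: uv sin_add sin_diff field_simps)
    finally have le: "sin (\<delta> / 2) \<le> sin u" by simp
    have "\<delta> / 2 \<le> u"
    proof (rule ccontr)
      assume "\<not> ?thesis"
      then have "sin u < sin (\<delta> / 2)" using u b by (intro sin_monotone_2pi) auto
      with le show False by simp
    qed
    then show ?thesis by (simp add: u_def \<alpha>_def \<beta>_def \<delta>_def)
  qed
qed

end

section \<open>Spaces of directions are compact\<close>

text \<open>Distance 0 does not imply equality here: geodesics with the same germ have angle 0 but
  may differ as functions.\<close>

locale pseudometric =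
  fixes S :: "'b set" and dd :: "'b \<Rightarrow> 'b \<Rightarrow> real"
  assumes nonneg: "x \<in> S \<Longrightarrow> y \<in> S \<Longrightarrow> 0 \<le> dd x y"
    and refl: "x \<in> S \<Longrightarrow> dd x x = 0"
    and sym: "x \<in> S \<Longrightarrow> y \<in> S \<Longrightarrow> dd x y = dd y x"
    and tri: "x \<in> S \<Longrightarrow> y \<in> S \<Longrightarrow> z \<in> S \<Longrightarrow> dd x z \<le> dd x y + dd y z"
begin

abbreviation "cls u \<equiv> cauchy_rel S dd `` {u}"
abbreviation "pt x \<equiv> completion_point S dd x"
abbreviation "cd \<equiv> completion_dist dd"

lemma cd_tendsto: "u \<in> cauchy_seqs S dd \<Longrightarrow> v \<in> cauchy_seqs S dd \<Longrightarrow> (\<lambda>n. dd (u n) (v n)) \<longlonglongrightarrow> cd (cls u) (cls v)"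
  by (rule completion_dist_limit[OF nonneg refl sym tri])

lemma cauchy_seqs_in: "u \<in> cauchy_seqs S dd \<Longrightarrow> u n \<in> S"
  by (auto simp: cauchy_seqs_def)

lemma completionE:
  assumes "\<xi> \<in> completion S dd"
  obtains u where "u \<in> cauchy_seqs S dd" "\<xi> = cls u"
  using assms unfolding completion_def by (rule quotientE)

lemma cls_in: "u \<in> cauchy_seqs S dd \<Longrightarrow> cls u \<in> completion S dd"
  unfolding completion_def by (rule quotientI)

lemma const_in: "x \<in> S \<Longrightarrow> (\<lambda>n. x) \<in> cauchy_seqs S dd"
  by (simp add: cauchy_seqs_def refl image_subset_iff)

lemma pt_in: "x \<in> S \<Longrightarrow> pt x \<in> completion S dd"
  unfolding completion_point_def by (intro cls_in const_in)

lemma cd_pt_pt: "x \<in> S \<Longrightarrow> y \<in> S \<Longrightarrow> cd (pt x) (pt y) = dd x y"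
  unfolding completion_point_def
  by (rule LIMSEQ_unique[OF cd_tendsto[OF const_in const_in]]) auto

lemma cd_nonneg: assumes "\<xi> \<in> completion S dd" "\<eta> \<in> completion S dd" shows "0 \<le> cd \<xi> \<eta>"
proof -
  obtain u v where uv: "u \<in> cauchy_seqs S dd" "\<xi> = cls u" "v \<in> cauchy_seqs S dd" "\<eta> = cls v"
    using assms by (metis completionE)
  have "0 \<le> dd (u n) (v n)" for n using uv cauchy_seqs_in nonneg by simp
  then show ?thesis using LIMSEQ_le_const[OF cd_tendsto[OF uv(1,3)]] uv by simp
qed

lemma cd_le: assumes "\<xi> \<in> completion S dd" "\<eta> \<in> completion S dd" and b: "\<And>x y. x \<in> S \<Longrightarrow> y \<in> S \<Longrightarrow> dd x y \<le> b"
  shows "cd \<xi> \<eta> \<le> b"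
proof -
  obtain u v where uv: "u \<in> cauchy_seqs S dd" "\<xi> = cls u" "v \<in> cauchy_seqs S dd" "\<eta> = cls v"
    using assms by (metis completionE)
  have "dd (u n) (v n) \<le> b" for n using uv cauchy_seqs_in b by simp
  then show ?thesis using LIMSEQ_le_const2[OF cd_tendsto[OF uv(1,3)]] uv by simp
qed

lemma cd_self: assumes "\<xi> \<in> completion S dd" shows "cd \<xi> \<xi> = 0"
proof -
  obtain u where u: "u \<in> cauchy_seqs S dd" "\<xi> = cls u" using assms by (metis completionE)
  have "(\<lambda>n. dd (u n) (u n)) \<longlonglongrightarrow> cd \<xi> \<xi>" using cd_tendsto[OF u(1) u(1)] u by simp
  moreover have "dd (u n) (u n) = 0" for n using u cauchy_seqs_in refl by simp
  ultimately show ?thesis by (simp add: LIMSEQ_const_iff)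
qed

lemma cd_commute: assumes "\<xi> \<in> completion S dd" "\<eta> \<in> completion S dd" shows "cd \<xi> \<eta> = cd \<eta> \<xi>"
proof -
  obtain u v where uv: "u \<in> cauchy_seqs S dd" "\<xi> = cls u" "v \<in> cauchy_seqs S dd" "\<eta> = cls v"
    using assms by (metis completionE)
  have "dd (u n) (v n) = dd (v n) (u n)" for n using uv cauchy_seqs_in sym by simp
  then show ?thesis
    using cd_tendsto[OF uv(1,3)] cd_tendsto[OF uv(3,1)] uv LIMSEQ_unique by simp
qed

lemma cd_triangle:
  assumes "\<xi> \<in> completion S dd" "\<eta> \<in> completion S dd" "\<zeta> \<in> completion S dd"
  shows "cd \<xi> \<zeta> \<le> cd \<xi> \<eta> + cd \<eta> \<zeta>"
proof -
  obtain u v w where uv: "u \<in> cauchy_seqs S dd" "\<xi> = cls u" "v \<in> cauchy_seqs S dd" "\<eta> = cls v"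
    "w \<in> cauchy_seqs S dd" "\<zeta> = cls w"
    using assms by (metis completionE)
  have "dd (u n) (w n) \<le> dd (u n) (v n) + dd (v n) (w n)" for n
    using uv cauchy_seqs_in by (intro tri) auto
  then show ?thesis
    using LIMSEQ_le[OF cd_tendsto[OF uv(1,5)] tendsto_add[OF cd_tendsto[OF uv(1,3)] cd_tendsto[OF uv(3,5)]]] uv by simp
qed

lemma cd_cls_pt_le:
  assumes u: "u \<in> cauchy_seqs S dd" and x: "x \<in> S" and b: "\<And>n. n \<ge> N \<Longrightarrow> dd (u n) x \<le> b"
  shows "cd (cls u) (pt x) \<le> b"
  unfolding completion_point_def
  by (rule LIMSEQ_le_const2[OF cd_tendsto[OF u const_in[OF x]]]) (use b in blast)

lemma completion_dense:
  assumes "\<xi> \<in> completion S dd" "e > 0"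
  obtains x where "x \<in> S" "cd \<xi> (pt x) < e"
proof -
  obtain u where u: "u \<in> cauchy_seqs S dd" "\<xi> = cls u" using assms by (metis completionE)
  have "e / 2 > 0" using assms by simp
  moreover have "\<forall>e>0. \<exists>N. \<forall>m\<ge>N. \<forall>n\<ge>N. dd (u m) (u n) < e" using u(1) by (simp add: cauchy_seqs_def)
  ultimately have "\<exists>N. \<forall>m\<ge>N. \<forall>n\<ge>N. dd (u m) (u n) < e / 2" by (elim allE[of _ "e / 2"] impE)
  then obtain N where N: "\<forall>m\<ge>N. \<forall>n\<ge>N. dd (u m) (u n) < e / 2" ..
  have "cd (cls u) (pt (u N)) \<le> e / 2"
    by (rule cd_cls_pt_le[OF u(1) cauchy_seqs_in[OF u(1)], of N]) (use N in \<open>simp add: less_imp_le\<close>)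
  with that[of "u N"] cauchy_seqs_in[OF u(1)] u assms(2) show ?thesis by simp
qed

lemma completion_ultralimit:
  assumes pre: "precompact dd S S" and f: "\<And>n. f n \<in> completion S dd"
  obtains \<xi> where "\<xi> \<in> completion S dd" "((\<lambda>n. cd (f n) \<xi>) \<longlongrightarrow> 0) ultra"
proof -
  have "\<exists>x. x \<in> S \<and> cd (f n) (pt x) < inverse (real (Suc n))" for n
  proof -
    obtain x where "x \<in> S" "cd (f n) (pt x) < inverse (real (Suc n))"
      by (rule completion_dense[OF f[of n], of "inverse (real (Suc n))"]) simp_all
    then show ?thesis by (intro exI[of _ x]) simp
  qed
  then have "\<exists>x. \<forall>n. x n \<in> S \<and> cd (f n) (pt (x n)) < inverse (real (Suc n))" by (intro choice allI)
  then obtain x where x: "\<forall>n. x n \<in> S \<and> cd (f n) (pt (x n)) < inverse (real (Suc n))" by (elim exE)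
  have xS: "x n \<in> S" for n using x by simp
  have "\<exists>a. a \<in> S \<and> eventually (\<lambda>n. dd a (x n) < (1 / 2) ^ j) ultra" for j :: nat
  proof -
    obtain a where "a \<in> S" "eventually (\<lambda>n. dd a (x n) < (1 / 2) ^ j) ultra"
      by (rule precompact_ultra[OF pre, of x "(1 / 2) ^ j"]) (use xS in auto)
    then show ?thesis by (intro exI[of _ a]) simp
  qed
  then have "\<exists>a. \<forall>j. a j \<in> S \<and> eventually (\<lambda>n. dd (a j) (x n) < (1 / 2) ^ j) ultra" by (intro choice allI)
  then obtain a where a': "\<forall>j. a j \<in> S \<and> eventually (\<lambda>n. dd (a j) (x n) < (1 / 2) ^ j) ultra" by (elim exE)
  have aS: "a j \<in> S" and ax: "eventually (\<lambda>n. dd (a j) (x n) < (1 / 2) ^ j) ultra" for j using a' by simp_all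
  have aa: "dd (a i) (a j) < (1 / 2) ^ i + (1 / 2) ^ j" for i j
  proof -
    obtain n where "dd (a i) (x n) < (1 / 2) ^ i" "dd (a j) (x n) < (1 / 2) ^ j"
      using eventually_ultra_ex[OF eventually_conj[OF ax[of i] ax[of j]]] by auto
    then show ?thesis using tri[OF aS[of i] xS[of n] aS[of j]] sym[OF xS[of n] aS[of j]] by linarith
  qed
  have small: "\<exists>j. (1 / 2) ^ j < e" if "e > 0" for e :: real
    using real_arch_pow_inv[OF that, of "1/2"] by auto
  have half: "(1 / 2 :: real) ^ i \<le> (1 / 2) ^ N" if "N \<le> i" for i N :: nat
    using that by (intro power_decreasing) auto
  have "\<exists>N. \<forall>m\<ge>N. \<forall>n\<ge>N. dd (a m) (a n) < e" if e: "e > 0" for e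
  proof -
    obtain N where N: "(1 / 2) ^ N < e / 2" using small[of "e / 2"] e by auto
    have "dd (a i) (a j) < e" if "N \<le> i" "N \<le> j" for i j
      using aa[of i j] N half[OF that(1)] half[OF that(2)] by linarith
    then show ?thesis by blast
  qed
  then have ac: "a \<in> cauchy_seqs S dd" using aS by (auto simp: cauchy_seqs_def)
  have xi: "cls a \<in> completion S dd" by (rule cls_in[OF ac])
  have ca: "cd (cls a) (pt (a j)) \<le> 2 * (1 / 2) ^ j" for j
  proof (rule cd_cls_pt_le[OF ac aS])
    fix n assume "n \<ge> j"
    then show "dd (a n) (a j) \<le> 2 * (1 / 2) ^ j" using aa[of n j] half[of j n] by linarith
  qed
  have "((\<lambda>n. cd (f n) (cls a)) \<longlongrightarrow> 0) ultra"
  proof (rule tendstoI)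
    fix e :: real assume e: "e > 0"
    obtain j where j: "(1 / 2) ^ j < e / 8" using small[of "e / 8"] e by auto
    have "eventually (\<lambda>n. inverse (real (Suc n)) < e / 8) ultra"
      by (rule eventually_ultraI, rule order_tendstoD[OF LIMSEQ_inverse_real_of_nat]) (use e in simp)
    with ax[of j] show "eventually (\<lambda>n. dist (cd (f n) (cls a)) 0 < e) ultra"
    proof eventually_elim
      case (elim n)
      have "cd (f n) (cls a) \<le> cd (f n) (pt (x n)) + cd (pt (x n)) (cls a)"
        by (rule cd_triangle[OF f pt_in[OF xS] xi])
      also have "cd (pt (x n)) (cls a) \<le> cd (pt (x n)) (pt (a j)) + cd (pt (a j)) (cls a)"
        by (rule cd_triangle[OF pt_in[OF xS] pt_in[OF aS] xi])
      finally have "cd (f n) (cls a) \<le> cd (f n) (pt (x n)) + (dd (a j) (x n) + cd (cls a) (pt (a j)))"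
        using cd_pt_pt[OF xS aS, of n j] sym[OF xS aS, of n j] cd_commute[OF pt_in[OF aS] xi, of j] by simp
      moreover have "cd (f n) (pt (x n)) < inverse (real (Suc n))" using x by simp
      moreover have "w < e" if "w \<le> v + (y + z)" "v < i" "y < h" "i < e / 8" "h < e / 8" "z \<le> 2 * h"
        for w v y z i h :: real using that e by linarith
      ultimately have "cd (f n) (cls a) < e" using elim j ca[of j] by metis
      then show ?case using cd_nonneg[OF f xi, of n] by (simp add: dist_real_def)
    qed
  qed
  with xi show ?thesis by (rule that)
qed

end

sublocale alexandrov \<subseteq> geo: pseudometric "geodesics_from X p" "geodesic_angle X p" for p
  by unfold_locales (use ang_bounds ang_self ang_commute ang_triangle in auto)

context alexandrov
begin

abbreviation dirs :: "'a \<Rightarrow> 'a direction set" where "dirs \<equiv> directions X"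
abbreviation dird :: "'a \<Rightarrow> 'a direction \<Rightarrow> 'a direction \<Rightarrow> real" where "dird \<equiv> dir_dist X"
abbreviation dir :: "'a \<Rightarrow> (real \<Rightarrow> 'a) \<Rightarrow> 'a direction" where "dir \<equiv> dir_of X"

lemma dir_in: "\<gamma> \<in> geodesics_from X p \<Longrightarrow> dir p \<gamma> \<in> dirs p"
  unfolding dir_of_def directions_def by (rule geo.pt_in)

lemma dird_dir: "\<gamma> \<in> geodesics_from X p \<Longrightarrow> \<sigma> \<in> geodesics_from X p \<Longrightarrow> dird p (dir p \<gamma>) (dir p \<sigma>) = ang p \<gamma> \<sigma>"
  unfolding dir_of_def dir_dist_def by (rule geo.cd_pt_pt)

lemma dird_nonneg: "\<xi> \<in> dirs p \<Longrightarrow> \<eta> \<in> dirs p \<Longrightarrow> 0 \<le> dird p \<xi> \<eta>"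
  unfolding directions_def dir_dist_def by (rule geo.cd_nonneg)

lemma dird_le_pi: "\<xi> \<in> dirs p \<Longrightarrow> \<eta> \<in> dirs p \<Longrightarrow> dird p \<xi> \<eta> \<le> pi"
  unfolding directions_def dir_dist_def by (rule geo.cd_le) (use ang_bounds in auto)

lemma dird_self: "\<xi> \<in> dirs p \<Longrightarrow> dird p \<xi> \<xi> = 0"
  unfolding directions_def dir_dist_def by (rule geo.cd_self)

lemma dird_commute: "\<xi> \<in> dirs p \<Longrightarrow> \<eta> \<in> dirs p \<Longrightarrow> dird p \<xi> \<eta> = dird p \<eta> \<xi>"
  unfolding directions_def dir_dist_def by (rule geo.cd_commute)

lemma dird_triangle:
  "\<xi> \<in> dirs p \<Longrightarrow> \<eta> \<in> dirs p \<Longrightarrow> \<zeta> \<in> dirs p \<Longrightarrow> dird p \<xi> \<zeta> \<le> dird p \<xi> \<eta> + dird p \<eta> \<zeta>"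
  unfolding directions_def dir_dist_def by (rule geo.cd_triangle)

lemma dir_dense:
  assumes "\<xi> \<in> dirs p" "e > 0"
  obtains \<gamma> where "\<gamma> \<in> geodesics_from X p" "dird p \<xi> (dir p \<gamma>) < e"
  using geo.completion_dense[of \<xi> p e] assms unfolding directions_def dir_dist_def dir_of_def by metis

lemma dird_tendsto:
  assumes "\<xi> \<in> dirs p" "\<eta> \<in> dirs p" "\<And>n. f n \<in> dirs p" "\<And>n. g n \<in> dirs p"
    and "((\<lambda>n. dird p (f n) \<xi>) \<longlongrightarrow> 0) F" "((\<lambda>n. dird p (g n) \<eta>) \<longlongrightarrow> 0) F"
  shows "((\<lambda>n. dird p (f n) (g n)) \<longlongrightarrow> dird p \<xi> \<eta>) F"
proof -
  have "((\<lambda>n. dird p (f n) (g n) - dird p \<xi> \<eta>) \<longlongrightarrow> 0) F"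
  proof (rule Lim_null_comparison)
    show "eventually (\<lambda>n. norm (dird p (f n) (g n) - dird p \<xi> \<eta>) \<le> dird p (f n) \<xi> + dird p (g n) \<eta>) F"
    proof (intro always_eventually allI)
      fix n
      note t = dird_triangle[of "f n" p \<xi> "g n"] dird_triangle[of \<xi> p \<eta> "g n"]
        dird_triangle[of \<xi> p "f n" \<eta>] dird_triangle[of "f n" p "g n" \<eta>]
        dird_commute[of "f n" p \<xi>] dird_commute[of "g n" p \<eta>]
      show "norm (dird p (f n) (g n) - dird p \<xi> \<eta>) \<le> dird p (f n) \<xi> + dird p (g n) \<eta>"
        unfolding real_norm_def abs_le_iff using t assms(1-4) by simp
    qed
    show "((\<lambda>n. dird p (f n) \<xi> + dird p (g n) \<eta>) \<longlongrightarrow> 0) F" using tendsto_add[OF assms(5,6)] by simp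
  qed
  then show ?thesis by (rule LIM_zero_cancel)
qed

text \<open>Directions with large mutual angles become separated points on a sphere of small radius
  \<open>t\<close>. Since \<open>t\<close> depends on the finite family, it is essential that
  \<open>separated_card_le\<close> gives the same bound for all radii.\<close>

lemma precompact_geodesics:
  assumes p: "p \<in> M" shows "precompact (ang p) (geodesics_from X p) (geodesics_from X p)"
proof (rule precompact_if_card_le)
  fix e :: real assume e: "e > 0"
  \<comment> \<open>The minimum with \<open>pi\<close> keeps \<open>e' / 2\<close> where sine is
    increasing. The chord for the angle \<open>e'\<close> has relative length
    \<open>2 * sin (e' / 2)\<close>; taking \<open>c\<close> as half of it makes the limit
    inequality strict.\<close>
  define e' where "e' = min e pi"
  have e': "0 < e'" "e' \<le> e" "e' \<le> pi" using e by (auto simp: e'_def)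
  define c where "c = sin (e' / 2)"
  have c: "0 < c" "c \<le> 1" using e' by (auto simp: c_def intro!: sin_gt_zero)
  from separated_card_le[OF c] obtain N where N: "\<And>p r T. p \<in> M \<Longrightarrow> 0 < r \<Longrightarrow> r \<le> R0 / 12 \<Longrightarrow> finite T \<Longrightarrow> T \<subseteq> M \<Longrightarrow>
     (\<And>z. z \<in> T \<Longrightarrow> d p z \<le> r) \<Longrightarrow> (\<And>z z'. z \<in> T \<Longrightarrow> z' \<in> T \<Longrightarrow> z \<noteq> z' \<Longrightarrow> c * r \<le> d z z') \<Longrightarrow> card T \<le> N"
    by metis
  have "card T \<le> N" if T: "finite T" "T \<subseteq> geodesics_from X p" and sep: "\<forall>x\<in>T. \<forall>y\<in>T. x \<noteq> y \<longrightarrow> e \<le> ang p x y" for T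
  proof -
    have "eventually (\<lambda>t. c * t < d (\<gamma> t) (\<sigma> t)) (at_right 0)" if g: "\<gamma> \<in> T" "\<sigma> \<in> T" "\<gamma> \<noteq> \<sigma>" for \<gamma> \<sigma>
    proof -
      have G: "\<gamma> \<in> geodesics_from X p" "\<sigma> \<in> geodesics_from X p" using g T by auto
      note b = ang_bounds[OF G]
      have "e' / 2 \<le> ang p \<gamma> \<sigma> / 2" using sep g e' by force
      then have "c \<le> sin (ang p \<gamma> \<sigma> / 2)" unfolding c_def using e' b by (intro sin_monotone_2pi_le) auto
      then have "c < 2 * sin (ang p \<gamma> \<sigma> / 2)" using c by simp
      also have "\<dots> = sqrt (2 - 2 * cos (ang p \<gamma> \<sigma>))" using b by (intro sqrt_two_minus_two_cos[symmetric]) auto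
      finally have "eventually (\<lambda>s. c < d (\<gamma> s) (\<sigma> (1 * s)) / s) (at_right 0)"
        by (intro order_tendstoD(1)[OF dist_quotient_tendsto[OF G]]) simp_all
      with eventually_at_right_0_le[OF zero_less_one] show ?thesis
        by eventually_elim (simp add: less_divide_eq)
    qed
    then have "eventually (\<lambda>t. \<gamma> \<noteq> \<sigma> \<longrightarrow> c * t < d (\<gamma> t) (\<sigma> t)) (at_right 0)" if "\<gamma> \<in> T" "\<sigma> \<in> T" for \<gamma> \<sigma>
      using that by (cases "\<gamma> = \<sigma>") simp_all
    then have ev1: "eventually (\<lambda>t. \<forall>\<gamma>\<in>T. \<forall>\<sigma>\<in>T. \<gamma> \<noteq> \<sigma> \<longrightarrow> c * t < d (\<gamma> t) (\<sigma> t)) (at_right 0)"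
      using T(1) by (intro eventually_ball_finite ballI) auto
    have "eventually (\<lambda>t. \<gamma> t \<in> M \<and> d p (\<gamma> t) = t) (at_right 0)" if "\<gamma> \<in> T" for \<gamma>
    proof -
      have "\<gamma> \<in> geodesics_from X p" using that T by auto
      then obtain l where l: "l > 0" "unit_speed_minimal X l \<gamma>" "\<gamma> 0 = p" by (auto simp: geodesics_from_def)
      from eventually_at_right_0_le[OF l(1)] show ?thesis
        by eventually_elim (use l unit_speed_minimalD(1)[OF l(2)] d_start[OF l(2,3)] in simp)
    qed
    then have ev2: "eventually (\<lambda>t. \<forall>\<gamma>\<in>T. \<gamma> t \<in> M \<and> d p (\<gamma> t) = t) (at_right 0)"
      using T(1) by (intro eventually_ball_finite ballI) auto
    have "R0 / 12 > 0" using R0_pos by simp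
    from eventually_happens'[OF trivial_limit_at_right_real
        eventually_conj[OF eventually_at_right_0_le[OF this] eventually_conj[OF ev1 ev2]]]
    obtain t where t: "0 < t" "t \<le> R0 / 12" "\<forall>\<gamma>\<in>T. \<forall>\<sigma>\<in>T. \<gamma> \<noteq> \<sigma> \<longrightarrow> c * t < d (\<gamma> t) (\<sigma> t)"
      "\<forall>\<gamma>\<in>T. \<gamma> t \<in> M \<and> d p (\<gamma> t) = t" by (elim exE conjE)
    have "inj_on (\<lambda>\<gamma>. \<gamma> t) T"
    proof (rule inj_onI, rule ccontr)
      fix \<gamma> \<sigma> assume "\<gamma> \<in> T" "\<sigma> \<in> T" "\<gamma> t = \<sigma> t" "\<gamma> \<noteq> \<sigma>"
      moreover have "0 < c * t" using c t by simp
      ultimately show False using t(3,4) by force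
    qed
    then have "card T = card ((\<lambda>\<gamma>. \<gamma> t) ` T)" by (simp add: card_image)
    also have "\<dots> \<le> N"
    proof (rule N[OF p t(1,2)])
      fix z z' assume "z \<in> (\<lambda>\<gamma>. \<gamma> t) ` T" "z' \<in> (\<lambda>\<gamma>. \<gamma> t) ` T" "z \<noteq> z'"
      then obtain \<gamma> \<sigma> where "\<gamma> \<in> T" "\<sigma> \<in> T" "z = \<gamma> t" "z' = \<sigma> t" "\<gamma> \<noteq> \<sigma>" by force
      with t(3) show "c * t \<le> d z z'" by (simp add: less_imp_le)
    qed (use T t(4) in auto)
    finally show ?thesis .
  qed
  then show "\<exists>N. \<forall>T. finite T \<longrightarrow> T \<subseteq> geodesics_from X p \<longrightarrow>
      (\<forall>x\<in>T. \<forall>y\<in>T. x \<noteq> y \<longrightarrow> e \<le> ang p x y) \<longrightarrow> card T \<le> N"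
    by (intro exI[of _ N] allI impI)
qed (use ang_self ang_commute in auto)

lemma dir_ultralimit:
  assumes "p \<in> M" "\<And>n. f n \<in> dirs p"
  obtains \<xi> where "\<xi> \<in> dirs p" "((\<lambda>n. dird p (f n) \<xi>) \<longlongrightarrow> 0) ultra"
  using geo.completion_ultralimit[OF precompact_geodesics[OF assms(1)], of f] assms(2)
  unfolding directions_def dir_dist_def by metis

end

section \<open>First variation\<close>

context alexandrov
begin

abbreviation mg :: "'a \<Rightarrow> 'a \<Rightarrow> (real \<Rightarrow> 'a) set" where "mg \<equiv> minimal_geodesics X"

lemma mgD:
  assumes "\<sigma> \<in> mg p q"
  shows "unit_speed_minimal X (d p q) \<sigma>" "\<sigma> 0 = p" "\<sigma> (d p q) = q"
  using assms by (simp_all add: minimal_geodesics_def)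

lemma mg_geodesic: "\<sigma> \<in> mg p q \<Longrightarrow> p \<in> M \<Longrightarrow> q \<in> M \<Longrightarrow> p \<noteq> q \<Longrightarrow> \<sigma> \<in> geodesics_from X p"
  using mgD[of \<sigma> p q] d_pos[of p q] unfolding geodesics_from_def by (simp add: exI[of _ "d p q"])

lemma geodesic_in_mg:
  assumes "unit_speed_minimal X l \<gamma>" "\<gamma> 0 = p" "0 \<le> t" "t \<le> l"
  shows "\<gamma> \<in> mg p (\<gamma> t)"
  using d_start[OF assms] assms unit_speed_minimal_le[OF assms(1,4)] by (simp add: minimal_geodesics_def)

text \<open>Hinge comparison in Euclidean form with error \<open>e\<close>. The radius serves all
  base points at once, since hinges will be based at moving nearest points.\<close>

definition angle_scale :: "real \<Rightarrow> real \<Rightarrow> bool" where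
  "angle_scale e \<rho> \<longleftrightarrow> \<rho> > 0 \<and> (\<forall>p \<gamma> \<sigma> l l' s t. unit_speed_minimal X l \<gamma> \<longrightarrow> \<gamma> 0 = p \<longrightarrow>
    unit_speed_minimal X l' \<sigma> \<longrightarrow> \<sigma> 0 = p \<longrightarrow> 0 < s \<longrightarrow> s \<le> l \<longrightarrow> s \<le> \<rho> \<longrightarrow> 0 < t \<longrightarrow> t \<le> l' \<longrightarrow> t \<le> \<rho> \<longrightarrow>
    cos (ang p \<gamma> \<sigma>) - e \<le> ecos s t (d (\<gamma> s) (\<sigma> t)))"

lemma angle_scaleD:
  assumes "angle_scale e \<rho>"
  shows "\<rho> > 0" "unit_speed_minimal X l \<gamma> \<Longrightarrow> \<gamma> 0 = p \<Longrightarrow> unit_speed_minimal X l' \<sigma> \<Longrightarrow> \<sigma> 0 = p \<Longrightarrow>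
    0 < s \<Longrightarrow> s \<le> l \<Longrightarrow> s \<le> \<rho> \<Longrightarrow> 0 < t \<Longrightarrow> t \<le> l' \<Longrightarrow> t \<le> \<rho> \<Longrightarrow> cos (ang p \<gamma> \<sigma>) - e \<le> ecos s t (d (\<gamma> s) (\<sigma> t))"
  by (rule assms[unfolded angle_scale_def, THEN conjunct1])
    (rule assms[unfolded angle_scale_def, THEN conjunct2, rule_format])

lemma angle_scale_exists:
  assumes e: "e > 0"
  obtains \<rho> where "angle_scale e \<rho>"
proof -
  obtain r where r: "r > 0" "\<forall>a b c. 0 < a \<and> 0 < b \<and> a \<le> r \<and> b \<le> r \<and> \<bar>a - b\<bar> \<le> c \<and> c \<le> a + b \<longrightarrow>
    \<bar>mcos k a b c - ecos a b c\<bar> \<le> e" using mcos_ecos_close[OF e, of k] by (elim exE conjE)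
  define \<rho> where "\<rho> = min r (R0 / 4)"
  have \<rho>: "\<rho> > 0" using r R0_pos by (simp add: \<rho>_def)
  have "cos (ang p \<gamma> \<sigma>) - e \<le> ecos s t (d (\<gamma> s) (\<sigma> t))"
    if \<gamma>: "unit_speed_minimal X l \<gamma>" "\<gamma> 0 = p" and \<sigma>: "unit_speed_minimal X l' \<sigma>" "\<sigma> 0 = p"
      and s: "0 < s" "s \<le> l" "s \<le> \<rho>" and t: "0 < t" "t \<le> l'" "t \<le> \<rho>" for p \<gamma> \<sigma> l l' s t
  proof -
    have M: "p \<in> M" "\<gamma> s \<in> M" "\<sigma> t \<in> M"
      using unit_speed_minimalD(1)[OF \<gamma>(1), of 0] unit_speed_minimalD(1)[OF \<gamma>(1), of s]
        unit_speed_minimalD(1)[OF \<sigma>(1), of t] \<gamma>(2) s t by auto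
    have "\<bar>s - t\<bar> \<le> d (\<gamma> s) (\<sigma> t)" "d (\<gamma> s) (\<sigma> t) \<le> s + t"
      using d_sides[OF M] d_start[OF \<gamma>, of s] d_start[OF \<sigma>, of t] s t by auto
    then have "\<bar>mcos k s t (d (\<gamma> s) (\<sigma> t)) - ecos s t (d (\<gamma> s) (\<sigma> t))\<bar> \<le> e"
      using s t by (intro r(2)[rule_format]) (simp add: \<rho>_def)
    moreover have "cos (ang p \<gamma> \<sigma>) \<le> mcos k s t (d (\<gamma> s) (\<sigma> t))"
      using s t by (intro cos_ang_le_mcos[OF \<gamma> \<sigma>]) (simp_all add: \<rho>_def)
    ultimately show ?thesis by linarith
  qed
  with \<rho> have "angle_scale e \<rho>" unfolding angle_scale_def by (intro conjI allI impI)
  then show ?thesis by (rule that)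
qed

lemma square_ecos:
  fixes s t D :: real
  assumes "0 < s" "0 < t" shows "D\<^sup>2 = s\<^sup>2 + t\<^sup>2 - 2 * s * t * ecos s t D"
  using assms by (simp add: field_simps)

text \<open>The upper half of the first variation formula, uniform in the vertex \<open>P\<close>
  once the side from \<open>P\<close> to \<open>R\<close> has length at least
  \<open>\<epsilon>\<close>.\<close>

definition hinge_scale :: "real \<Rightarrow> real \<Rightarrow> real \<Rightarrow> bool" where
  "hinge_scale e \<epsilon> \<rho> \<longleftrightarrow> \<rho> > 0 \<and> (\<forall>P R Q \<sigma> \<tau>. P \<in> M \<longrightarrow> R \<in> M \<longrightarrow> Q \<in> M \<longrightarrow> \<epsilon> \<le> d P R \<longrightarrow> 0 < d P Q \<longrightarrow> d P Q < \<rho> \<longrightarrow>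
    \<sigma> \<in> mg P R \<longrightarrow> \<tau> \<in> mg P Q \<longrightarrow> d R Q \<le> d R P - d P Q * (cos (ang P \<tau> \<sigma>) - e))"

lemma hinge_scaleD:
  assumes "hinge_scale e \<epsilon> \<rho>"
  shows "\<rho> > 0" "P \<in> M \<Longrightarrow> R \<in> M \<Longrightarrow> Q \<in> M \<Longrightarrow> \<epsilon> \<le> d P R \<Longrightarrow> 0 < d P Q \<Longrightarrow> d P Q < \<rho> \<Longrightarrow>
    \<sigma> \<in> mg P R \<Longrightarrow> \<tau> \<in> mg P Q \<Longrightarrow> d R Q \<le> d R P - d P Q * (cos (ang P \<tau> \<sigma>) - e)"
  by (rule assms[unfolded hinge_scale_def, THEN conjunct1])
    (rule assms[unfolded hinge_scale_def, THEN conjunct2, rule_format])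

lemma hinge_scale_exists:
  assumes e: "e > 0" and \<epsilon>: "\<epsilon> > 0"
  obtains \<rho> where "hinge_scale e \<epsilon> \<rho>"
proof -
  have "e / 2 > 0" using e by simp
  then obtain \<rho>0 where "angle_scale (e / 2) \<rho>0" by (rule angle_scale_exists)
  note \<rho>0 = angle_scaleD[OF this]
  define \<epsilon>' where "\<epsilon>' = min \<epsilon> \<rho>0"
  have \<epsilon>': "\<epsilon>' > 0" "\<epsilon>' \<le> \<epsilon>" "\<epsilon>' \<le> \<rho>0" using \<epsilon> \<rho>0(1) by (simp_all add: \<epsilon>'_def)
  define \<rho> where "\<rho> = min \<rho>0 (e * \<epsilon>')"
  have \<rho>: "\<rho> > 0" "\<rho> \<le> \<rho>0" "\<rho> \<le> e * \<epsilon>'" using \<rho>0(1) e \<epsilon>' by (simp_all add: \<rho>_def)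
  have "d R Q \<le> d R P - d P Q * (cos (ang P \<tau> \<sigma>) - e)"
    if M: "P \<in> M" "R \<in> M" "Q \<in> M" and PR: "\<epsilon> \<le> d P R" and PQ: "0 < d P Q" "d P Q < \<rho>"
      and \<sigma>: "\<sigma> \<in> mg P R" and \<tau>: "\<tau> \<in> mg P Q" for P R Q \<sigma> \<tau>
  proof -
    define b where "b = d P Q"
    define D where "D = d Q (\<sigma> \<epsilon>')"
    define E where "E = ecos b \<epsilon>' D"
    have b: "0 < b" "b \<le> \<rho>0" "b \<le> e * \<epsilon>'" using PQ \<rho> by (simp_all add: b_def)
    have \<tau>b: "\<tau> b = Q" using mgD(3)[OF \<tau>] by (simp add: b_def)
    have "cos (ang P \<tau> \<sigma>) - e / 2 \<le> ecos b \<epsilon>' (d (\<tau> b) (\<sigma> \<epsilon>'))"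
      by (rule \<rho>0(2)[OF mgD(1,2)[OF \<tau>] mgD(1,2)[OF \<sigma>]]) (use b \<epsilon>' PR in \<open>simp_all add: b_def\<close>)
    then have E: "cos (ang P \<tau> \<sigma>) - e / 2 \<le> E" by (simp add: E_def D_def \<tau>b)
    have D2: "D\<^sup>2 = b\<^sup>2 + \<epsilon>'\<^sup>2 - 2 * b * \<epsilon>' * E" unfolding E_def using b \<epsilon>' by (intro square_ecos) auto
    \<comment> \<open>Linearises the cosine law: the mean inequality bounds \<open>D\<close>, and
      the quadratic remainder \<open>b * b\<close> is at most \<open>b * (e * \<epsilon>')\<close>
      by the choice of \<open>\<rho>\<close>.\<close>
    have "0 \<le> (D - \<epsilon>')\<^sup>2" by simp
    then have "2 * \<epsilon>' * D \<le> D\<^sup>2 + \<epsilon>'\<^sup>2" by (simp add: power2_diff mult_ac)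
    also have "\<dots> = 2 * \<epsilon>' * (\<epsilon>' - b * E) + b * b" unfolding D2 by (simp add: power2_eq_square algebra_simps)
    also have "b * b \<le> b * (e * \<epsilon>')" using b by (intro mult_left_mono) auto
    finally have "2 * \<epsilon>' * D \<le> 2 * \<epsilon>' * (\<epsilon>' - b * (E - e / 2))" by (simp add: algebra_simps)
    then have D1: "D \<le> \<epsilon>' - b * (E - e / 2)" using \<epsilon>' by simp
    have "b * (cos (ang P \<tau> \<sigma>) - e) \<le> b * (E - e / 2)" using E b by (intro mult_left_mono) auto
    moreover have "\<sigma> \<epsilon>' \<in> M" using unit_speed_minimalD(1)[OF mgD(1)[OF \<sigma>], of \<epsilon>'] \<epsilon>' PR by simp
    moreover have "d (\<sigma> \<epsilon>') R = d P R - \<epsilon>'"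
      using unit_speed_minimalD(2)[OF mgD(1)[OF \<sigma>], of \<epsilon>' "d P R"] mgD(3)[OF \<sigma>] \<epsilon>' PR by simp
    ultimately have "d Q R \<le> d P R - b * (cos (ang P \<tau> \<sigma>) - e)"
      using d_tri[of Q "\<sigma> \<epsilon>'" R] M D1 by (simp add: D_def)
    then show ?thesis by (simp add: b_def mdist_commute)
  qed
  with \<rho>(1) have "hinge_scale e \<epsilon> \<rho>" unfolding hinge_scale_def by (intro conjI allI impI)
  then show ?thesis by (rule that)
qed

lemma tendsto_mcos:
  assumes "(u \<longlongrightarrow> a) F" "(w \<longlongrightarrow> c) F" "model_sin k t \<noteq> 0" "model_sin k a \<noteq> 0"
  shows "((\<lambda>n. mcos k t (u n) (w n)) \<longlongrightarrow> mcos k t a c) F"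
  unfolding mcos_def using assms
  by (intro tendsto_intros isCont_tendsto_compose[OF isCont_model_md] isCont_tendsto_compose[OF isCont_model_sin]) auto

text \<open>The lower half of the formula. \<open>\<sigma>\<close> is the limit of minimal geodesics
  from \<open>\<gamma> (t n)\<close> to \<open>r\<close>; the estimate concerns this one geodesic,
  not every geodesic from \<open>p\<close> to \<open>r\<close>.\<close>

lemma first_variation:
  assumes M: "p \<in> M" "r \<in> M" "p \<noteq> r" and \<gamma>: "unit_speed_minimal X l \<gamma>" "\<gamma> 0 = p"
    and t: "\<And>n. 0 < t n" "\<And>n. t n \<le> l" "t \<longlonglongrightarrow> 0"
  obtains \<sigma> where "\<sigma> \<in> mg p r" "\<And>e. e > 0 \<Longrightarrow> eventually (\<lambda>n. d r p - t n * (cos (ang p \<gamma> \<sigma>) + e) \<le> d r (\<gamma> (t n))) ultra"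
proof -
  have l: "l > 0" using t(1,2)[of 0] by linarith
  have \<gamma>G: "\<gamma> \<in> geodesics_from X p" using \<gamma> l by (auto simp: geodesics_from_def)
  define q where "q n = \<gamma> (t n)" for n
  define L where "L = d p r"
  define m where "m n = d (q n) r" for n
  have L: "L > 0" using d_pos M by (simp add: L_def)
  have qM: "q n \<in> M" and pq: "d p (q n) = t n" for n
    using unit_speed_minimalD(1)[OF \<gamma>(1), of "t n"] d_start[OF \<gamma>, of "t n"] t(1,2)[of n] by (simp_all add: q_def)
  have tU: "(t \<longlongrightarrow> 0) ultra" by (rule tendsto_ultraI[OF t(3)])
  have mL: "(m \<longlongrightarrow> L) ultra"
    unfolding m_def L_def by (rule d_tendsto) (use M qM pq tU in auto)
  have "\<forall>n. \<exists>\<alpha>. \<alpha> \<in> mg (q n) r" using minimal_geodesic_exists[OF qM M(2)] by auto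
  from choice[OF this] obtain \<alpha> where \<alpha>: "\<forall>n. \<alpha> n \<in> mg (q n) r" ..
  have au: "unit_speed_minimal X (m n) (\<alpha> n)" and a0: "\<alpha> n 0 = q n" and a1: "\<alpha> n (m n) = r" for n
    using mgD[of "\<alpha> n" "q n" r] \<alpha> by (simp_all add: m_def)
  \<comment> \<open>The geodesics have varying lengths \<open>m n\<close>. They rest at
    \<open>r\<close> after arriving, so that all are defined on \<open>{0..L}\<close>.\<close>
  define f where "f n s = \<alpha> n (min s (m n))" for n s
  have m0: "0 \<le> m n" for n by (simp add: m_def)
  have fM: "f n s \<in> M" if "0 \<le> s" for n s
    unfolding f_def using that m0[of n] by (intro unit_speed_minimalD(1)[OF au]) auto
  have fd: "d (f n s) (f n s') = \<bar>min s (m n) - min s' (m n)\<bar>" if "0 \<le> s" "0 \<le> s'" for n s s'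
    unfolding f_def using that m0[of n] by (intro unit_speed_minimalD(2)[OF au]) auto
  have f0: "f n 0 = q n" for n using a0 m0[of n] by (simp add: f_def)
  obtain \<sigma> where \<sigma>: "unit_speed_minimal X L \<sigma>" "\<And>s. s \<in> {0..L} \<Longrightarrow> ((\<lambda>n. d (\<sigma> s) (f n s)) \<longlongrightarrow> 0) ultra"
  proof (rule ultralimit_curve[of p L f "l + L"])
    fix n s assume s: "s \<in> {0..L}"
    have "d p (f n s) \<le> d p (q n) + d (f n 0) (f n s)" using d_tri[of p "q n" "f n s"] M qM fM s f0 by simp
    also have "\<dots> \<le> l + L" using pq t(2)[of n] fd[of 0 s n] s m0[of n] by auto
    finally show "d p (f n s) \<le> l + L" .
  next
    fix s s' assume s: "s \<in> {0..L}" "s' \<in> {0..L}"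
    have "((\<lambda>n. \<bar>min s (m n) - min s' (m n)\<bar>) \<longlongrightarrow> \<bar>min s L - min s' L\<bar>) ultra"
      by (intro tendsto_intros mL)
    then show "((\<lambda>n. d (f n s) (f n s')) \<longlongrightarrow> \<bar>s - s'\<bar>) ultra" using fd s by simp
  qed (use M fM in auto)
  have \<sigma>M: "\<sigma> s \<in> M" if "s \<in> {0..L}" for s using unit_speed_minimalD(1)[OF \<sigma>(1)] that by simp
  have \<sigma>lim: "((\<lambda>n. d x (f n s)) \<longlongrightarrow> d x (\<sigma> s)) ultra" if "x \<in> M" "s \<in> {0..L}" for x s
    by (rule d_tendsto[OF that(1) \<sigma>M[OF that(2)]]) (use that fM \<sigma> in auto)
  have "d p (\<sigma> 0) = 0"
    by (rule tendsto_unique[OF ultra_neq_bot \<sigma>lim]) (use M L f0 pq tU in auto)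
  then have \<sigma>0: "\<sigma> 0 = p" using M \<sigma>M[of 0] L by simp
  have "d r (\<sigma> L) = 0"
  proof (rule tendsto_unique[OF ultra_neq_bot \<sigma>lim])
    have "d r (f n L) = \<bar>m n - min L (m n)\<bar>" for n
      using fd[of "m n" L n] m0[of n] L a1 by (simp add: f_def)
    moreover have "((\<lambda>n. \<bar>m n - min L (m n)\<bar>) \<longlongrightarrow> \<bar>L - min L L\<bar>) ultra" by (intro tendsto_intros mL)
    ultimately show "((\<lambda>n. d r (f n L)) \<longlongrightarrow> 0) ultra" by simp
  qed (use M L in auto)
  then have "\<sigma> L = r" using M \<sigma>M[of L] L by simp
  with \<sigma> \<sigma>0 have \<sigma>mg: "\<sigma> \<in> mg p r" by (simp add: minimal_geodesics_def L_def)
  have \<sigma>G: "\<sigma> \<in> geodesics_from X p" using mg_geodesic[OF \<sigma>mg M] .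
  have "eventually (\<lambda>n. d r p - t n * (cos (ang p \<gamma> \<sigma>) + e) \<le> d r (\<gamma> (t n))) ultra" if e: "e > 0" for e
  proof -
    define c where "c = cos (ang p \<gamma> \<sigma>)"
    have e3: "e / 3 > 0" using e by simp
    obtain \<rho> where \<rho>: "\<rho> > 0" "\<forall>a b c. 0 < a \<and> 0 < b \<and> a \<le> \<rho> \<and> b \<le> \<rho> \<and> \<bar>a - b\<bar> \<le> c \<and> c \<le> a + b \<longrightarrow>
      \<bar>mcos k a b c - ecos a b c\<bar> \<le> e / 3" using mcos_ecos_close[OF e3, of k] by (elim exE conjE)
    have "\<exists>b>0. \<forall>s. 0 < s \<and> s \<le> b \<longrightarrow> mcos k s s (d (\<gamma> s) (\<sigma> s)) < c + e / 3"
    proof (rule angle_aux[OF \<gamma>G \<sigma>G])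
      fix A assume A: "-1 \<le> A" "A \<le> 1" "ang p \<gamma> \<sigma> = arccos A"
        "((\<lambda>(s, t). mcos k s t (d (\<gamma> s) (\<sigma> t))) \<longlongrightarrow> A) (at_right 0 \<times>\<^sub>F at_right 0)"
      have "c = A" using A by (simp add: c_def)
      have "((\<lambda>s. mcos k s s (d (\<gamma> s) (\<sigma> s))) \<longlongrightarrow> A) (at_right 0)"
        using filterlim_compose[OF A(4) filterlim_Pair[OF filterlim_ident_at_right filterlim_ident_at_right]] by simp
      then have "eventually (\<lambda>s. mcos k s s (d (\<gamma> s) (\<sigma> s)) < c + e / 3) (at_right 0)"
        by (rule order_tendstoD(2)) (use e3 \<open>c = A\<close> in simp)
      then obtain b where b: "b > 0" "\<forall>y>0. y < b \<longrightarrow> mcos k y y (d (\<gamma> y) (\<sigma> y)) < c + e / 3"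
        unfolding eventually_at_right_field by (elim exE conjE)
      then show ?thesis by (intro exI[of _ "b / 2"]) auto
    qed
    then obtain b where b: "b > 0" "\<forall>s. 0 < s \<and> s \<le> b \<longrightarrow> mcos k s s (d (\<gamma> s) (\<sigma> s)) < c + e / 3" by (elim exE conjE)
    define \<epsilon> where "\<epsilon> = min (min b (L / 2)) (min l (min (\<rho> / 2) (R0 / 8)))"
    have \<epsilon>: "0 < \<epsilon>" "\<epsilon> \<le> b" "\<epsilon> \<le> L / 2" "\<epsilon> \<le> l" "\<epsilon> \<le> \<rho> / 2" "\<epsilon> \<le> R0 / 8"
      using b L l \<rho> R0_pos by (simp_all add: \<epsilon>_def)
    have \<epsilon>L: "\<epsilon> \<in> {0..L}" using \<epsilon> L by simp
    have pe: "d p (\<sigma> \<epsilon>) = \<epsilon>" using d_start[OF \<sigma>(1) \<sigma>0, of \<epsilon>] \<epsilon>L by simp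
    have \<gamma>\<epsilon>: "\<gamma> \<epsilon> \<in> M" using unit_speed_minimalD(1)[OF \<gamma>(1), of \<epsilon>] \<epsilon> by simp
    have lim1: "((\<lambda>n. d p (f n \<epsilon>)) \<longlongrightarrow> \<epsilon>) ultra" using \<sigma>lim[OF M(1) \<epsilon>L] pe by simp
    have lim2: "((\<lambda>n. d (\<gamma> \<epsilon>) (f n \<epsilon>)) \<longlongrightarrow> d (\<gamma> \<epsilon>) (\<sigma> \<epsilon>)) ultra" using \<sigma>lim[OF \<gamma>\<epsilon> \<epsilon>L] .
    have se: "model_sin k \<epsilon> \<noteq> 0" using good_sin_pos[OF good_R0, of \<epsilon>] \<epsilon> R0_pos by simp
    have "mcos k \<epsilon> \<epsilon> (d (\<gamma> \<epsilon>) (\<sigma> \<epsilon>)) < c + e / 3" using b(2) \<epsilon> by simp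
    then have ev1: "eventually (\<lambda>n. mcos k \<epsilon> (d p (f n \<epsilon>)) (d (\<gamma> \<epsilon>) (f n \<epsilon>)) < c + e / 3) ultra"
      by (rule order_tendstoD(2)[OF tendsto_mcos[OF lim1 lim2 se se]])
    have ev2: "eventually (\<lambda>n. 0 < d p (f n \<epsilon>)) ultra" "eventually (\<lambda>n. d p (f n \<epsilon>) < 2 * \<epsilon>) ultra"
      using order_tendstoD[OF lim1] \<epsilon> by simp_all
    have ev3: "eventually (\<lambda>n. \<epsilon> < m n) ultra" using order_tendstoD(1)[OF mL] \<epsilon> L by simp
    have ev4: "eventually (\<lambda>n. t n < \<epsilon>) ultra" using order_tendstoD(2)[OF tU] \<epsilon> by simp
    show ?thesis using ev1 ev2 ev3 ev4
    proof eventually_elim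
      case (elim n)
      define x where "x = f n \<epsilon>"
      define D where "D = d p x"
      define E where "E = ecos (t n) D (d (q n) x)"
      have x: "x \<in> M" using fM \<epsilon> by (simp add: x_def)
      have D: "0 < D" "D \<le> R0 / 4" "D \<le> \<rho>" using elim \<epsilon> by (auto simp: D_def x_def)
      have xp: "x \<noteq> p" using D M by (auto simp: D_def)
      have qx: "d (q n) x = \<epsilon>" using fd[of 0 \<epsilon> n] f0 elim \<epsilon> m0[of n] by (simp add: x_def)
      have xr: "d x r = m n - \<epsilon>" using fd[of \<epsilon> "m n" n] elim \<epsilon> m0[of n] a1 by (simp add: x_def f_def)
      \<comment> \<open>The cosine bound at scale \<open>\<epsilon>\<close> reached \<open>x\<close>
        from \<open>\<sigma> \<epsilon>\<close> by continuity; it descends to scale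
        \<open>t n\<close> because cosines decrease towards \<open>p\<close>.\<close>
      have "mcos k (t n) D (d (q n) x) \<le> mcos k \<epsilon> D (d (\<gamma> \<epsilon>) x)"
        unfolding D_def q_def
        by (rule geodesic_mcos_mono[OF \<gamma>]) (use t(1)[of n] elim \<epsilon> R0_pos x xp D in \<open>auto simp: D_def\<close>)
      also have "\<dots> < c + e / 3" using elim by (simp add: D_def x_def)
      finally have "mcos k (t n) D (d (q n) x) < c + e / 3" .
      moreover have "\<bar>mcos k (t n) D (d (q n) x) - ecos (t n) D (d (q n) x)\<bar> \<le> e / 3"
        using d_sides[OF M(1) qM[of n] x] pq[of n] t(1)[of n] D elim \<epsilon>
        by (intro \<rho>(2)[rule_format]) (auto simp: D_def)
      ultimately have E: "E \<le> c + e" using e unfolding E_def by linarith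
      \<comment> \<open>In the triangle \<open>p\<close>, \<open>q n\<close>, \<open>x\<close> the
        side opposite \<open>p\<close> is exactly \<open>\<epsilon>\<close>, so \<open>D\<close>
        exceeds it by at most the projection \<open>t n * E\<close>.\<close>
      have "\<epsilon>\<^sup>2 = (t n)\<^sup>2 + D\<^sup>2 - 2 * t n * D * E"
        unfolding E_def qx using t(1)[of n] D by (intro square_ecos) auto
      then have "(D - t n * E)\<^sup>2 = \<epsilon>\<^sup>2 - (t n)\<^sup>2 * (1 - E\<^sup>2)"
        by (simp add: power2_eq_square algebra_simps)
      moreover have "E\<^sup>2 \<le> 1"
      proof -
        have "-1 \<le> E" "E \<le> 1"
          using ecos_bounds[of "t n" D "d (q n) x"] d_sides[OF M(1) qM[of n] x] pq[of n] t(1)[of n] D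
          by (auto simp: E_def D_def)
        then show ?thesis by (simp add: abs_square_le_1 abs_le_iff)
      qed
      then have "0 \<le> (t n)\<^sup>2 * (1 - E\<^sup>2)" by simp
      ultimately have "(D - t n * E)\<^sup>2 \<le> \<epsilon>\<^sup>2" by linarith
      then have "D - t n * E \<le> \<epsilon>" by (rule power2_le_imp_le) (use \<epsilon> in simp)
      moreover have "t n * E \<le> t n * (c + e)" using E t(1)[of n] by (intro mult_left_mono) auto
      moreover have "d p r \<le> D + d x r" unfolding D_def using d_tri M x by blast
      ultimately have "d p r - t n * (c + e) \<le> m n" using xr by linarith
      then show ?case by (simp add: c_def m_def q_def mdist_commute)
    qed
  qed
  with \<sigma>mg show ?thesis by (rule that)
qed

section \<open>Limits of directions\<close>

lemma eventually_ang_less: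
  assumes G: "\<And>n. \<tau> n \<in> geodesics_from X p" "\<rho> \<in> geodesics_from X p" and \<xi>: "\<xi> \<in> dirs p"
    and lim: "((\<lambda>n. dird p (dir p (\<tau> n)) \<xi>) \<longlongrightarrow> 0) F" and e: "dird p \<xi> (dir p \<rho>) < e"
  shows "eventually (\<lambda>n. ang p (\<tau> n) \<rho> < e) F"
proof -
  have "((\<lambda>n. dird p (dir p (\<tau> n)) \<xi> + dird p \<xi> (dir p \<rho>)) \<longlongrightarrow> 0 + dird p \<xi> (dir p \<rho>)) F"
    by (intro tendsto_intros lim)
  then have "eventually (\<lambda>n. dird p (dir p (\<tau> n)) \<xi> + dird p \<xi> (dir p \<rho>) < e) F"
    using e by (intro order_tendstoD(2)) auto
  then show ?thesis
  proof eventually_elim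
    case (elim n)
    have "ang p (\<tau> n) \<rho> = dird p (dir p (\<tau> n)) (dir p \<rho>)" using G by (simp add: dird_dir)
    also have "\<dots> \<le> dird p (dir p (\<tau> n)) \<xi> + dird p \<xi> (dir p \<rho>)"
      using G \<xi> dir_in by (intro dird_triangle) auto
    finally show ?case using elim by simp
  qed
qed

text \<open>Pointwise convergence of geodesics alone does not control initial directions. A geodesic
  \<open>\<rho>\<close> with direction near the limit \<open>\<xi>\<close> of the directions stays
  relatively close to most \<open>\<sigma> n\<close> at a scale independent of \<open>n\<close>,
  hence also to \<open>\<sigma>'\<close>, which identifies the direction of \<open>\<sigma>'\<close>
  with \<open>\<xi>\<close>.\<close>

lemma mg_ultralimit:
  assumes M: "p \<in> M" "r \<in> M" "p \<noteq> r" and \<sigma>: "\<And>n. \<sigma> n \<in> mg p r"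
  obtains \<sigma>' where "\<sigma>' \<in> mg p r" "((\<lambda>n. dird p (dir p (\<sigma> n)) (dir p \<sigma>')) \<longlongrightarrow> 0) ultra"
proof -
  define L where "L = d p r"
  have L: "L > 0" using d_pos M by (simp add: L_def)
  have \<sigma>u: "unit_speed_minimal X L (\<sigma> n)" "\<sigma> n 0 = p" "\<sigma> n L = r" for n using mgD[OF \<sigma>] by (simp_all add: L_def)
  have \<sigma>G: "\<sigma> n \<in> geodesics_from X p" for n using mg_geodesic[OF \<sigma> M] .
  have \<sigma>M: "\<sigma> n t \<in> M" "d p (\<sigma> n t) = t" if "t \<in> {0..L}" for n t
    using unit_speed_minimalD(1)[OF \<sigma>u(1)] d_start[OF \<sigma>u(1,2)] that by simp_all
  obtain \<sigma>' where \<sigma>': "unit_speed_minimal X L \<sigma>'" "\<And>t. t \<in> {0..L} \<Longrightarrow> ((\<lambda>n. d (\<sigma>' t) (\<sigma> n t)) \<longlongrightarrow> 0) ultra"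
  proof (rule ultralimit_curve[of p L \<sigma> L])
    fix s t assume "s \<in> {0..L}" "t \<in> {0..L}"
    then show "((\<lambda>n. d (\<sigma> n s) (\<sigma> n t)) \<longlongrightarrow> \<bar>s - t\<bar>) ultra"
      using unit_speed_minimalD(2)[OF \<sigma>u(1)] by simp
  qed (use M \<sigma>M in auto)
  have \<sigma>'M: "\<sigma>' t \<in> M" if "t \<in> {0..L}" for t using unit_speed_minimalD(1)[OF \<sigma>'(1)] that by simp
  have "d (\<sigma>' 0) p = 0" "d (\<sigma>' L) r = 0"
    using \<sigma>'(2)[of 0] \<sigma>'(2)[of L] \<sigma>u(2,3) L by (auto simp: tendsto_const_iff)
  then have ends: "\<sigma>' 0 = p" "\<sigma>' L = r" using M \<sigma>'M[of 0] \<sigma>'M[of L] L by simp_all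
  with ends \<sigma>'(1) have mg: "\<sigma>' \<in> mg p r" by (simp add: minimal_geodesics_def L_def)
  have G: "\<sigma>' \<in> geodesics_from X p" using mg_geodesic[OF mg M] .
  obtain \<xi> where \<xi>: "\<xi> \<in> dirs p" "((\<lambda>n. dird p (dir p (\<sigma> n)) \<xi>) \<longlongrightarrow> 0) ultra"
    by (rule dir_ultralimit[OF M(1), of "\<lambda>n. dir p (\<sigma> n)"]) (use dir_in \<sigma>G in auto)
  have step: "cos e - 2 * e \<le> cos (dird p \<xi> (dir p \<sigma>'))" if e: "0 < e" "e \<le> pi" for e
  proof -
    obtain \<rho> where \<rho>: "\<rho> \<in> geodesics_from X p" "dird p \<xi> (dir p \<rho>) < e" by (rule dir_dense[OF \<xi>(1) e(1)])
    obtain l where l: "l > 0" "unit_speed_minimal X l \<rho>" "\<rho> 0 = p" using \<rho>(1) by (auto simp: geodesics_from_def)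
    have ev: "eventually (\<lambda>n. ang p (\<sigma> n) \<rho> < e) ultra"
      by (rule eventually_ang_less[OF \<sigma>G \<rho>(1) \<xi> \<rho>(2)])
    obtain \<epsilon> where "angle_scale e \<epsilon>" by (rule angle_scale_exists[OF e(1)])
    note \<epsilon> = angle_scaleD[OF this]
    define b where "b = min (min L l) \<epsilon>"
    have b: "b > 0" "b \<le> L" "b \<le> l" "b \<le> \<epsilon>" using L l \<epsilon>(1) by (auto simp: b_def)
    have "cos e - e \<le> ecos s s (d (\<sigma>' s) (\<rho> s))" if s: "0 < s" "s \<le> b" for s
    proof (rule tendsto_lowerbound)
      have sL: "s \<in> {0..L}" using s b by simp
      have "((\<lambda>n. d (\<sigma> n s) (\<rho> s)) \<longlongrightarrow> d (\<sigma>' s) (\<rho> s)) ultra"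
        by (rule d_tendsto) (use \<sigma>'(2) \<sigma>'M \<sigma>M sL unit_speed_minimalD(1)[OF l(2), of s] s b in auto)
      then show "((\<lambda>n. ecos s s (d (\<sigma> n s) (\<rho> s))) \<longlongrightarrow> ecos s s (d (\<sigma>' s) (\<rho> s))) ultra"
        using s by (intro tendsto_intros) auto
      show "eventually (\<lambda>n. cos e - e \<le> ecos s s (d (\<sigma> n s) (\<rho> s))) ultra"
        using ev
      proof eventually_elim
        case (elim n)
        have "cos e \<le> cos (ang p (\<sigma> n) \<rho>)"
          using elim e ang_bounds[OF \<sigma>G \<rho>(1)] by (intro cos_monotone_0_pi_le) auto
        moreover have "cos (ang p (\<sigma> n) \<rho>) - e \<le> ecos s s (d (\<sigma> n s) (\<rho> s))"
          by (rule \<epsilon>(2)[OF \<sigma>u(1,2) l(2,3)]) (use s b in auto)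
        ultimately show ?case by linarith
      qed
    qed simp
    then have "cos e - e \<le> cos (ang p \<sigma>' \<rho>)"
      by (intro tendsto_lowerbound[OF ecos_tendsto_cos_ang[OF G \<rho>(1) filterlim_ident_at_right filterlim_ident_at_right]
           eventually_mono[OF eventually_at_right_0_le[OF b(1)]]]) auto
    moreover have "\<bar>cos (dird p \<xi> (dir p \<sigma>')) - cos (ang p \<sigma>' \<rho>)\<bar> \<le> e"
    proof -
      have "dird p \<xi> (dir p \<sigma>') \<le> dird p \<xi> (dir p \<rho>) + dird p (dir p \<rho>) (dir p \<sigma>')"
        "dird p (dir p \<rho>) (dir p \<sigma>') \<le> dird p (dir p \<rho>) \<xi> + dird p \<xi> (dir p \<sigma>')"
        using \<xi>(1) dir_in G \<rho>(1) by (auto intro: dird_triangle)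
      then have "\<bar>dird p \<xi> (dir p \<sigma>') - ang p \<sigma>' \<rho>\<bar> \<le> e"
        using \<rho> dird_dir[OF \<rho>(1) G] ang_commute[OF \<rho>(1) G] dird_commute[OF \<xi>(1) dir_in[OF \<rho>(1)]] by linarith
      with abs_cos_diff_le show ?thesis by (rule order_trans)
    qed
    ultimately show ?thesis by linarith
  qed
  have "((\<lambda>e. cos e - 2 * e) \<longlongrightarrow> cos 0 - 2 * 0) (at_right (0::real))" by (intro tendsto_intros)
  then have "cos 0 - 2 * 0 \<le> cos (dird p \<xi> (dir p \<sigma>'))"
    by (rule tendsto_upperbound) (use eventually_mono[OF eventually_at_right_0_le[OF pi_gt_zero]] step in auto)
  then have "cos (dird p \<xi> (dir p \<sigma>')) = cos 0" by (simp add: antisym)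
  then have zero: "dird p \<xi> (dir p \<sigma>') = 0"
    by (rule cos_inj_0_pi[rotated 4]) (use dird_nonneg dird_le_pi \<xi>(1) dir_in[OF G] in auto)
  have "((\<lambda>n. dird p (dir p (\<sigma> n)) (dir p \<sigma>')) \<longlongrightarrow> 0) ultra"
  proof (rule tendsto_sandwich[OF _ _ tendsto_const \<xi>(2)])
    show "eventually (\<lambda>n. 0 \<le> dird p (dir p (\<sigma> n)) (dir p \<sigma>')) ultra"
      using dird_nonneg dir_in \<sigma>G G by auto
    show "eventually (\<lambda>n. dird p (dir p (\<sigma> n)) (dir p \<sigma>') \<le> dird p (dir p (\<sigma> n)) \<xi>) ultra"
    proof (intro always_eventually allI)
      fix n show "dird p (dir p (\<sigma> n)) (dir p \<sigma>') \<le> dird p (dir p (\<sigma> n)) \<xi>"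
        using dird_triangle[OF dir_in[OF \<sigma>G[of n]] \<xi>(1) dir_in[OF G]] zero by simp
    qed
  qed
  with mg show ?thesis by (rule that)
qed

text \<open>Both geodesics end at the same \<open>x n\<close>, at distance \<open>b n\<close> from
  \<open>p\<close>. Geodesics approximating the two limit directions are, at parameter
  \<open>b n\<close>, close to \<open>x n\<close> relative to \<open>b n\<close>, hence close to
  each other.\<close>

lemma same_direction:
  assumes M: "p \<in> M" "\<And>n. x n \<in> M" "\<And>n. x n \<noteq> p" and lim: "((\<lambda>n. d p (x n)) \<longlongrightarrow> 0) ultra"
    and \<tau>: "\<And>n. \<tau> n \<in> mg p (x n)" "\<xi> \<in> dirs p" "((\<lambda>n. dird p (dir p (\<tau> n)) \<xi>) \<longlongrightarrow> 0) ultra"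
    and \<sigma>: "\<And>n. \<sigma> n \<in> mg p (x n)" "\<xi>' \<in> dirs p" "((\<lambda>n. dird p (dir p (\<sigma> n)) \<xi>') \<longlongrightarrow> 0) ultra"
  shows "dird p \<xi> \<xi>' = 0"
proof -
  define b where "b n = d p (x n)" for n
  have b: "0 < b n" for n using d_pos[OF M(1) M(2)] M(3)[of n] by (simp add: b_def)
  have "b = (\<lambda>n. d p (x n))" by (simp add: b_def fun_eq_iff)
  with lim have bU: "(b \<longlongrightarrow> 0) ultra" by (simp only:)
  have bR: "filterlim b (at_right 0) ultra"
    using bU b unfolding filterlim_at by (simp add: less_imp_neq[symmetric])
  have near: "eventually (\<lambda>n. (d (x n) (\<rho> (b n)))\<^sup>2 \<le> 2 * (b n)\<^sup>2 * (1 - cos e + e)) ultra"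
    if e: "0 < e" "e \<le> pi" and \<rho>: "\<rho> \<in> geodesics_from X p" "dird p \<zeta> (dir p \<rho>) < e"
      and \<alpha>: "\<And>n. \<alpha> n \<in> mg p (x n)" "\<zeta> \<in> dirs p" "((\<lambda>n. dird p (dir p (\<alpha> n)) \<zeta>) \<longlongrightarrow> 0) ultra"
    for e \<rho> \<zeta> \<alpha>
  proof -
    obtain l where l: "l > 0" "unit_speed_minimal X l \<rho>" "\<rho> 0 = p" using \<rho>(1) by (auto simp: geodesics_from_def)
    have \<alpha>G: "\<alpha> n \<in> geodesics_from X p" for n using mg_geodesic[OF \<alpha>(1) M(1,2)] M(3)[of n] by metis
    have ev: "eventually (\<lambda>n. ang p (\<alpha> n) \<rho> < e) ultra"
      by (rule eventually_ang_less[OF \<alpha>G \<rho>(1) \<alpha>(2,3) \<rho>(2)])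
    obtain \<epsilon> where "angle_scale e \<epsilon>" by (rule angle_scale_exists[OF e(1)])
    note \<epsilon> = angle_scaleD[OF this]
    have "min l \<epsilon> > 0" using l \<epsilon>(1) by simp
    then have ev2: "eventually (\<lambda>n. b n < min l \<epsilon>) ultra" by (rule order_tendstoD(2)[OF bU])
    show ?thesis using ev ev2
    proof eventually_elim
      case (elim n)
      note u = mgD[OF \<alpha>(1)[of n], folded b_def]
      have "cos e \<le> cos (ang p (\<alpha> n) \<rho>)"
        using elim e ang_bounds[OF \<alpha>G \<rho>(1)] by (intro cos_monotone_0_pi_le) auto
      moreover have "cos (ang p (\<alpha> n) \<rho>) - e \<le> ecos (b n) (b n) (d (\<alpha> n (b n)) (\<rho> (b n)))"
        by (rule \<epsilon>(2)[OF u(1,2) l(2,3)]) (use elim b[of n] in auto)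
      ultimately have "cos e - e \<le> ecos (b n) (b n) (d (x n) (\<rho> (b n)))" using u(3) by simp
      then have "2 * (b n)\<^sup>2 * (cos e - e) \<le> 2 * (b n)\<^sup>2 * ecos (b n) (b n) (d (x n) (\<rho> (b n)))"
        by (intro mult_left_mono) auto
      moreover have "(d (x n) (\<rho> (b n)))\<^sup>2 = (b n)\<^sup>2 + (b n)\<^sup>2 - 2 * b n * b n * ecos (b n) (b n) (d (x n) (\<rho> (b n)))"
        using b[of n] by (intro square_ecos) auto
      ultimately show ?case by (simp add: power2_eq_square algebra_simps)
    qed
  qed
  have step: "1 - 4 * (1 - cos e + e) - 2 * e \<le> cos (dird p \<xi> \<xi>')" if e: "0 < e" "e \<le> pi" for e
  proof -
    obtain \<rho> where \<rho>: "\<rho> \<in> geodesics_from X p" "dird p \<xi> (dir p \<rho>) < e" by (rule dir_dense[OF \<tau>(2) e(1)])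
    obtain \<rho>' where \<rho>': "\<rho>' \<in> geodesics_from X p" "dird p \<xi>' (dir p \<rho>') < e" by (rule dir_dense[OF \<sigma>(2) e(1)])
    obtain l where l: "l > 0" "unit_speed_minimal X l \<rho>" "\<rho> 0 = p" using \<rho>(1) by (auto simp: geodesics_from_def)
    obtain l' where l': "l' > 0" "unit_speed_minimal X l' \<rho>'" "\<rho>' 0 = p" using \<rho>'(1) by (auto simp: geodesics_from_def)
    define K where "K = 1 - cos e + e"
    have K: "K \<ge> 0" using cos_le_one[of e] e unfolding K_def by linarith
    have "min l l' > 0" using l l' by simp
    then have ev: "eventually (\<lambda>n. b n < min l l') ultra" by (rule order_tendstoD(2)[OF bU])
    have "1 - 4 * K \<le> cos (ang p \<rho> \<rho>')"
    proof (rule tendsto_lowerbound[OF ecos_tendsto_cos_ang[OF \<rho>(1) \<rho>'(1) bR bR]])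
      show "eventually (\<lambda>n. 1 - 4 * K \<le> ecos (b n) (b n) (d (\<rho> (b n)) (\<rho>' (b n)))) ultra"
        using near[OF e \<rho> \<tau>] near[OF e \<rho>' \<sigma>] ev
      proof eventually_elim
        case (elim n)
        define B where "B = b n"
        have B: "B > 0" using b by (simp add: B_def)
        define y where "y = d (x n) (\<rho> B)"
        define z where "z = d (x n) (\<rho>' B)"
        define w where "w = d (\<rho> B) (\<rho>' B)"
        have "\<rho> B \<in> M" "\<rho>' B \<in> M"
          using unit_speed_minimalD(1)[OF l(2), of B] unit_speed_minimalD(1)[OF l'(2), of B] elim B by (simp_all add: B_def)
        then have "w \<le> y + z" using d_sides(2)[of "x n" "\<rho> B" "\<rho>' B"] M(2) by (simp add: w_def y_def z_def)
        then have "w\<^sup>2 \<le> (y + z)\<^sup>2" by (intro power_mono) (auto simp: w_def)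
        moreover have "0 \<le> (y - z)\<^sup>2" by simp
        moreover have "(y + z)\<^sup>2 = 2 * y\<^sup>2 + 2 * z\<^sup>2 - (y - z)\<^sup>2" by (simp add: power2_eq_square algebra_simps)
        moreover have "y\<^sup>2 \<le> 2 * B\<^sup>2 * K" "z\<^sup>2 \<le> 2 * B\<^sup>2 * K" using elim by (simp_all add: y_def z_def B_def K_def)
        ultimately have "w\<^sup>2 \<le> 8 * (B\<^sup>2 * K)" by linarith
        then have "(1 - 4 * K) * (2 * B * B) \<le> B\<^sup>2 + B\<^sup>2 - w\<^sup>2" by (simp add: power2_eq_square algebra_simps)
        then show ?case using B unfolding B_def[symmetric] w_def[symmetric] by (subst pos_le_divide_eq) auto
      qed
    qed simp
    moreover have "\<bar>cos (dird p \<xi> \<xi>') - cos (ang p \<rho> \<rho>')\<bar> \<le> 2 * e"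
    proof -
      note D = dir_in[OF \<rho>(1)] dir_in[OF \<rho>'(1)]
      have "dird p \<xi> \<xi>' \<le> dird p \<xi> (dir p \<rho>) + dird p (dir p \<rho>) \<xi>'"
        "dird p (dir p \<rho>) \<xi>' \<le> dird p (dir p \<rho>) (dir p \<rho>') + dird p (dir p \<rho>') \<xi>'"
        "dird p (dir p \<rho>) (dir p \<rho>') \<le> dird p (dir p \<rho>) \<xi> + dird p \<xi> (dir p \<rho>')"
        "dird p \<xi> (dir p \<rho>') \<le> dird p \<xi> \<xi>' + dird p \<xi>' (dir p \<rho>')"
        using \<tau>(2) \<sigma>(2) D by (auto intro: dird_triangle)
      then have "\<bar>dird p \<xi> \<xi>' - ang p \<rho> \<rho>'\<bar> \<le> 2 * e"
        using \<rho>(2) \<rho>'(2) dird_dir[OF \<rho>(1) \<rho>'(1)] dird_commute[OF \<tau>(2) D(1)] dird_commute[OF \<sigma>(2) D(2)] by linarith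
      with abs_cos_diff_le show ?thesis by (rule order_trans)
    qed
    ultimately show ?thesis unfolding K_def by linarith
  qed
  have "((\<lambda>e. 1 - 4 * (1 - cos e + e) - 2 * e) \<longlongrightarrow> 1 - 4 * (1 - cos 0 + 0) - 2 * 0) (at_right (0::real))"
    by (intro tendsto_intros)
  then have "1 - 4 * (1 - cos 0 + 0) - 2 * 0 \<le> cos (dird p \<xi> \<xi>')"
    by (rule tendsto_upperbound) (use eventually_mono[OF eventually_at_right_0_le[OF pi_gt_zero]] step in auto)
  then have "cos (dird p \<xi> \<xi>') = cos 0" by (simp add: antisym)
  then show ?thesis
    by (rule cos_inj_0_pi[rotated 4]) (use dird_nonneg dird_le_pi \<tau>(2) \<sigma>(2) in auto)
qed

text \<open>Since \<open>\<gamma>\<close> continues past \<open>t\<close>, both arcs can be viewed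
  from \<open>x = \<gamma> l\<close> as prolongations of the segment from \<open>x\<close> to
  \<open>q\<close>. The comparison angle at \<open>x\<close> is 0 at \<open>q\<close> and cannot
  increase farther out.\<close>

lemma no_branching:
  assumes \<gamma>: "unit_speed_minimal X l \<gamma>" "\<gamma> 0 = p" and t: "0 < t" "t < l" "l \<le> R0 / 4"
    and \<tau>: "\<tau> \<in> mg p (\<gamma> t)" and s: "0 \<le> s" "s \<le> t"
  shows "\<tau> s = \<gamma> s"
proof (cases "s = t")
  case True
  then show ?thesis using mgD(3)[OF \<tau>] d_start[OF \<gamma>, of t] t by simp
next
  case False
  define x where "x = \<gamma> l"
  define q where "q = \<gamma> t"
  define A where "A = \<gamma> s"
  define B where "B = \<tau> s"
  have st: "s < t" using s False by simp
  have pq: "d p q = t" using d_start[OF \<gamma>, of t] t by (simp add: q_def)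
  note \<tau>u = mgD[OF \<tau>, folded q_def, unfolded pq]
  note g = unit_speed_minimalD[OF \<gamma>(1)] and h = unit_speed_minimalD[OF \<tau>u(1)]
  have M: "x \<in> M" "q \<in> M" "A \<in> M" "B \<in> M" "p \<in> M"
    using g(1)[of l] g(1)[of t] g(1)[of s] g(1)[of 0] h(1)[of s] \<gamma>(2) t s by (simp_all add: x_def q_def A_def B_def)
  have D: "d x q = l - t" "d q A = t - s" "d x A = l - s" "d q B = t - s" "d p B = s" "d p x = l"
    using g(2)[of l t] g(2)[of t s] g(2)[of l s] h(2)[of t s] d_start[OF \<tau>u(1,2), of s] d_start[OF \<gamma>, of l] \<tau>u(3) t s
    by (simp_all add: x_def q_def A_def B_def)
  have xB: "d x B = l - s"
    using d_tri[of x q B] d_tri[of p B x] M D by (simp add: mdist_commute)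
  have ne: "x \<noteq> q" "x \<noteq> A" using D t st M by auto
  have S: "model_sin k (l - t) > 0" "model_sin k (l - s) > 0"
    using good_sin_pos[OF good_R0] t s st R0_pos by simp_all
  have "mcos k (l - t) (l - t) 0 = 1"
    using mcos_law(1)[of k "l - t" "l - t" 0] S by simp
  moreover have "mcos k (l - t) (l - t) (d q q) \<le> mcos k (l - s) (l - t) (d A q)"
    using between_mcos_mono[of x A q q] M ne D t s by simp
  moreover have "mcos k (l - t) (l - s) (d q A) \<le> mcos k (l - s) (l - s) (d B A)"
    using between_mcos_mono[of x B q A] M ne D xB t s by simp
  ultimately have 1: "1 \<le> mcos k (l - s) (l - s) (d B A)"
    using M by (simp add: mdist_commute[of X A q] mcos_commute[of k "l - s" "l - t"])
  have "model_md k (d B A) = model_sin k (l - s) * model_sin k (l - s) * (1 - mcos k (l - s) (l - s) (d B A))"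
    using mcos_law(1)[of k "l - s" "l - s" "d B A"] S by simp
  also have "\<dots> \<le> 0" using 1 S by (simp add: mult_nonneg_nonpos)
  finally have "d B A = 0"
    using d_sides(2)[of q B A] M D t s R0_pos by (intro good_md_inject[OF good_R0]) auto
  then show ?thesis using M by (simp add: A_def B_def)
qed

end

section \<open>Quasi-convex subsets\<close>

context alexandrov
begin

abbreviation sdirs :: "'a \<Rightarrow> 'a set \<Rightarrow> 'a direction set" where "sdirs \<equiv> directions_of_subset X"

lemma closedin_subset_M: "closedin (mtopology_of X) F \<Longrightarrow> F \<subseteq> M"
  using closedin_subset[of "mtopology_of X" F] by simp

lemma closedin_ultralimit:
  assumes F: "closedin (mtopology_of X) F" and x: "x \<in> M" "\<And>n. f n \<in> F" "((\<lambda>n. d x (f n)) \<longlongrightarrow> 0) ultra"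
  shows "x \<in> F"
proof (rule ccontr)
  interpret Metric_space M d by (rule Metric_space_mspace_mdist)
  assume "x \<notin> F"
  have "closedin mtopology F" using F by (simp add: mtopology_of_def)
  then have "\<exists>r>0. disjnt F (mball x r)" using x(1) \<open>x \<notin> F\<close> unfolding closedin_metric by blast
  then obtain r where r: "r > 0" "disjnt F (mball x r)" by (elim exE conjE)
  have "eventually (\<lambda>n. d x (f n) < r) ultra" using order_tendstoD(2)[OF x(3) r(1)] .
  then obtain n where "d x (f n) < r" using eventually_ultra_ex by auto
  moreover have "f n \<in> M" using x(2)[of n] closedin_subset_M[OF F] by auto
  ultimately have "f n \<in> mball x r" using x(1) by simp
  with r(2) x(2)[of n] show False by (auto simp: disjnt_iff)
qed

lemma nearest_point_exists:
  assumes F: "closedin (mtopology_of X) F" "p0 \<in> F" and q: "q \<in> M"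
  obtains p where "p \<in> F" "\<forall>x\<in>F. d q p \<le> d q x"
proof -
  define m where "m = Inf (d q ` F)"
  have bdd: "bdd_below (d q ` F)" by (intro bdd_belowI[of _ 0]) auto
  have FM: "F \<subseteq> M" using closedin_subset_M[OF F(1)] .
  have "\<exists>x. x \<in> F \<and> d q x < m + inverse (real (Suc n))" for n
  proof -
    have "m < m + inverse (real (Suc n))" by simp
    then have "\<exists>y\<in>d q ` F. y < m + inverse (real (Suc n))"
      unfolding m_def using F(2) by (intro cInf_lessD) auto
    then show ?thesis by auto
  qed
  then have "\<exists>f. \<forall>n. f n \<in> F \<and> d q (f n) < m + inverse (real (Suc n))" by (intro choice allI)
  then obtain f where f: "\<forall>n. f n \<in> F \<and> d q (f n) < m + inverse (real (Suc n))" by (elim exE)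
  have fM: "f n \<in> M" for n using f FM by auto
  have "inverse (real (Suc n)) \<le> 1" for n by (simp add: field_simps)
  then have bound: "d q (f n) \<le> m + 1" for n using f[rule_format, of n] by (smt (verit))
  obtain p where p: "p \<in> M" "((\<lambda>n. d p (f n)) \<longlongrightarrow> 0) ultra"
    by (rule ultralimit_exists[OF q fM bound])
  have pF: "p \<in> F" by (rule closedin_ultralimit[OF F(1) p(1) _ p(2)]) (use f in simp)
  have "d q p \<le> m"
  proof (rule tendsto_le[OF ultra_neq_bot])
    show "((\<lambda>n. d q (f n)) \<longlongrightarrow> d q p) ultra" by (rule d_tendsto) (use q p fM in auto)
    show "((\<lambda>n. m + inverse (real (Suc n))) \<longlongrightarrow> m) ultra"
      using tendsto_add[OF tendsto_const tendsto_ultraI[OF LIMSEQ_inverse_real_of_nat], of m] by simp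
    show "eventually (\<lambda>n. d q (f n) \<le> m + inverse (real (Suc n))) ultra"
      using f by (intro always_eventually allI) (simp add: less_imp_le)
  qed
  moreover have "m \<le> d q x" if "x \<in> F" for x unfolding m_def using that by (intro cInf_lower[OF _ bdd]) auto
  ultimately have "\<forall>x\<in>F. d q p \<le> d q x" by force
  with pF show ?thesis by (rule that)
qed

section \<open>Directions of a subset and the nearest point condition\<close>

lemma dirs_to_in: "p \<in> M \<Longrightarrow> x \<in> M \<Longrightarrow> p \<noteq> x \<Longrightarrow> \<nu> \<in> dirs_to X p x \<Longrightarrow> \<nu> \<in> dirs p"
  unfolding dirs_to_def using mg_geodesic dir_in by auto

text \<open>One \<open>e\<close> controls both position and direction; the sequences of the
  definition arise from \<open>e = inverse (Suc n)\<close>.\<close>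

lemma sdirsI:
  assumes F: "F \<subseteq> M" "p \<in> F" and \<xi>: "\<xi> \<in> dirs p"
    and ex: "\<And>e. e > 0 \<Longrightarrow> \<exists>x \<sigma>. x \<in> F - {p} \<and> d p x < e \<and> \<sigma> \<in> mg p x \<and> dird p (dir p \<sigma>) \<xi> < e"
  shows "\<xi> \<in> sdirs p F"
proof -
  have "\<forall>n. \<exists>y. fst y \<in> F - {p} \<and> d p (fst y) < inverse (real (Suc n)) \<and> snd y \<in> mg p (fst y) \<and>
      dird p (dir p (snd y)) \<xi> < inverse (real (Suc n))"
  proof
    fix n
    obtain x \<sigma> where "x \<in> F - {p}" "d p x < inverse (real (Suc n))" "\<sigma> \<in> mg p x" "dird p (dir p \<sigma>) \<xi> < inverse (real (Suc n))"
      using ex[of "inverse (real (Suc n))"] by auto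
    then show "\<exists>y. fst y \<in> F - {p} \<and> d p (fst y) < inverse (real (Suc n)) \<and> snd y \<in> mg p (fst y) \<and>
      dird p (dir p (snd y)) \<xi> < inverse (real (Suc n))" by (intro exI[of _ "(x, \<sigma>)"]) simp
  qed
  from choice[OF this] obtain y where y: "\<forall>n. fst (y n) \<in> F - {p} \<and> d p (fst (y n)) < inverse (real (Suc n)) \<and> snd (y n) \<in> mg p (fst (y n)) \<and>
      dird p (dir p (snd (y n))) \<xi> < inverse (real (Suc n))" by (elim exE)
  define x where "x n = fst (y n)" for n
  define \<nu> where "\<nu> n = dir p (snd (y n))" for n
  have x: "x n \<in> F - {p}" "d p (x n) < inverse (real (Suc n))" "\<nu> n \<in> dirs_to X p (x n)" "dird p (\<nu> n) \<xi> < inverse (real (Suc n))" for n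
    using y by (simp_all add: x_def \<nu>_def dirs_to_def)
  have inv: "(\<lambda>n. inverse (real (Suc n))) \<longlonglongrightarrow> 0" by (rule LIMSEQ_inverse_real_of_nat)
  interpret Metric_space M d by (rule Metric_space_mspace_mdist)
  have xM: "x n \<in> M" for n using x(1)[of n] F by auto
  have "limitin mtopology x p sequentially"
    unfolding limit_metric_sequentially
  proof (intro conjI allI impI)
    fix e :: real assume "e > 0"
    from order_tendstoD(2)[OF inv this] obtain N where N: "\<forall>n\<ge>N. inverse (real (Suc n)) < e"
      unfolding eventually_sequentially by (elim exE)
    have "x n \<in> M \<and> d (x n) p < e" if "n \<ge> N" for n
      using N that x(2)[of n] xM[of n] mdist_commute[of X p "x n"] by auto
    then show "\<exists>N. \<forall>n\<ge>N. x n \<in> M \<and> d (x n) p < e" by (intro exI[of _ N] allI impI)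
  qed (use F in auto)
  then have lim: "limitin (mtopology_of X) x p sequentially" by (simp add: mtopology_of_def)
  have "\<nu> n \<in> dirs p" for n using x(1,3) xM F by (intro dirs_to_in[of p "x n"]) auto
  then have "0 \<le> dird p (\<nu> n) \<xi>" for n using \<xi> by (intro dird_nonneg)
  then have "(\<lambda>n. dird p (\<nu> n) \<xi>) \<longlonglongrightarrow> 0"
    using x(4) by (intro tendsto_sandwich[OF _ _ tendsto_const inv] always_eventually allI) (auto intro: less_imp_le)
  with \<xi> x lim show ?thesis unfolding directions_of_subset_def
    by (intro CollectI conjI exI[of _ x] exI[of _ \<nu>]) auto
qed

lemma sdirsD:
  assumes F: "F \<subseteq> M" "p \<in> F" and \<xi>: "\<xi> \<in> sdirs p F" and e: "e > 0"
  obtains x \<sigma> where "x \<in> F - {p}" "d p x < e" "\<sigma> \<in> mg p x" "dird p (dir p \<sigma>) \<xi> < e"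
proof -
  from \<xi> obtain x \<nu> where x: "\<forall>i :: nat. x i \<in> F - {p} \<and> \<nu> i \<in> dirs_to X p (x i)"
    "limitin (mtopology_of X) x p sequentially" "(\<lambda>i. dird p (\<nu> i) \<xi>) \<longlonglongrightarrow> 0"
    unfolding directions_of_subset_def by auto
  interpret Metric_space M d by (rule Metric_space_mspace_mdist)
  have "limitin mtopology x p sequentially" using x(2) by (simp add: mtopology_of_def)
  then have "\<exists>N. \<forall>n\<ge>N. x n \<in> M \<and> d (x n) p < e" using e unfolding limit_metric_sequentially by simp
  then have "eventually (\<lambda>n. d (x n) p < e) sequentially" unfolding eventually_sequentially by auto
  moreover have "eventually (\<lambda>n. dird p (\<nu> n) \<xi> < e) sequentially" by (rule order_tendstoD(2)[OF x(3) e])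
  ultimately have "eventually (\<lambda>n. d (x n) p < e \<and> dird p (\<nu> n) \<xi> < e) sequentially" by (rule eventually_conj)
  then obtain n where n: "d (x n) p < e" "dird p (\<nu> n) \<xi> < e" using eventually_happens[of _ sequentially] by auto
  obtain \<sigma> where "\<sigma> \<in> mg p (x n)" "\<nu> n = dir p \<sigma>" using x(1) by (auto simp: dirs_to_def)
  with n x(1) that[of "x n" \<sigma>] show ?thesis by (simp add: mdist_commute)
qed

lemma sdirs_in: "\<xi> \<in> sdirs p F \<Longrightarrow> \<xi> \<in> dirs p"
  by (simp add: directions_of_subset_def)

lemma sdirs_ultralimit:
  assumes F: "F \<subseteq> M" "p \<in> F" and \<xi>: "\<And>n. \<xi> n \<in> sdirs p F" "\<xi>' \<in> dirs p" "((\<lambda>n. dird p (\<xi> n) \<xi>') \<longlongrightarrow> 0) ultra"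
  shows "\<xi>' \<in> sdirs p F"
proof (rule sdirsI[OF F \<xi>(2)])
  fix e :: real assume e: "e > 0"
  then have e2: "e / 2 > 0" by simp
  obtain n where n: "dird p (\<xi> n) \<xi>' < e / 2" using eventually_ultra_ex[OF order_tendstoD(2)[OF \<xi>(3) e2]] by auto
  obtain x \<sigma> where x: "x \<in> F - {p}" "d p x < e / 2" "\<sigma> \<in> mg p x" "dird p (dir p \<sigma>) (\<xi> n) < e / 2"
    by (rule sdirsD[OF F \<xi>(1) e2])
  have "dir p \<sigma> \<in> dirs p" using x F by (intro dir_in mg_geodesic[of \<sigma> p x]) auto
  then have "dird p (dir p \<sigma>) \<xi>' \<le> dird p (dir p \<sigma>) (\<xi> n) + dird p (\<xi> n) \<xi>'"
    using sdirs_in[OF \<xi>(1)] \<xi>(2) by (intro dird_triangle)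
  with x n e show "\<exists>x \<sigma>. x \<in> F - {p} \<and> d p x < e \<and> \<sigma> \<in> mg p x \<and> dird p (dir p \<sigma>) \<xi>' < e"
    by (intro exI[of _ x] exI[of _ \<sigma>]) auto
qed

text \<open>With a positive cosine, the hinge inequality would make points of \<open>F\<close> near
  \<open>p\<close> in direction \<open>\<xi>\<close> closer to \<open>q\<close> than
  \<open>p\<close> is.\<close>

lemma cos_nearest_direction:
  assumes F: "F \<subseteq> M" "p \<in> F" and q: "q \<in> M" "q \<notin> F" and near: "\<forall>x\<in>F. d q p \<le> d q x"
    and \<tau>: "\<tau> \<in> mg p q" and \<xi>: "\<xi> \<in> sdirs p F"
  shows "cos (dird p (dir p \<tau>) \<xi>) \<le> 0"
proof (rule field_le_epsilon)
  fix e :: real assume e: "e > 0"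
  have e2: "e / 2 > 0" using e by simp
  have pM: "p \<in> M" and pq: "p \<noteq> q" using F q by auto
  have G: "\<tau> \<in> geodesics_from X p" using mg_geodesic[OF \<tau> pM q(1) pq] .
  obtain \<rho> where "hinge_scale (e / 2) (d p q) \<rho>" by (rule hinge_scale_exists[OF e2 d_pos[OF pM q(1) pq]])
  note \<rho> = hinge_scaleD[OF this]
  have "min (e / 2) \<rho> > 0" using e2 \<rho>(1) by simp
  from sdirsD[OF F \<xi> this] obtain x \<sigma> where x: "x \<in> F - {p}" "d p x < min (e / 2) \<rho>" "\<sigma> \<in> mg p x"
    "dird p (dir p \<sigma>) \<xi> < min (e / 2) \<rho>" .
  have xM: "x \<in> M" "p \<noteq> x" using x F by auto
  have px: "0 < d p x" using d_pos pM xM by simp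
  have \<sigma>G: "\<sigma> \<in> geodesics_from X p" using mg_geodesic[OF x(3) pM xM] .
  have "d q x \<le> d q p - d p x * (cos (ang p \<sigma> \<tau>) - e / 2)"
    by (rule \<rho>(2)[OF pM q(1) xM(1) _ px _ \<tau> x(3)]) (use x in auto)
  moreover have "d q p \<le> d q x" using near x by auto
  ultimately have "d p x * (cos (ang p \<sigma> \<tau>) - e / 2) \<le> 0" by linarith
  then have "cos (ang p \<sigma> \<tau>) \<le> e / 2" using px by (simp add: mult_le_0_iff)
  moreover have "\<bar>cos (dird p (dir p \<tau>) \<xi>) - cos (ang p \<sigma> \<tau>)\<bar> \<le> e / 2"
  proof -
    note D = dir_in[OF G] dir_in[OF \<sigma>G] sdirs_in[OF \<xi>]
    have "dird p (dir p \<tau>) \<xi> \<le> dird p (dir p \<tau>) (dir p \<sigma>) + dird p (dir p \<sigma>) \<xi>"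
      "dird p (dir p \<tau>) (dir p \<sigma>) \<le> dird p (dir p \<tau>) \<xi> + dird p \<xi> (dir p \<sigma>)"
      using D by (auto intro: dird_triangle)
    moreover have "dird p (dir p \<sigma>) \<xi> < e / 2" using x(4) by simp
    ultimately have "\<bar>dird p (dir p \<tau>) \<xi> - ang p \<sigma> \<tau>\<bar> \<le> e / 2"
      using dird_dir[OF G \<sigma>G] ang_commute[OF G \<sigma>G] dird_commute[OF D(2,3)] by linarith
    with abs_cos_diff_le show ?thesis by (rule order_trans)
  qed
  ultimately show "cos (dird p (dir p \<tau>) \<xi>) \<le> 0 + e" by linarith
qed

text \<open>The infimum in the definition of quasi-convexity is not known to be attained, hence the error \<open>e\<close>.\<close>

lemma quasi_convexD:
  assumes qc: "quasi_convex X F" and q: "q \<in> M - F" and p: "p \<in> F" "\<forall>x\<in>F. d q p \<le> d q x"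
    and r: "r \<in> F - {p}" and e: "e > 0"
  obtains \<tau> \<sigma> where "\<tau> \<in> mg p q" "\<sigma> \<in> mg p r" "- e \<le> cos (ang p \<tau> \<sigma>)"
proof -
  have FM: "F \<subseteq> M" using qc closedin_subset_M by (simp add: quasi_convex_def)
  have M: "p \<in> M" "r \<in> M" "q \<in> M" "p \<noteq> r" "p \<noteq> q" using FM p r q by auto
  define A where "A = {dird p \<alpha> \<beta> | \<alpha> \<beta>. \<alpha> \<in> dirs_to X p q \<and> \<beta> \<in> dirs_to X p r}"
  have "dir_set_dist X p (dirs_to X p q) (dirs_to X p r) \<le> pi / 2"
    using qc q p r unfolding quasi_convex_def by simp
  then have "Inf A < pi / 2 + e" using e by (simp add: dir_set_dist_def A_def)
  moreover have "A \<noteq> {}"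
    using minimal_geodesic_exists[OF M(1,2)] minimal_geodesic_exists[OF M(1,3)] unfolding A_def dirs_to_def by auto
  ultimately have "\<exists>x\<in>A. x < pi / 2 + e" by (intro cInf_lessD)
  then obtain \<tau> \<sigma> where \<tau>\<sigma>: "\<tau> \<in> mg p q" "\<sigma> \<in> mg p r" "dird p (dir p \<tau>) (dir p \<sigma>) < pi / 2 + e"
    unfolding A_def dirs_to_def by auto
  have G: "\<tau> \<in> geodesics_from X p" "\<sigma> \<in> geodesics_from X p" using \<tau>\<sigma> M mg_geodesic by auto
  have a: "ang p \<tau> \<sigma> < pi / 2 + e" using \<tau>\<sigma>(3) dird_dir[OF G] by simp
  have "- e \<le> cos (ang p \<tau> \<sigma>)"
  proof (cases "ang p \<tau> \<sigma> \<le> pi / 2")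
    case True
    then have "0 \<le> cos (ang p \<tau> \<sigma>)" using ang_bounds(1)[OF G] by (intro cos_ge_zero) auto
    with e show ?thesis by linarith
  next
    case False
    have "cos (pi / 2) - cos (ang p \<tau> \<sigma>) \<le> \<bar>pi / 2 - ang p \<tau> \<sigma>\<bar>"
      using abs_cos_diff_le[of "pi / 2" "ang p \<tau> \<sigma>"] by linarith
    with False a show ?thesis by simp
  qed
  with \<tau>\<sigma>(1,2) show ?thesis by (rule that)
qed

text \<open>Because \<open>t < l\<close>, every minimal geodesic from \<open>p\<close> to
  \<open>\<gamma> t\<close> runs along \<open>\<gamma>\<close>, so the distance between sets of
  directions becomes an angle with \<open>\<gamma>\<close> itself. The errors
  \<open>inverse (Suc n)\<close> vanish in the limit of the geodesics to \<open>r\<close>.\<close>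

lemma nearest_on_geodesic:
  assumes qc: "quasi_convex X F" and p: "p \<in> F" and \<gamma>: "unit_speed_minimal X l \<gamma>" "\<gamma> 0 = p"
    and t: "0 < t" "t < l" "\<gamma> t \<notin> F" "\<forall>x\<in>F. d (\<gamma> t) p \<le> d (\<gamma> t) x"
    and l: "l \<le> R0 / 4" and r: "r \<in> F - {p}"
  obtains \<sigma> where "\<sigma> \<in> mg p r" "0 \<le> cos (ang p \<gamma> \<sigma>)"
proof -
  have FM: "F \<subseteq> M" using qc closedin_subset_M by (simp add: quasi_convex_def)
  have M: "p \<in> M" "r \<in> M" "p \<noteq> r" using FM p r by auto
  have q: "\<gamma> t \<in> M - F" using unit_speed_minimalD(1)[OF \<gamma>(1), of t] t by simp
  have G: "\<gamma> \<in> geodesics_from X p" using \<gamma> t by (auto simp: geodesics_from_def intro!: exI[of _ l])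
  have "\<exists>\<sigma>. \<sigma> \<in> mg p r \<and> - inverse (real (Suc n)) \<le> cos (ang p \<gamma> \<sigma>)" for n
  proof -
    obtain \<tau> \<sigma> where \<tau>: "\<tau> \<in> mg p (\<gamma> t)" "\<sigma> \<in> mg p r" "- inverse (real (Suc n)) \<le> cos (ang p \<tau> \<sigma>)"
      by (rule quasi_convexD[OF qc q p t(4) r, of "inverse (real (Suc n))"]) simp_all
    have \<tau>G: "\<tau> \<in> geodesics_from X p" using \<tau>(1) q p M by (intro mg_geodesic[of \<tau> p "\<gamma> t"]) auto
    have \<sigma>G: "\<sigma> \<in> geodesics_from X p" using mg_geodesic[OF \<tau>(2) M] .
    have "ang p \<tau> \<gamma> = 0"
      by (rule ang_eq_0_if_eventually_eq[OF \<tau>G G t(1)]) (use no_branching[OF \<gamma> t(1,2) l \<tau>(1)] in auto)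
    then have "ang p \<tau> \<sigma> = ang p \<gamma> \<sigma>"
      using ang_triangle[OF \<tau>G G \<sigma>G] ang_triangle[OF G \<tau>G \<sigma>G] ang_commute[OF \<tau>G G] by linarith
    with \<tau> show ?thesis by (intro exI[of _ \<sigma>]) simp
  qed
  then have "\<exists>\<sigma>. \<forall>n. \<sigma> n \<in> mg p r \<and> - inverse (real (Suc n)) \<le> cos (ang p \<gamma> (\<sigma> n))" by (intro choice allI)
  then obtain \<sigma> where \<sigma>: "\<forall>n. \<sigma> n \<in> mg p r \<and> - inverse (real (Suc n)) \<le> cos (ang p \<gamma> (\<sigma> n))" by (elim exE)
  have \<sigma>mg: "\<sigma> n \<in> mg p r" for n using \<sigma> by simp
  obtain \<sigma>' where \<sigma>': "\<sigma>' \<in> mg p r" "((\<lambda>n. dird p (dir p (\<sigma> n)) (dir p \<sigma>')) \<longlongrightarrow> 0) ultra"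
    by (rule mg_ultralimit[OF M \<sigma>mg])
  have D: "dir p \<gamma> \<in> dirs p" "dir p \<sigma>' \<in> dirs p" "dir p (\<sigma> n) \<in> dirs p" for n
    using dir_in G mg_geodesic[OF \<sigma>'(1) M] mg_geodesic[OF \<sigma>mg M] by simp_all
  have "0 \<le> cos (dird p (dir p \<gamma>) (dir p \<sigma>'))"
  proof (rule tendsto_le[OF ultra_neq_bot])
    show "((\<lambda>n. cos (dird p (dir p \<gamma>) (dir p (\<sigma> n)))) \<longlongrightarrow> cos (dird p (dir p \<gamma>) (dir p \<sigma>'))) ultra"
      by (intro tendsto_cos dird_tendsto) (use D \<sigma>'(2) dird_self in auto)
    show "((\<lambda>n. - inverse (real (Suc n))) \<longlongrightarrow> 0) ultra"
      using tendsto_minus[OF tendsto_ultraI[OF LIMSEQ_inverse_real_of_nat]] by simp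
    show "eventually (\<lambda>n. - inverse (real (Suc n)) \<le> cos (dird p (dir p \<gamma>) (dir p (\<sigma> n)))) ultra"
      using \<sigma> dird_dir[OF G mg_geodesic[OF \<sigma>mg M]] by (intro always_eventually allI) simp
  qed
  then have "0 \<le> cos (ang p \<gamma> \<sigma>')" using dird_dir[OF G mg_geodesic[OF \<sigma>'(1) M]] by simp
  with \<sigma>'(1) show ?thesis by (rule that)
qed

text \<open>Isolated for a single direction, so that it can be proved for directions of geodesics,
  which are merely dense, and then extended by a limit.\<close>

definition qc_property :: "'a set \<Rightarrow> 'a \<Rightarrow> 'a \<Rightarrow> 'a direction \<Rightarrow> bool" where
  "qc_property F p r \<eta> \<longleftrightarrow> (if sdirs p F = {}
        then \<exists>\<zeta> \<in> dirs_to X p r. cos (dird p \<eta> \<zeta>) \<ge> 0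
        else \<exists>\<zeta> \<in> dirs_to X p r. \<exists>\<xi> \<in> sdirs p F. dird p \<eta> \<xi> \<le> pi / 2 \<and>
               cos (dird p \<eta> \<zeta>) \<ge> cos (dird p \<eta> \<xi>) * cos (dird p \<zeta> \<xi>))"

section \<open>From quasi-convexity to the angle condition, and back\<close>

lemma cos_nonneg_le_half_pi:
  assumes "0 \<le> x" "x \<le> pi" "0 \<le> cos x" shows "x \<le> pi / 2"
proof (rule ccontr)
  assume "\<not> x \<le> pi / 2"
  then have "cos x < cos (pi / 2)" using assms by (intro cos_monotone_0_pi) auto
  with assms show False by simp
qed

text \<open>\<open>\<xi>\<close> is a limit of directions to points of \<open>F\<close> near
  \<open>p\<close>. Quasi-convexity makes its angle with \<open>\<gamma>\<close> at most
  \<open>pi / 2\<close>, minimality of the distance makes it at least that, so the product of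
  cosines is 0.\<close>

lemma qc_property_nearest:
  assumes qc: "quasi_convex X F" and p: "p \<in> F" and \<gamma>: "unit_speed_minimal X l \<gamma>" "\<gamma> 0 = p"
    and t: "0 < t" "t < l" "\<gamma> t \<notin> F" "\<forall>x\<in>F. d (\<gamma> t) p \<le> d (\<gamma> t) x"
    and l: "l \<le> R0 / 4" and r: "r \<in> F - {p}"
  shows "qc_property F p r (dir p \<gamma>)"
proof -
  have FM: "F \<subseteq> M" using qc closedin_subset_M by (simp add: quasi_convex_def)
  have M: "p \<in> M" "r \<in> M" "p \<noteq> r" using FM p r by auto
  have qM: "\<gamma> t \<in> M" using unit_speed_minimalD(1)[OF \<gamma>(1), of t] t by simp
  have \<gamma>q: "\<gamma> \<in> mg p (\<gamma> t)" using geodesic_in_mg[OF \<gamma>, of t] t by simp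
  have G: "\<gamma> \<in> geodesics_from X p" using \<gamma> t by (auto simp: geodesics_from_def intro!: exI[of _ l])
  obtain \<sigma> where \<sigma>: "\<sigma> \<in> mg p r" "0 \<le> cos (ang p \<gamma> \<sigma>)" by (rule nearest_on_geodesic[OF qc p \<gamma> t l r])
  have \<sigma>G: "\<sigma> \<in> geodesics_from X p" using mg_geodesic[OF \<sigma>(1) M] .
  have \<zeta>: "dir p \<sigma> \<in> dirs_to X p r" "0 \<le> cos (dird p (dir p \<gamma>) (dir p \<sigma>))"
    using \<sigma> dird_dir[OF G \<sigma>G] by (simp_all add: dirs_to_def)
  show ?thesis
  proof (cases "sdirs p F = {}")
    case True
    with \<zeta> show ?thesis unfolding qc_property_def by auto
  next
    case False
    then obtain \<xi>0 where \<xi>0: "\<xi>0 \<in> sdirs p F" by auto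
    have "\<exists>y. fst y \<in> F - {p} \<and> d p (fst y) < inverse (real (Suc n)) \<and> snd y \<in> mg p (fst y) \<and> 0 \<le> cos (ang p \<gamma> (snd y))" for n
    proof -
      obtain x \<sigma>0 where x: "x \<in> F - {p}" "d p x < inverse (real (Suc n))"
        by (rule sdirsD[OF FM p \<xi>0, of "inverse (real (Suc n))"]) simp_all
      obtain \<sigma> where "\<sigma> \<in> mg p x" "0 \<le> cos (ang p \<gamma> \<sigma>)" by (rule nearest_on_geodesic[OF qc p \<gamma> t l x(1)])
      with x show ?thesis by (intro exI[of _ "(x, \<sigma>)"]) simp
    qed
    then have "\<exists>y. \<forall>n. fst (y n) \<in> F - {p} \<and> d p (fst (y n)) < inverse (real (Suc n)) \<and> snd (y n) \<in> mg p (fst (y n)) \<and> 0 \<le> cos (ang p \<gamma> (snd (y n)))"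
      by (intro choice allI)
    then obtain y where y: "\<forall>n. fst (y n) \<in> F - {p} \<and> d p (fst (y n)) < inverse (real (Suc n)) \<and> snd (y n) \<in> mg p (fst (y n)) \<and> 0 \<le> cos (ang p \<gamma> (snd (y n)))"
      by (elim exE)
    define x where "x n = fst (y n)" for n
    define \<alpha> where "\<alpha> n = snd (y n)" for n
    have x: "x n \<in> F - {p}" "d p (x n) < inverse (real (Suc n))" "\<alpha> n \<in> mg p (x n)" "0 \<le> cos (ang p \<gamma> (\<alpha> n))" for n
      using y by (simp_all add: x_def \<alpha>_def)
    have \<alpha>G: "\<alpha> n \<in> geodesics_from X p" for n using x(1,3) FM M by (intro mg_geodesic[of "\<alpha> n" p "x n"]) auto
    obtain \<xi> where \<xi>: "\<xi> \<in> dirs p" "((\<lambda>n. dird p (dir p (\<alpha> n)) \<xi>) \<longlongrightarrow> 0) ultra"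
      by (rule dir_ultralimit[OF M(1), of "\<lambda>n. dir p (\<alpha> n)"]) (use dir_in \<alpha>G in auto)
    have \<xi>F: "\<xi> \<in> sdirs p F"
    proof (rule sdirsI[OF FM p \<xi>(1)])
      fix e :: real assume e: "e > 0"
      have "eventually (\<lambda>n. inverse (real (Suc n)) < e) ultra"
        by (rule eventually_ultraI, rule order_tendstoD(2)[OF LIMSEQ_inverse_real_of_nat e])
      from eventually_ultra_ex[OF eventually_conj[OF this order_tendstoD(2)[OF \<xi>(2) e]]]
      obtain n where "inverse (real (Suc n)) < e" "dird p (dir p (\<alpha> n)) \<xi> < e" by (elim exE conjE)
      with x[of n] show "\<exists>x \<sigma>. x \<in> F - {p} \<and> d p x < e \<and> \<sigma> \<in> mg p x \<and> dird p (dir p \<sigma>) \<xi> < e"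
        by (intro exI[of _ "x n"] exI[of _ "\<alpha> n"]) (meson order_less_trans)
    qed
    note D = dir_in[OF G] \<xi>(1)
    have "0 \<le> cos (dird p (dir p \<gamma>) \<xi>)"
    proof (rule tendsto_lowerbound)
      show "((\<lambda>n. cos (dird p (dir p \<gamma>) (dir p (\<alpha> n)))) \<longlongrightarrow> cos (dird p (dir p \<gamma>) \<xi>)) ultra"
        by (intro tendsto_cos dird_tendsto) (use D \<xi> \<alpha>G dir_in dird_self in auto)
      show "eventually (\<lambda>n. 0 \<le> cos (dird p (dir p \<gamma>) (dir p (\<alpha> n)))) ultra"
        using x(4) dird_dir[OF G \<alpha>G] by (intro always_eventually allI) simp
    qed simp
    moreover have "cos (dird p (dir p \<gamma>) \<xi>) \<le> 0"
      by (rule cos_nearest_direction[OF FM p qM t(3,4) \<gamma>q \<xi>F])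
    ultimately have c0: "cos (dird p (dir p \<gamma>) \<xi>) = 0" by simp
    then have "dird p (dir p \<gamma>) \<xi> \<le> pi / 2" using dird_nonneg[OF D] dird_le_pi[OF D] by (intro cos_nonneg_le_half_pi) auto
    moreover have "cos (dird p (dir p \<gamma>) \<xi>) * cos (dird p (dir p \<sigma>) \<xi>) \<le> cos (dird p (dir p \<gamma>) (dir p \<sigma>))"
      using c0 \<zeta>(2) by simp
    ultimately show ?thesis unfolding qc_property_def using False \<zeta>(1) \<xi>F by auto
  qed
qed

text \<open>Rescaling at \<open>p\<close>: the nearest points \<open>y n\<close> to \<open>\<gamma> (t n)\<close> have a limit direction \<open>\<xi>\<close>, and \<open>v\<close> is the
  limit of their relative distances. Quasi-convexity at \<open>y n\<close> towards \<open>r\<close>, combined with the first variation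
  formula at \<open>p\<close>, gives \<open>v * cos |\<xi> \<zeta>| \<le> cos |\<eta> \<zeta>0|\<close>. Applied to \<open>r = y m\<close> this yields \<open>v \<le> cos |\<eta> \<xi>|\<close>;
  quasi-convexity at \<open>y n\<close> towards \<open>p\<close> yields the opposite inequality.\<close>

lemma qc_property_blowup:
  assumes qc: "quasi_convex X F" and p: "p \<in> F" and \<gamma>: "unit_speed_minimal X l \<gamma>" "\<gamma> 0 = p"
    and t: "\<And>n. 0 < t n" "\<And>n. t n \<le> l" "t \<longlonglongrightarrow> 0" and q: "\<And>n. \<gamma> (t n) \<notin> F"
    and y: "\<And>n. y n \<in> F - {p}" "\<And>n. \<forall>x\<in>F. d (\<gamma> (t n)) (y n) \<le> d (\<gamma> (t n)) x"
    and r: "r \<in> F - {p}"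
  shows "qc_property F p r (dir p \<gamma>)"
proof -
  have FM: "F \<subseteq> M" using qc closedin_subset_M by (simp add: quasi_convex_def)
  have M: "p \<in> M" using FM p by auto
  have yM: "y n \<in> M" "p \<noteq> y n" for n using y(1)[of n] FM by auto
  have l: "l > 0" using t(1,2)[of 0] by linarith
  have G: "\<gamma> \<in> geodesics_from X p" using \<gamma> l by (auto simp: geodesics_from_def)
  have qM: "\<gamma> (t n) \<in> M" and pq: "d p (\<gamma> (t n)) = t n" for n
    using unit_speed_minimalD(1)[OF \<gamma>(1), of "t n"] d_start[OF \<gamma>, of "t n"] t(1,2)[of n] by simp_all
  have qMF: "\<gamma> (t n) \<in> M - F" for n using qM q by simp
  define b where "b n = d p (y n)" for n
  define w where "w n = d (y n) (\<gamma> (t n))" for n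
  have b: "0 < b n" for n using d_pos[OF M yM(1) yM(2)] by (simp add: b_def)
  have w: "0 < w n" "w n \<le> t n" for n
  proof -
    show "0 < w n" unfolding w_def using yM qM q y(1) by (intro d_pos) (auto, metis)
    show "w n \<le> t n" using bspec[OF y(2)[of n] p] pq[of n]
      by (simp add: w_def mdist_commute[of X "\<gamma> (t n)"])
  qed
  have b2: "b n \<le> 2 * t n" for n
    using d_tri[OF M qM[of n] yM(1)[of n]] pq[of n] w(2)[of n] by (simp add: b_def w_def mdist_commute)
  have tU: "(t \<longlongrightarrow> 0) ultra" by (rule tendsto_ultraI[OF t(3)])
  have bU: "(b \<longlongrightarrow> 0) ultra"
  proof (rule tendsto_sandwich[OF _ _ tendsto_const])
    show "((\<lambda>n. 2 * t n) \<longlongrightarrow> 0) ultra" using tendsto_mult[OF tendsto_const tU, of 2] by simp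
  qed (use b b2 in \<open>auto intro!: always_eventually simp: less_imp_le\<close>)
  have wU: "(w \<longlongrightarrow> 0) ultra"
    by (rule tendsto_sandwich[OF _ _ tendsto_const tU]) (use w in \<open>auto intro!: always_eventually simp: less_imp_le\<close>)
  have v0: "0 \<le> b n / t n" "b n / t n \<le> 2" for n using b[of n] b2[of n] t(1)[of n] by (simp_all add: divide_le_eq)
  obtain v where v: "((\<lambda>n. b n / t n) \<longlongrightarrow> v) ultra" by (rule ultra_bounded_tendsto[OF v0])
  have v02: "0 \<le> v" "v \<le> 2"
    using tendsto_lowerbound[OF v, of 0] tendsto_upperbound[OF v, of 2] v0 by simp_all
  have "\<forall>n. \<exists>\<tau>. \<tau> \<in> mg p (y n)" using minimal_geodesic_exists[OF M yM(1)] by auto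
  from choice[OF this] obtain \<tau> where \<tau>: "\<forall>n. \<tau> n \<in> mg p (y n)" by (elim exE)
  have \<tau>mg: "\<tau> n \<in> mg p (y n)" for n using \<tau> by simp
  have \<tau>G: "\<tau> n \<in> geodesics_from X p" for n using mg_geodesic[OF \<tau>mg M yM] .
  obtain \<xi> where \<xi>: "\<xi> \<in> dirs p" "((\<lambda>n. dird p (dir p (\<tau> n)) \<xi>) \<longlongrightarrow> 0) ultra"
    by (rule dir_ultralimit[OF M, of "\<lambda>n. dir p (\<tau> n)"]) (use dir_in \<tau>G in auto)
  have \<xi>F: "\<xi> \<in> sdirs p F"
  proof (rule sdirsI[OF FM p \<xi>(1)])
    fix e :: real assume e: "e > 0"
    from eventually_ultra_ex[OF eventually_conj[OF order_tendstoD(2)[OF bU e] order_tendstoD(2)[OF \<xi>(2) e]]]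
    obtain n where "b n < e" "dird p (dir p (\<tau> n)) \<xi> < e" by (elim exE conjE)
    with y(1)[of n] \<tau>mg[of n] show "\<exists>x \<sigma>. x \<in> F - {p} \<and> d p x < e \<and> \<sigma> \<in> mg p x \<and> dird p (dir p \<sigma>) \<xi> < e"
      by (intro exI[of _ "y n"] exI[of _ "\<tau> n"]) (simp add: b_def)
  qed
  note D = dir_in[OF G] \<xi>(1)
  \<comment> \<open>\<open>\<sigma>0\<close> stems from first variation, while the hinge inequality
    at \<open>p\<close> holds for every \<open>\<sigma>\<close>; hence this order of quantifiers.
    The claim is kept general in \<open>r\<close> because it is used again with the nearest
    points.\<close>
  have key: "\<exists>\<sigma>0\<in>mg p r. \<forall>\<sigma>\<in>mg p r. v * cos (dird p \<xi> (dir p \<sigma>)) \<le> cos (ang p \<gamma> \<sigma>0)" if r: "r \<in> F - {p}" for r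
  proof -
    have rM: "r \<in> M" "p \<noteq> r" using r FM by auto
    obtain \<sigma>0 where \<sigma>0: "\<sigma>0 \<in> mg p r" "\<And>e. e > 0 \<Longrightarrow> eventually (\<lambda>n. d r p - t n * (cos (ang p \<gamma> \<sigma>0) + e) \<le> d r (\<gamma> (t n))) ultra"
      using first_variation[OF M rM \<gamma> t] by metis
    have "v * cos (dird p \<xi> (dir p \<sigma>)) \<le> cos (ang p \<gamma> \<sigma>0)" if \<sigma>: "\<sigma> \<in> mg p r" for \<sigma>
    proof (rule field_le_epsilon)
      fix e' :: real assume "e' > 0"
      \<comment> \<open>Three errors relative to \<open>t n\<close>, and one relative to
        \<open>b n\<close>, which is weighted by \<open>v \<le> 2\<close>.\<close>
      define e where "e = e' / 5"
      have e: "e > 0" "e' = 5 * e" using \<open>e' > 0\<close> by (simp_all add: e_def)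
      have \<sigma>G: "\<sigma> \<in> geodesics_from X p" using mg_geodesic[OF \<sigma> M rM] .
      have pr: "0 < d p r" using d_pos[OF M rM] .
      have pr2: "0 < d p r / 2" using pr by simp
      obtain \<rho>1 where "hinge_scale e (d p r / 2) \<rho>1" by (rule hinge_scale_exists[OF e(1) pr2])
      note \<rho>1 = hinge_scaleD[OF this]
      have lim: "((\<lambda>n. b n / t n * (cos (dird p (dir p (\<tau> n)) (dir p \<sigma>)) - e) - 3 * e) \<longlongrightarrow> v * (cos (dird p \<xi> (dir p \<sigma>)) - e) - 3 * e) ultra"
        by (intro tendsto_intros v tendsto_cos dird_tendsto) (use \<xi> dir_in \<tau>G \<sigma>G dird_self in auto)
      have "v * (cos (dird p \<xi> (dir p \<sigma>)) - e) - 3 * e \<le> cos (ang p \<gamma> \<sigma>0)"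
      proof (rule tendsto_upperbound[OF lim])
        show "eventually (\<lambda>n. b n / t n * (cos (dird p (dir p (\<tau> n)) (dir p \<sigma>)) - e) - 3 * e \<le> cos (ang p \<gamma> \<sigma>0)) ultra"
          using \<sigma>0(2)[OF e(1)] order_tendstoD(2)[OF bU \<rho>1(1)] order_tendstoD(2)[OF wU \<rho>1(1)] order_tendstoD(2)[OF bU pr2]
        proof eventually_elim
          case (elim n)
          \<comment> \<open>Keeps the side from \<open>y n\<close> to \<open>r\<close> bounded
            below, so that the single scale \<open>\<rho>1\<close> applies at all late
            vertices.\<close>
          have yr: "d p r / 2 \<le> d (y n) r" using d_tri[OF M yM(1)[of n] rM(1)] elim(4) by (simp add: b_def)
          have "r \<noteq> y n" using yr pr2 yM(1)[of n] by auto
          then obtain \<tau>' \<sigma>' where qt: "\<tau>' \<in> mg (y n) (\<gamma> (t n))" "\<sigma>' \<in> mg (y n) r" "- e \<le> cos (ang (y n) \<tau>' \<sigma>')"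
            using quasi_convexD[OF qc qMF _ y(2) _ e(1), of n r] y(1)[of n] r by auto
          have "d r (\<gamma> (t n)) \<le> d r (y n) - w n * (cos (ang (y n) \<tau>' \<sigma>') - e)"
            unfolding w_def
            by (rule \<rho>1(2)[OF yM(1) rM(1) qM yr _ _ qt(2,1)]) (use w[of n] elim(3) in \<open>simp_all add: w_def\<close>)
          moreover have "w n * (- 2 * e) \<le> w n * (cos (ang (y n) \<tau>' \<sigma>') - e)"
            using w[of n] qt(3) by (intro mult_left_mono) auto
          moreover have "w n * e \<le> t n * e" using w[of n] e by (intro mult_right_mono) auto
          moreover have "d r (y n) \<le> d r p - b n * (cos (ang p (\<tau> n) \<sigma>) - e)"
            unfolding b_def
            by (rule \<rho>1(2)[OF M rM(1) yM(1) _ _ _ \<sigma> \<tau>mg]) (use pr b[of n] elim(2) in \<open>simp_all add: b_def\<close>)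
          ultimately have "b n * (cos (ang p (\<tau> n) \<sigma>) - e) \<le> t n * (cos (ang p \<gamma> \<sigma>0) + 3 * e)"
            using elim(1) by (simp add: algebra_simps)
          then have "b n * (cos (ang p (\<tau> n) \<sigma>) - e) / t n \<le> cos (ang p \<gamma> \<sigma>0) + 3 * e"
            using t(1)[of n] by (simp add: divide_le_eq mult.commute)
          then show ?case using dird_dir[OF \<tau>G \<sigma>G] by simp
        qed
      qed simp
      moreover have "v * e \<le> 2 * e" using v02 e by (intro mult_right_mono) auto
      ultimately show "v * cos (dird p \<xi> (dir p \<sigma>)) \<le> cos (ang p \<gamma> \<sigma>0) + e'"
        unfolding e(2) by (simp add: algebra_simps)
    qed
    with \<sigma>0(1) show ?thesis by auto
  qed
  have vle: "v \<le> cos (dird p (dir p \<gamma>) \<xi>)"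
  proof -
    \<comment> \<open>The geodesic that \<open>key\<close> supplies for the endpoint
      \<open>y n\<close> may differ from \<open>\<tau> n\<close>; \<open>same_direction\<close>
      shows that their limit directions agree.\<close>
    have "\<forall>n. \<exists>\<sigma>0. \<sigma>0 \<in> mg p (y n) \<and> v * cos (dird p \<xi> (dir p (\<tau> n))) \<le> cos (ang p \<gamma> \<sigma>0)"
    proof
      fix n
      from key[OF y(1)[of n]] obtain \<sigma>0 where \<sigma>0: "\<sigma>0 \<in> mg p (y n)"
        "\<forall>\<sigma>\<in>mg p (y n). v * cos (dird p \<xi> (dir p \<sigma>)) \<le> cos (ang p \<gamma> \<sigma>0)" ..
      show "\<exists>\<sigma>0. \<sigma>0 \<in> mg p (y n) \<and> v * cos (dird p \<xi> (dir p (\<tau> n))) \<le> cos (ang p \<gamma> \<sigma>0)"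
        by (rule exI[of _ \<sigma>0], rule conjI[OF \<sigma>0(1) bspec[OF \<sigma>0(2) \<tau>mg[of n]]])
    qed
    from choice[OF this] obtain \<sigma> where \<sigma>: "\<forall>n. \<sigma> n \<in> mg p (y n) \<and> v * cos (dird p \<xi> (dir p (\<tau> n))) \<le> cos (ang p \<gamma> (\<sigma> n))"
      by (elim exE)
    have \<sigma>mg: "\<sigma> n \<in> mg p (y n)" for n using \<sigma> by simp
    have \<sigma>G: "\<sigma> n \<in> geodesics_from X p" for n using mg_geodesic[OF \<sigma>mg M yM] .
    obtain \<xi>' where \<xi>': "\<xi>' \<in> dirs p" "((\<lambda>n. dird p (dir p (\<sigma> n)) \<xi>') \<longlongrightarrow> 0) ultra"
      by (rule dir_ultralimit[OF M, of "\<lambda>n. dir p (\<sigma> n)"]) (use dir_in \<sigma>G in auto)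
    have "dird p \<xi> \<xi>' = 0"
    proof (rule same_direction[OF M yM(1) _ _ \<tau>mg \<xi> \<sigma>mg \<xi>'])
      show "y n \<noteq> p" for n using y(1)[of n] by simp
      show "((\<lambda>n. d p (y n)) \<longlongrightarrow> 0) ultra" using bU unfolding b_def[abs_def] .
    qed
    then have eq: "dird p (dir p \<gamma>) \<xi>' = dird p (dir p \<gamma>) \<xi>"
      using dird_triangle[OF D(1) \<xi>(1) \<xi>'(1)] dird_triangle[OF D(1) \<xi>'(1) \<xi>(1)] dird_commute[OF \<xi>(1) \<xi>'(1)] by linarith
    have "v * cos (dird p \<xi> \<xi>) \<le> cos (dird p (dir p \<gamma>) \<xi>')"
    proof (rule tendsto_le[OF ultra_neq_bot])
      show "((\<lambda>n. cos (dird p (dir p \<gamma>) (dir p (\<sigma> n)))) \<longlongrightarrow> cos (dird p (dir p \<gamma>) \<xi>')) ultra"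
        by (intro tendsto_cos dird_tendsto) (use D \<xi>' \<sigma>G dir_in dird_self in auto)
      show "((\<lambda>n. v * cos (dird p \<xi> (dir p (\<tau> n)))) \<longlongrightarrow> v * cos (dird p \<xi> \<xi>)) ultra"
        by (intro tendsto_mult tendsto_const tendsto_cos dird_tendsto) (use \<xi> \<tau>G dir_in dird_self in auto)
      show "eventually (\<lambda>n. v * cos (dird p \<xi> (dir p (\<tau> n))) \<le> cos (dird p (dir p \<gamma>) (dir p (\<sigma> n)))) ultra"
        using \<sigma> dird_dir[OF G \<sigma>G] by (intro always_eventually allI) simp
    qed
    then show ?thesis using dird_self[OF \<xi>(1)] eq by simp
  qed
  have vge: "cos (dird p (dir p \<gamma>) \<xi>) \<le> v"
  proof (rule field_le_epsilon)
    fix e' :: real assume "e' > 0"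
    define e where "e = e' / 3"
    have e: "e > 0" "e' = 3 * e" using \<open>e' > 0\<close> by (simp_all add: e_def)
    obtain \<rho> where "angle_scale e \<rho>" by (rule angle_scale_exists[OF e(1)])
    note \<rho> = angle_scaleD[OF this]
    have lim: "((\<lambda>n. cos (dird p (dir p (\<tau> n)) (dir p \<gamma>)) - e) \<longlongrightarrow> cos (dird p \<xi> (dir p \<gamma>)) - e) ultra"
      by (intro tendsto_intros tendsto_cos dird_tendsto) (use \<xi> dir_in \<tau>G G dird_self in auto)
    have lim': "((\<lambda>n. b n / t n + 2 * e) \<longlongrightarrow> v + 2 * e) ultra" by (intro tendsto_intros v)
    have "cos (dird p \<xi> (dir p \<gamma>)) - e \<le> v + 2 * e"
    proof (rule tendsto_le[OF ultra_neq_bot lim' lim])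
      show "eventually (\<lambda>n. cos (dird p (dir p (\<tau> n)) (dir p \<gamma>)) - e \<le> b n / t n + 2 * e) ultra"
        using order_tendstoD(2)[OF bU \<rho>(1)] order_tendstoD(2)[OF wU \<rho>(1)] order_tendstoD(2)[OF tU \<rho>(1)]
      proof eventually_elim
        case (elim n)
        define B where "B = b n"
        define W where "W = w n"
        define T where "T = t n"
        define g where "g = cos (ang p (\<tau> n) \<gamma>) - e"
        have pos: "0 < B" "0 < W" "0 < T" "W \<le> T" using b[of n] w[of n] t(1)[of n] by (simp_all add: B_def W_def T_def)
        have pF: "p \<in> F - {y n}" using p y(1)[of n] by auto
        obtain \<tau>' \<sigma>' where qt: "\<tau>' \<in> mg (y n) (\<gamma> (t n))" "\<sigma>' \<in> mg (y n) p" "- e \<le> cos (ang (y n) \<tau>' \<sigma>')"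
          using quasi_convexD[OF qc qMF _ y(2) pF e(1)] y(1)[of n] by auto
        have Bd: "d (y n) p = B" "d p (y n) = B" by (simp_all add: B_def b_def mdist_commute)
        have Wd: "d (y n) (\<gamma> (t n)) = W" by (simp add: W_def w_def)
        note u1 = mgD[OF qt(1), unfolded Wd] and u2 = mgD[OF qt(2), unfolded Bd(1)] and u3 = mgD[OF \<tau>mg[of n], unfolded Bd(2)]
        have "cos (ang (y n) \<tau>' \<sigma>') - e \<le> ecos W B (d (\<tau>' W) (\<sigma>' B))"
          by (rule \<rho>(2)[OF u1(1,2) u2(1,2)]) (use pos elim in \<open>auto simp: B_def W_def\<close>)
        then have "- 2 * e \<le> ecos W B T" using qt(3) u1(3) u2(3) pq[of n] by (simp add: T_def mdist_commute)
        then have "(- 2 * e) * (2 * W * B) \<le> W\<^sup>2 + B\<^sup>2 - T\<^sup>2" using pos by (subst (asm) pos_le_divide_eq) auto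
        \<comment> \<open>An approximate Pythagorean inequality, as the angle at \<open>y n\<close>
          is almost at most a right angle. Combined with the cosine law at \<open>p\<close> it
          eliminates \<open>W\<^sup>2\<close>.\<close>
        then have 1: "T\<^sup>2 \<le> W\<^sup>2 + B\<^sup>2 + 4 * e * W * B" by (simp add: algebra_simps)
        have "g \<le> ecos B T (d (\<tau> n B) (\<gamma> T))"
          unfolding g_def by (rule \<rho>(2)[OF u3(1,2) \<gamma>]) (use pos elim t(2)[of n] in \<open>auto simp: B_def T_def\<close>)
        then have "g \<le> ecos B T W" using u3(3) Wd by (simp add: T_def)
        then have "g * (2 * B * T) \<le> B\<^sup>2 + T\<^sup>2 - W\<^sup>2" using pos by (subst (asm) pos_le_divide_eq) auto
        with 1 have "(g * T) * (2 * B) \<le> (B + 2 * e * W) * (2 * B)" by (simp add: power2_eq_square algebra_simps)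
        then have "g * T \<le> B + 2 * e * W" using pos by simp
        also have "\<dots> \<le> B + 2 * e * T" using pos e by simp
        also have "\<dots> = (B / T + 2 * e) * T" using pos by (simp add: field_simps)
        finally have "g \<le> B / T + 2 * e" using pos by simp
        then show ?case using dird_dir[OF \<tau>G G, of n] by (simp add: g_def B_def T_def)
      qed
    qed
    then show "cos (dird p (dir p \<gamma>) \<xi>) \<le> v + e'" using dird_commute[OF D] e(2) by simp
  qed
  have veq: "cos (dird p (dir p \<gamma>) \<xi>) = v" using vle vge by simp
  then have half: "dird p (dir p \<gamma>) \<xi> \<le> pi / 2"
    using dird_nonneg[OF D] dird_le_pi[OF D] v02 by (intro cos_nonneg_le_half_pi) auto
  obtain \<sigma>0 where \<sigma>0: "\<sigma>0 \<in> mg p r" "v * cos (dird p \<xi> (dir p \<sigma>0)) \<le> cos (ang p \<gamma> \<sigma>0)"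
    using key[OF r] by auto
  have \<sigma>G: "\<sigma>0 \<in> geodesics_from X p" using r FM by (intro mg_geodesic[OF \<sigma>0(1) M]) auto
  have "cos (dird p (dir p \<gamma>) \<xi>) * cos (dird p (dir p \<sigma>0) \<xi>) \<le> cos (dird p (dir p \<gamma>) (dir p \<sigma>0))"
    using \<sigma>0(2) veq dird_dir[OF G \<sigma>G] dird_commute[OF \<xi>(1) dir_in[OF \<sigma>G]] by simp
  with half \<xi>F \<sigma>0(1) show ?thesis unfolding qc_property_def dirs_to_def by auto
qed

lemma qc_property_geodesic:
  assumes qc: "quasi_convex X F" and p: "p \<in> F" and G: "\<gamma> \<in> geodesics_from X p" and r: "r \<in> F - {p}"
  shows "qc_property F p r (dir p \<gamma>)"
proof -
  have cl: "closedin (mtopology_of X) F" using qc by (simp add: quasi_convex_def)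
  have FM: "F \<subseteq> M" using closedin_subset_M[OF cl] .
  have M: "p \<in> M" "r \<in> M" "p \<noteq> r" using FM p r by auto
  obtain l0 where l0: "l0 > 0" "unit_speed_minimal X l0 \<gamma>" "\<gamma> 0 = p" using G by (auto simp: geodesics_from_def)
  define l where "l = min l0 (R0 / 4)"
  have l: "l > 0" "l \<le> R0 / 4" using l0 R0_pos by (simp_all add: l_def)
  have \<gamma>: "unit_speed_minimal X l \<gamma>" by (rule unit_speed_minimal_le[OF l0(2)]) (simp add: l_def)
  note \<gamma>0 = l0(3)
  have \<gamma>M: "\<gamma> s \<in> M" "d p (\<gamma> s) = s" if "0 \<le> s" "s \<le> l" for s
    using unit_speed_minimalD(1)[OF \<gamma>] d_start[OF \<gamma> \<gamma>0] that by simp_all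
  show ?thesis
  proof (cases "\<forall>e>0. \<exists>s. 0 < s \<and> s < e \<and> \<gamma> s \<in> F")
    case True
    \<comment> \<open>The direction of \<open>\<gamma>\<close> itself serves as
      \<open>\<xi>\<close>, and the condition becomes an equality for any
      \<open>\<zeta>\<close>.\<close>
    have "dir p \<gamma> \<in> sdirs p F"
    proof (rule sdirsI[OF FM p dir_in[OF G]])
      fix e :: real assume e: "e > 0"
      have "min e l > 0" using e l by simp
      with True obtain s where s: "0 < s" "s < min e l" "\<gamma> s \<in> F" by blast
      then have "\<gamma> s \<in> F - {p}" "d p (\<gamma> s) < e" using \<gamma>M[of s] M by auto
      moreover have "\<gamma> \<in> mg p (\<gamma> s)" using geodesic_in_mg[OF \<gamma> \<gamma>0, of s] s by simp
      moreover have "dird p (dir p \<gamma>) (dir p \<gamma>) < e" using dird_self[OF dir_in[OF G]] e by simp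
      ultimately show "\<exists>x \<sigma>. x \<in> F - {p} \<and> d p x < e \<and> \<sigma> \<in> mg p x \<and> dird p (dir p \<sigma>) (dir p \<gamma>) < e"
        by (intro exI[of _ "\<gamma> s"] exI[of _ \<gamma>] conjI)
    qed
    moreover obtain \<sigma> where \<sigma>: "\<sigma> \<in> mg p r" using minimal_geodesic_exists[OF M(1,2)] by auto
    have \<sigma>G: "\<sigma> \<in> geodesics_from X p" using mg_geodesic[OF \<sigma> M] .
    have "cos (dird p (dir p \<gamma>) (dir p \<gamma>)) * cos (dird p (dir p \<sigma>) (dir p \<gamma>)) \<le> cos (dird p (dir p \<gamma>) (dir p \<sigma>))"
      using dird_self[OF dir_in[OF G]] dird_commute[OF dir_in[OF G] dir_in[OF \<sigma>G]] by simp
    moreover have "dird p (dir p \<gamma>) (dir p \<gamma>) \<le> pi / 2" using dird_self[OF dir_in[OF G]] by simp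
    moreover have "dir p \<sigma> \<in> dirs_to X p r" using \<sigma> by (simp add: dirs_to_def)
    ultimately show ?thesis unfolding qc_property_def by auto
  next
    case False
    then obtain e where e: "e > 0" "\<And>s. 0 < s \<Longrightarrow> s < e \<Longrightarrow> \<gamma> s \<notin> F" by auto
    define m where "m = min e l"
    have m: "m > 0" "m \<le> e" "m \<le> l" using e l by (simp_all add: m_def)
    show ?thesis
    proof (cases "\<exists>s. 0 < s \<and> s < m \<and> (\<forall>x\<in>F. d (\<gamma> s) p \<le> d (\<gamma> s) x)")
      case True
      then obtain s where s: "0 < s" "s < m" "\<forall>x\<in>F. d (\<gamma> s) p \<le> d (\<gamma> s) x" by auto
      then show ?thesis using e m by (intro qc_property_nearest[OF qc p \<gamma> \<gamma>0 s(1) _ _ s(3) l(2) r]) auto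
    next
      case False
      \<comment> \<open>Starting with the factor 1/2 keeps every \<open>t n\<close> strictly below
        \<open>m\<close>, as both negated case assumptions require.\<close>
      define t where "t n = m * inverse (real (Suc (Suc n)))" for n
      have t: "0 < t n" "t n < m" for n
      proof -
        show "0 < t n" using m by (simp add: t_def)
        have "inverse (real (Suc (Suc n))) < 1" by (simp add: field_simps)
        then show "t n < m" using m mult_strict_left_mono[of _ 1 m] by (simp add: t_def)
      qed
      have "t \<longlonglongrightarrow> m * 0" unfolding t_def
        by (intro tendsto_mult tendsto_const LIMSEQ_Suc[OF LIMSEQ_inverse_real_of_nat])
      then have t0: "t \<longlonglongrightarrow> 0" by simp
      have "\<forall>n. \<exists>y. y \<in> F \<and> (\<forall>x\<in>F. d (\<gamma> (t n)) y \<le> d (\<gamma> (t n)) x)"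
      proof
        fix n
        have "\<gamma> (t n) \<in> M" using \<gamma>M(1)[of "t n"] t[of n] m by simp
        from nearest_point_exists[OF cl p this] obtain y where "y \<in> F" "\<forall>x\<in>F. d (\<gamma> (t n)) y \<le> d (\<gamma> (t n)) x" .
        then show "\<exists>y. y \<in> F \<and> (\<forall>x\<in>F. d (\<gamma> (t n)) y \<le> d (\<gamma> (t n)) x)" by (intro exI[of _ y] conjI)
      qed
      from choice[OF this] obtain y where y: "\<forall>n. y n \<in> F \<and> (\<forall>x\<in>F. d (\<gamma> (t n)) (y n) \<le> d (\<gamma> (t n)) x)" by (elim exE)
      show ?thesis
      proof (rule qc_property_blowup[OF qc p \<gamma> \<gamma>0 _ _ t0 _ _ _ r])
        fix n
        show "0 < t n" "t n \<le> l" "\<gamma> (t n) \<notin> F" using t[of n] m e by auto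
        show "\<forall>x\<in>F. d (\<gamma> (t n)) (y n) \<le> d (\<gamma> (t n)) x" using y by simp
        have "y n \<noteq> p"
        proof
          assume "y n = p"
          with y have "\<forall>x\<in>F. d (\<gamma> (t n)) p \<le> d (\<gamma> (t n)) x" by force
          with False t[of n] show False by blast
        qed
        with y show "y n \<in> F - {p}" by simp
      qed
    qed
  qed
qed

text \<open>A general \<open>\<eta>\<close> is approximated by directions of geodesics. Limits of
  the witnesses remain admissible because the directions to \<open>r\<close> and those in
  \<open>sdirs p F\<close> are closed under ultralimits.\<close>

lemma qc_property_if_quasi_convex:
  assumes qc: "quasi_convex X F" and p: "p \<in> F" and r: "r \<in> F - {p}" and \<eta>: "\<eta> \<in> dirs p"
  shows "qc_property F p r \<eta>"
proof -
  have FM: "F \<subseteq> M" using qc closedin_subset_M by (simp add: quasi_convex_def)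
  have M: "p \<in> M" "r \<in> M" "p \<noteq> r" using FM p r by auto
  have "\<forall>n. \<exists>\<gamma>. \<gamma> \<in> geodesics_from X p \<and> dird p \<eta> (dir p \<gamma>) < inverse (real (Suc n))"
  proof
    fix n
    obtain \<gamma> where "\<gamma> \<in> geodesics_from X p" "dird p \<eta> (dir p \<gamma>) < inverse (real (Suc n))"
      by (rule dir_dense[OF \<eta>, of "inverse (real (Suc n))"]) simp_all
    then show "\<exists>\<gamma>. \<gamma> \<in> geodesics_from X p \<and> dird p \<eta> (dir p \<gamma>) < inverse (real (Suc n))" by (intro exI[of _ \<gamma>] conjI)
  qed
  from choice[OF this] obtain \<gamma> where \<gamma>: "\<forall>n. \<gamma> n \<in> geodesics_from X p \<and> dird p \<eta> (dir p (\<gamma> n)) < inverse (real (Suc n))" by (elim exE)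
  have G: "\<gamma> n \<in> geodesics_from X p" for n using \<gamma> by simp
  have \<gamma>lim: "((\<lambda>n. dird p (dir p (\<gamma> n)) \<eta>) \<longlongrightarrow> 0) ultra"
  proof (rule tendsto_sandwich[OF _ _ tendsto_const tendsto_ultraI[OF LIMSEQ_inverse_real_of_nat]])
    show "eventually (\<lambda>n. 0 \<le> dird p (dir p (\<gamma> n)) \<eta>) ultra" using dird_nonneg dir_in G \<eta> by simp
    show "eventually (\<lambda>n. dird p (dir p (\<gamma> n)) \<eta> \<le> inverse (real (Suc n))) ultra"
      using \<gamma> dird_commute[OF dir_in[OF G] \<eta>] by (intro always_eventually allI) (simp add: less_imp_le)
  qed
  have cond: "qc_property F p r (dir p (\<gamma> n))" for n by (rule qc_property_geodesic[OF qc p G r])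
  show ?thesis
  proof (cases "sdirs p F = {}")
    case True
    have "\<forall>n. \<exists>\<sigma>. \<sigma> \<in> mg p r \<and> 0 \<le> cos (dird p (dir p (\<gamma> n)) (dir p \<sigma>))"
      using cond True unfolding qc_property_def dirs_to_def by auto
    from choice[OF this] obtain \<sigma> where \<sigma>: "\<forall>n. \<sigma> n \<in> mg p r \<and> 0 \<le> cos (dird p (dir p (\<gamma> n)) (dir p (\<sigma> n)))" by (elim exE)
    have \<sigma>mg: "\<sigma> n \<in> mg p r" for n using \<sigma> by simp
    obtain \<sigma>' where \<sigma>': "\<sigma>' \<in> mg p r" "((\<lambda>n. dird p (dir p (\<sigma> n)) (dir p \<sigma>')) \<longlongrightarrow> 0) ultra"
      by (rule mg_ultralimit[OF M \<sigma>mg])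
    have "0 \<le> cos (dird p \<eta> (dir p \<sigma>'))"
    proof (rule tendsto_lowerbound)
      show "((\<lambda>n. cos (dird p (dir p (\<gamma> n)) (dir p (\<sigma> n)))) \<longlongrightarrow> cos (dird p \<eta> (dir p \<sigma>'))) ultra"
        by (intro tendsto_cos dird_tendsto \<gamma>lim \<sigma>'(2) \<eta> dir_in G mg_geodesic[OF \<sigma>'(1) M] mg_geodesic[OF \<sigma>mg M])
      show "eventually (\<lambda>n. 0 \<le> cos (dird p (dir p (\<gamma> n)) (dir p (\<sigma> n)))) ultra" using \<sigma> by simp
    qed simp
    with True \<sigma>'(1) show ?thesis unfolding qc_property_def dirs_to_def by auto
  next
    case False
    have "\<forall>n. \<exists>z. fst z \<in> mg p r \<and> snd z \<in> sdirs p F \<and> dird p (dir p (\<gamma> n)) (snd z) \<le> pi / 2 \<and>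
      cos (dird p (dir p (\<gamma> n)) (snd z)) * cos (dird p (dir p (fst z)) (snd z)) \<le> cos (dird p (dir p (\<gamma> n)) (dir p (fst z)))"
    proof
      fix n
      obtain \<sigma> \<xi> where "\<sigma> \<in> mg p r" "\<xi> \<in> sdirs p F" "dird p (dir p (\<gamma> n)) \<xi> \<le> pi / 2"
        "cos (dird p (dir p (\<gamma> n)) \<xi>) * cos (dird p (dir p \<sigma>) \<xi>) \<le> cos (dird p (dir p (\<gamma> n)) (dir p \<sigma>))"
        using cond[of n] False unfolding qc_property_def dirs_to_def by auto
      then show "\<exists>z. fst z \<in> mg p r \<and> snd z \<in> sdirs p F \<and> dird p (dir p (\<gamma> n)) (snd z) \<le> pi / 2 \<and>
        cos (dird p (dir p (\<gamma> n)) (snd z)) * cos (dird p (dir p (fst z)) (snd z)) \<le> cos (dird p (dir p (\<gamma> n)) (dir p (fst z)))"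
        by (intro exI[of _ "(\<sigma>, \<xi>)"]) simp
    qed
    from choice[OF this] obtain z where z: "\<forall>n. fst (z n) \<in> mg p r \<and> snd (z n) \<in> sdirs p F \<and> dird p (dir p (\<gamma> n)) (snd (z n)) \<le> pi / 2 \<and>
      cos (dird p (dir p (\<gamma> n)) (snd (z n))) * cos (dird p (dir p (fst (z n))) (snd (z n))) \<le> cos (dird p (dir p (\<gamma> n)) (dir p (fst (z n))))"
      by (elim exE)
    define \<sigma> where "\<sigma> n = fst (z n)" for n
    define \<xi> where "\<xi> n = snd (z n)" for n
    have zz: "\<sigma> n \<in> mg p r" "\<xi> n \<in> sdirs p F" "dird p (dir p (\<gamma> n)) (\<xi> n) \<le> pi / 2"
      "cos (dird p (dir p (\<gamma> n)) (\<xi> n)) * cos (dird p (dir p (\<sigma> n)) (\<xi> n)) \<le> cos (dird p (dir p (\<gamma> n)) (dir p (\<sigma> n)))" for n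
      using z by (simp_all add: \<sigma>_def \<xi>_def)
    obtain \<sigma>' where \<sigma>': "\<sigma>' \<in> mg p r" "((\<lambda>n. dird p (dir p (\<sigma> n)) (dir p \<sigma>')) \<longlongrightarrow> 0) ultra"
      by (rule mg_ultralimit[OF M zz(1)])
    note S = mg_geodesic[OF \<sigma>'(1) M, THEN dir_in] mg_geodesic[OF zz(1) M, THEN dir_in]
    have \<xi>d: "\<xi> n \<in> dirs p" for n by (rule sdirs_in[OF zz(2)])
    obtain \<xi>' where \<xi>': "\<xi>' \<in> dirs p" "((\<lambda>n. dird p (\<xi> n) \<xi>') \<longlongrightarrow> 0) ultra" by (rule dir_ultralimit[OF M(1) \<xi>d])
    have \<xi>'F: "\<xi>' \<in> sdirs p F" by (rule sdirs_ultralimit[OF FM p zz(2) \<xi>'])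
    have l1: "((\<lambda>n. dird p (dir p (\<gamma> n)) (\<xi> n)) \<longlongrightarrow> dird p \<eta> \<xi>') ultra"
      by (intro dird_tendsto \<gamma>lim \<xi>' \<eta> dir_in G \<xi>d)
    have l2: "((\<lambda>n. dird p (dir p (\<sigma> n)) (\<xi> n)) \<longlongrightarrow> dird p (dir p \<sigma>') \<xi>') ultra"
      by (intro dird_tendsto \<sigma>'(2) \<xi>' S \<xi>d)
    have l3: "((\<lambda>n. dird p (dir p (\<gamma> n)) (dir p (\<sigma> n))) \<longlongrightarrow> dird p \<eta> (dir p \<sigma>')) ultra"
      by (intro dird_tendsto \<gamma>lim \<sigma>'(2) \<eta> dir_in G S)
    have "dird p \<eta> \<xi>' \<le> pi / 2" by (rule tendsto_upperbound[OF l1]) (use zz(3) in auto)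
    moreover have "cos (dird p \<eta> \<xi>') * cos (dird p (dir p \<sigma>') \<xi>') \<le> cos (dird p \<eta> (dir p \<sigma>'))"
      by (rule tendsto_le[OF ultra_neq_bot tendsto_cos[OF l3] tendsto_mult[OF tendsto_cos[OF l1] tendsto_cos[OF l2]]])
        (use zz(4) in auto)
    ultimately show ?thesis using False \<xi>'F \<sigma>'(1) unfolding qc_property_def dirs_to_def by auto
  qed
qed

text \<open>The infimum in the definition is bounded by a single pair \<open>\<eta>\<close>,
  \<open>\<zeta>\<close>, so one geodesic from \<open>p\<close> to \<open>q\<close> is enough. The
  bound \<open>pi / 2\<close> on the angle to \<open>\<xi>\<close> excludes a negative cosine, which
  first variation would leave open.\<close>

lemma quasi_convex_if_qc_property:
  assumes cl: "closedin (mtopology_of X) F"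
    and cond: "\<And>p r \<eta>. p \<in> F \<Longrightarrow> r \<in> F - {p} \<Longrightarrow> \<eta> \<in> dirs p \<Longrightarrow> qc_property F p r \<eta>"
  shows "quasi_convex X F"
  unfolding quasi_convex_def
proof (intro conjI ballI impI cl)
  fix q p r assume q: "q \<in> M - F" and p: "p \<in> F" and near: "\<forall>x\<in>F. d q p \<le> d q x" and r: "r \<in> F - {p}"
  have FM: "F \<subseteq> M" using closedin_subset_M[OF cl] .
  have M: "p \<in> M" "q \<in> M" "p \<noteq> q" "r \<in> M" "p \<noteq> r" using FM p q r by auto
  obtain \<tau> where \<tau>: "\<tau> \<in> mg p q" using minimal_geodesic_exists[OF M(1,2)] by auto
  note G = mg_geodesic[OF \<tau> M(1-3)]
  define \<eta> where "\<eta> = dir p \<tau>"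
  have \<eta>: "\<eta> \<in> dirs p" "\<eta> \<in> dirs_to X p q" using dir_in[OF G] \<tau> by (simp_all add: \<eta>_def dirs_to_def)
  have "\<exists>\<zeta>\<in>dirs_to X p r. 0 \<le> cos (dird p \<eta> \<zeta>)"
  proof (cases "sdirs p F = {}")
    case True
    then show ?thesis using cond[OF p r \<eta>(1)] by (simp add: qc_property_def)
  next
    case False
    then obtain \<zeta> \<xi> where \<zeta>: "\<zeta> \<in> dirs_to X p r" "\<xi> \<in> sdirs p F" "dird p \<eta> \<xi> \<le> pi / 2"
      "cos (dird p \<eta> \<xi>) * cos (dird p \<zeta> \<xi>) \<le> cos (dird p \<eta> \<zeta>)"
      using cond[OF p r \<eta>(1)] by (auto simp: qc_property_def)
    have "cos (dird p \<eta> \<xi>) \<le> 0"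
      unfolding \<eta>_def using q by (intro cos_nearest_direction[OF FM p M(2) _ near \<tau> \<zeta>(2)]) simp
    moreover have "0 \<le> cos (dird p \<eta> \<xi>)"
      using dird_nonneg[OF \<eta>(1) sdirs_in[OF \<zeta>(2)]] \<zeta>(3) by (intro cos_ge_zero) auto
    ultimately have "cos (dird p \<eta> \<xi>) = 0" by simp
    with \<zeta> show ?thesis by (intro bexI[of _ \<zeta>]) simp_all
  qed
  then obtain \<zeta> where \<zeta>: "\<zeta> \<in> dirs_to X p r" "0 \<le> cos (dird p \<eta> \<zeta>)" by auto
  have \<zeta>d: "\<zeta> \<in> dirs p" by (rule dirs_to_in[OF M(1,4,5) \<zeta>(1)])
  have "dir_set_dist X p (dirs_to X p q) (dirs_to X p r) \<le> dird p \<eta> \<zeta>"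
    unfolding dir_set_dist_def
  proof (rule cInf_lower)
    show "bdd_below {dird p \<alpha> \<beta> |\<alpha> \<beta>. \<alpha> \<in> dirs_to X p q \<and> \<beta> \<in> dirs_to X p r}"
      using dirs_to_in[OF M(1-3)] dirs_to_in[OF M(1,4,5)] dird_nonneg by (intro bdd_belowI[of _ 0]) auto
  qed (use \<eta> \<zeta> in auto)
  also have "\<dots> \<le> pi / 2"
    using dird_nonneg[OF \<eta>(1) \<zeta>d] dird_le_pi[OF \<eta>(1) \<zeta>d] \<zeta>(2) by (intro cos_nonneg_le_half_pi) auto
  finally show "dir_set_dist X p (dirs_to X p q) (dirs_to X p r) \<le> pi / 2" .
qed

end

theorem theoremA:
  fixes X :: "'a metric" and k :: real and F :: "'a set"
  assumes "X \<in> Alex k"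
    and "closedin (mtopology_of X) F"
  shows "quasi_convex X F \<longleftrightarrow>
    (\<forall>p \<in> F. \<forall>r \<in> F. p \<noteq> r \<longrightarrow>
      (\<forall>\<eta> \<in> directions X p.
        if directions_of_subset X p F = {}
        then \<exists>\<zeta> \<in> dirs_to X p r. cos (dir_dist X p \<eta> \<zeta>) \<ge> 0
        else \<exists>\<zeta> \<in> dirs_to X p r. \<exists>\<xi> \<in> directions_of_subset X p F.
               dir_dist X p \<eta> \<xi> \<le> pi / 2 \<and>
               cos (dir_dist X p \<eta> \<zeta>) \<ge> cos (dir_dist X p \<eta> \<xi>) * cos (dir_dist X p \<zeta> \<xi>)))"
proof -
  interpret alexandrov X k using assms(1) by unfold_locales
  have "quasi_convex X F \<longleftrightarrow> (\<forall>p \<in> F. \<forall>r \<in> F. p \<noteq> r \<longrightarrow> (\<forall>\<eta> \<in> directions X p. qc_property F p r \<eta>))"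
  proof
    assume "quasi_convex X F"
    then show "\<forall>p \<in> F. \<forall>r \<in> F. p \<noteq> r \<longrightarrow> (\<forall>\<eta> \<in> directions X p. qc_property F p r \<eta>)"
      by (intro ballI impI qc_property_if_quasi_convex) auto
  next
    assume "\<forall>p \<in> F. \<forall>r \<in> F. p \<noteq> r \<longrightarrow> (\<forall>\<eta> \<in> directions X p. qc_property F p r \<eta>)"
    then show "quasi_convex X F" by (intro quasi_convex_if_qc_property[OF assms(2)]) force
  qed
  then show ?thesis unfolding qc_property_def .
qed

end
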